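(* Assume the setting below, with (A) there is $p_0>1$ with $\liminf_{i\to\infty}\frac{a_i}{\theta_i}\frac{\Delta_i^{(p_0)}}{i^{p_0}}>0$, and (K) there are $\kappa>0$, $\alpha\in(0,1)$ with $k_{i,j}\le\kappa((1+\theta_i)^\alpha+(1+\theta_j)^\alpha)$ for all $i,j\ge1$. Let $p>1$. Then for each $f_0\in X_{p,\alpha}^+$ there is $T=T(f_0)>0$ such that the problem $$\frac{df_i}{dt}=g_{i-1}f_{i-1}-g_if_i+d_{i+1}f_{i+1}-d_if_i-s_if_i-a_if_i+\sum_{j=i+1}^\infty a_jb_{i,j}f_j+\frac12\sum_{j=1}^{i-1}k_{i-j,j}f_{i-j}f_j-\sum_{j=1}^\infty k_{i,j}f_if_j,\quad f_i(0)=f_{0,i},$$ has a unique non-negative classical solution $f\in C([0,T],X_{p,\alpha})\cap C^1((0,T),X_p)\cap C((0,T),X_{p,1})$.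
   Context: Setting: $(g_i),(d_i),(s_i),(a_i)$ nonnegative sequences, $(b_{i,j}),(k_{i,j})$ nonnegative arrays, $a_1=0$, $a_i>0$ ($i\ge2$), $b_{i,j}=0$ for $i\ge j$, $\sum_{i=1}^{j-1}ib_{i,j}=j$ ($j\ge2$); $g_0=0$ and the index-$0$ term vanishes; $\theta_i=a_i+g_i+d_i+s_i$; $\Delta_i^{(p)}=i^p-\sum_{j=1}^{i-1}j^pb_{j,i}$. $X_p$: sequences with $\|f\|_p=\sum_{i\ge1}i^p|f_i|<\infty$; $X_{p,\beta}$ ($0<\beta\le1$): sequences with $\|f\|_{p,\beta}=\sum i^p(1+\theta_i)^\beta|f_i|<\infty$; $U^+$: nonnegative elements of $U$. Let $[Y_pf]_i=-\theta_if_i+g_{i-1}f_{i-1}+d_{i+1}f_{i+1}+\sum_{j>i}a_jb_{i,j}f_j$ (domain $X_{p,1}$) and $F(f)_i=\frac12\sum_{j=1}^{i-1}k_{i-j,j}f_{i-j}f_j-\sum_jk_{i,j}f_if_j$. A classical solution on $[0,T]$ is $f\in C([0,T],X_{p,\alpha})\cap C^1((0,T),X_p)$ with $f(t)\in X_{p,1}$ for $t\in(0,T)$, $f'(t)=Y_pf(t)+F(f(t))$ in $X_p$ for $t\in(0,T)$, and $f(0)=f_0$. *)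

theory Defs
  imports "HOL-Analysis.Analysis"
begin

text \<open>Sequences are represented as functions nat => real; only the indices i >= 1
  carry information.  Convention: elements of the sequence spaces have value 0 at
  index 0 (so that the index-0 term vanishes and solutions are unique as functions).\<close>

definition theta :: "(nat \<Rightarrow> real) \<Rightarrow> (nat \<Rightarrow> real) \<Rightarrow> (nat \<Rightarrow> real) \<Rightarrow> (nat \<Rightarrow> real) \<Rightarrow> nat \<Rightarrow> real" where
  "theta a g d s i = a i + g i + d i + s i"

definition Delta :: "(nat \<Rightarrow> nat \<Rightarrow> real) \<Rightarrow> real \<Rightarrow> nat \<Rightarrow> real" where
  "Delta b p i = real i powr p - (\<Sum>j = 1..i - 1. real j powr p * b j i)"

text \<open>Weighted l1-norm (with values in [0, infinity], so that it is infinite exactly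
  when the sequence is not in the space).\<close>
definition enorm :: "(nat \<Rightarrow> real) \<Rightarrow> (nat \<Rightarrow> real) \<Rightarrow> ennreal" where
  "enorm w f = (\<Sum>n. ennreal (w (Suc n) * \<bar>f (Suc n)\<bar>))"

definition Xsp :: "(nat \<Rightarrow> real) \<Rightarrow> (nat \<Rightarrow> real) set" where
  "Xsp w = {f. f 0 = 0 \<and> enorm w f < \<infinity>}"

definition Xpos :: "(nat \<Rightarrow> real) \<Rightarrow> (nat \<Rightarrow> real) set" where
  "Xpos w = {f \<in> Xsp w. \<forall>i. 0 \<le> f i}"

definition wp :: "real \<Rightarrow> nat \<Rightarrow> real" where
  "wp p i = real i powr p"

definition wpb :: "real \<Rightarrow> real \<Rightarrow> (nat \<Rightarrow> real) \<Rightarrow> nat \<Rightarrow> real" where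
  "wpb p \<beta> \<theta> i = real i powr p * (1 + \<theta> i) powr \<beta>"

definition cont_in :: "(nat \<Rightarrow> real) \<Rightarrow> real set \<Rightarrow> (real \<Rightarrow> nat \<Rightarrow> real) \<Rightarrow> bool" where
  "cont_in w S u \<longleftrightarrow> (\<forall>t\<in>S. ((\<lambda>s. enorm w (\<lambda>i. u s i - u t i)) \<longlongrightarrow> 0) (at t within S))"

definition has_deriv_in :: "(nat \<Rightarrow> real) \<Rightarrow> (real \<Rightarrow> nat \<Rightarrow> real) \<Rightarrow> (nat \<Rightarrow> real) \<Rightarrow> real \<Rightarrow> bool" where
  "has_deriv_in w u D t \<longleftrightarrow>
     ((\<lambda>h. enorm w (\<lambda>i. (u (t + h) i - u t i) / h - D i)) \<longlongrightarrow> 0) (at 0)"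

definition C1_in :: "(nat \<Rightarrow> real) \<Rightarrow> real set \<Rightarrow> (real \<Rightarrow> nat \<Rightarrow> real) \<Rightarrow> bool" where
  "C1_in w S u \<longleftrightarrow> (\<exists>D. (\<forall>t\<in>S. u t \<in> Xsp w \<and> D t \<in> Xsp w \<and> has_deriv_in w u (D t) t)
                        \<and> cont_in w S u \<and> cont_in w S D)"

definition Yop :: "(nat \<Rightarrow> real) \<Rightarrow> (nat \<Rightarrow> nat \<Rightarrow> real) \<Rightarrow> (nat \<Rightarrow> real) \<Rightarrow> (nat \<Rightarrow> real)
    \<Rightarrow> (nat \<Rightarrow> real) \<Rightarrow> (nat \<Rightarrow> real) \<Rightarrow> nat \<Rightarrow> real" where
  "Yop a b g d s f i = (if i = 0 then 0 else
      - theta a g d s i * f i + g (i - 1) * f (i - 1) + d (i + 1) * f (i + 1)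
      + (\<Sum>n. a (i + 1 + n) * b i (i + 1 + n) * f (i + 1 + n)))"

definition Fop :: "(nat \<Rightarrow> nat \<Rightarrow> real) \<Rightarrow> (nat \<Rightarrow> real) \<Rightarrow> nat \<Rightarrow> real" where
  "Fop k f i = (if i = 0 then 0 else
      (1/2) * (\<Sum>j = 1..i - 1. k (i - j) j * f (i - j) * f j)
      - (\<Sum>n. k i (Suc n) * f i * f (Suc n)))"

definition classical_sol :: "(nat \<Rightarrow> real) \<Rightarrow> (nat \<Rightarrow> nat \<Rightarrow> real) \<Rightarrow> (nat \<Rightarrow> real) \<Rightarrow> (nat \<Rightarrow> real)
    \<Rightarrow> (nat \<Rightarrow> real) \<Rightarrow> (nat \<Rightarrow> nat \<Rightarrow> real) \<Rightarrow> real \<Rightarrow> real \<Rightarrow> real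
    \<Rightarrow> (nat \<Rightarrow> real) \<Rightarrow> (real \<Rightarrow> nat \<Rightarrow> real) \<Rightarrow> bool" where
  "classical_sol a b g d s k p \<alpha> T f0 f \<longleftrightarrow>
     (\<forall>t\<in>{0..T}. f t \<in> Xsp (wpb p \<alpha> (theta a g d s)))
   \<and> cont_in (wpb p \<alpha> (theta a g d s)) {0..T} f
   \<and> C1_in (wp p) {0<..<T} f
   \<and> (\<forall>t\<in>{0<..<T}. f t \<in> Xsp (wpb p 1 (theta a g d s))
        \<and> has_deriv_in (wp p) f (\<lambda>i. Yop a b g d s (f t) i + Fop k (f t) i) t)
   \<and> f 0 = f0"

end

theory Submission
  imports Defs
begin

text \<open>
  With \<open>x\<^sub>n = (n+1)\<^sup>p f\<^sub>n\<^sub>+\<^sub>1\<close> the problem becomes a semilinear equation in the space of absolutely summable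
  sequences, and assumption (A), which by Jensen's inequality passes from \<open>p\<^sub>0\<close> to every \<open>p > 1\<close>, says
  that after a bounded shift each column of the linear part is dominated by its diagonal with a margin
  proportional to \<open>1 + \<theta>\<close>.  Neumann series give positive contractive resolvents, and the Yosida
  approximation gives a positive contraction semigroup \<open>S\<close>.  Dominance also means that the total mass
  dissipates at a rate controlling \<open>norm (Y (S t x))\<close>, whose time integral is therefore at most a multiple of
  \<open>norm x\<close>; as \<open>norm (Y (S t x))\<close> is decreasing, it is \<open>O(1/t)\<close> and \<open>S\<close> is analytic.  In weighted summable
  sequence spaces interpolation on the unit vectors then yields the smoothing estimate of order
  \<open>t powr - \<alpha>\<close> into the intermediate space.

  By (K) the coagulation operator is a bounded bilinear map from the intermediate to the basic space,
  so a mild solution is a fixed point of a contraction.  Moving a term \<open>\<gamma> (1 + \<theta>) powr \<alpha>\<close> from the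
  nonlinear to the linear part makes the nonlinearity positive on a ball, hence the solution
  nonnegative.  Comparing it with its time dilations shows that it is locally Lipschitz on \<open>(0,T]\<close>, which
  upgrades it to a classical solution; conversely classical solutions are mild, and mild solutions
  are unique.
\<close>

section \<open>Absolutely summable sequences\<close>

text \<open>The norm of \<open>ell1\<close> is additive on nonnegative elements. Hence operator
  bounds can be read off columns, and the norm of a nonnegative trajectory is the linear functional
  \<open>total\<close>, which commutes with integrals. The margin in (A) makes the graph norm of the
  linear part equivalent to the norm of X_{p,1}; this identifies the domain exactly and later gives
  continuity in X_{p,1}. The obstacle is regularity. A mild solution is a priori only continuous
  into X_{p,\<alpha>}, and continuity in time of the nonlinearity does not put its Duhamel integral
  into the domain, because \<open>norm (Y (S r x))\<close> is only of order 1/r. A Lipschitz modulus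
  cancels exactly this singularity. The damping \<gamma> has to beat the loss rate 2 \<kappa> r on
  the ball where the fixed point is sought. It therefore depends on the initial datum, and the
  semigroup is built for each datum separately; since the term is subtracted in the linear part and
  added in the nonlinear one, the equation does not see it.\<close>

typedef ell1 = "{f :: nat \<Rightarrow> real. summable (\<lambda>n. \<bar>f n\<bar>)}"
  morphisms coord Abs_ell1
  by (intro exI[of _ "\<lambda>_. 0"]) simp

lemma summable_coord: "summable (\<lambda>n. \<bar>coord x n\<bar>)"
  using coord[of x] by simp

lemma coord_Abs: "summable (\<lambda>n. \<bar>f n\<bar>) \<Longrightarrow> coord (Abs_ell1 f) = f"
  by (simp add: Abs_ell1_inverse)

lemma ell1_eqI: "(\<And>n. coord x n = coord y n) \<Longrightarrow> x = y"
  using coord_inject by blast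

lemma summable_abs_add:
  fixes f g :: "nat \<Rightarrow> real"
  assumes "summable (\<lambda>n. \<bar>f n\<bar>)" "summable (\<lambda>n. \<bar>g n\<bar>)"
  shows "summable (\<lambda>n. \<bar>f n + g n\<bar>)"
  by (rule summable_comparison_test'[OF summable_add[OF assms], of 0]) (auto intro: abs_triangle_ineq)

lemma summable_abs_mult:
  fixes f :: "nat \<Rightarrow> real"
  assumes "summable (\<lambda>n. \<bar>f n\<bar>)"
  shows "summable (\<lambda>n. \<bar>c * f n\<bar>)"
  using summable_mult[OF assms, of "\<bar>c\<bar>"] by (simp add: abs_mult)

instantiation ell1 :: real_vector
begin

definition "0 = Abs_ell1 (\<lambda>_. 0)"
definition "x + y = Abs_ell1 (\<lambda>n. coord x n + coord y n)"
definition "- x = Abs_ell1 (\<lambda>n. - coord x n)" for x :: ell1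
definition "x - y = Abs_ell1 (\<lambda>n. coord x n - coord y n)" for x :: ell1
definition "r *\<^sub>R x = Abs_ell1 (\<lambda>n. r * coord x n)" for x :: ell1

lemma coord_zero [simp]: "coord 0 n = 0"
  by (simp add: zero_ell1_def coord_Abs)

lemma coord_add [simp]: "coord (x + y) n = coord x n + coord y n"
  by (simp add: plus_ell1_def coord_Abs summable_abs_add summable_coord)

lemma coord_uminus [simp]: "coord (- x) n = - coord x n"
  by (simp add: uminus_ell1_def coord_Abs summable_coord)

lemma coord_diff [simp]: "coord (x - y) n = coord x n - coord y n"
  using summable_abs_add[of "coord x" "\<lambda>n. - coord y n"]
  by (simp add: minus_ell1_def coord_Abs summable_coord)

lemma coord_scaleR [simp]: "coord (r *\<^sub>R x) n = r * coord x n"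
  by (simp add: scaleR_ell1_def coord_Abs summable_abs_mult summable_coord)

instance
  by standard (auto intro: ell1_eqI simp: algebra_simps)

end

instantiation ell1 :: real_normed_vector
begin

definition "norm x = (\<Sum>n. \<bar>coord x n\<bar>)"
definition "sgn x = x /\<^sub>R norm x" for x :: ell1
definition "dist x y = norm (x - y)" for x :: ell1
definition "(uniformity :: (ell1 \<times> ell1) filter) = (INF e\<in>{0 <..}. principal {(x, y). dist x y < e})"
definition "open U = (\<forall>x\<in>U. eventually (\<lambda>(x', y). x' = x \<longrightarrow> y \<in> U) uniformity)" for U :: "ell1 set"

instance
proof
  fix x y :: ell1 and r :: real
  show "norm x = 0 \<longleftrightarrow> x = 0"
    unfolding norm_ell1_def
    by (subst suminf_eq_zero_iff) (auto simp: summable_coord intro: ell1_eqI)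
  show "norm (x + y) \<le> norm x + norm y"
    unfolding norm_ell1_def
    by (subst suminf_add) (auto intro!: suminf_le summable_add summable_abs_add summable_coord abs_triangle_ineq)
  show "norm (r *\<^sub>R x) = \<bar>r\<bar> * norm x"
    unfolding norm_ell1_def by (simp add: abs_mult suminf_mult summable_coord)
qed (auto simp: sgn_ell1_def dist_ell1_def uniformity_ell1_def open_ell1_def)

end

lemma sum_abs_coord_le: "finite A \<Longrightarrow> (\<Sum>n\<in>A. \<bar>coord x n\<bar>) \<le> norm x"
  unfolding norm_ell1_def by (rule sum_le_suminf) (auto simp: summable_coord)

lemma abs_coord_le: "\<bar>coord x n\<bar> \<le> norm x"
  using sum_abs_coord_le[of "{n}" x] by simp

lemma norm_ell1_le:
  assumes "\<And>N. (\<Sum>n<N. \<bar>coord x n\<bar>) \<le> C"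
  shows "norm x \<le> C"
  unfolding norm_ell1_def using assms by (intro suminf_le_const summable_coord)

lemma summable_absI:
  fixes f :: "nat \<Rightarrow> real"
  assumes "\<And>N. (\<Sum>n<N. \<bar>f n\<bar>) \<le> C"
  shows "summable (\<lambda>n. \<bar>f n\<bar>)"
proof (rule bounded_imp_summable)
  show "(\<Sum>k\<le>n. \<bar>f k\<bar>) \<le> C" for n
    using assms[of "Suc n"] by (simp only: lessThan_Suc_atMost)
qed simp

lemma bounded_linear_coord: "bounded_linear (\<lambda>x. coord x n)"
  by (rule bounded_linear_intro[of _ 1]) (auto simp: abs_coord_le)

lemma coord_sum: "coord (sum f A) n = (\<Sum>i\<in>A. coord (f i) n)"
  using linear_sum[OF bounded_linear.linear[OF bounded_linear_coord[of n]], of f A] .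

instance ell1 :: banach
proof
  fix X :: "nat \<Rightarrow> ell1"
  assume X: "Cauchy X"
  have "Cauchy (\<lambda>m. coord (X m) n)" for n
    by (rule bounded_linear.Cauchy[OF bounded_linear_coord X])
  then have "\<exists>L. (\<lambda>m. coord (X m) n) \<longlonglongrightarrow> L" for n
    by (simp add: Cauchy_convergent_iff convergent_def)
  then obtain L where L: "\<And>n. (\<lambda>m. coord (X m) n) \<longlonglongrightarrow> L n"
    by metis
  \<comment> \<open>Only finite partial sums pass to the coordinatewise limit; a bound uniform in N
    then yields both summability of L and convergence in norm.\<close>
  have close: "\<exists>M. \<forall>m\<ge>M. \<forall>N. (\<Sum>n<N. \<bar>coord (X m) n - L n\<bar>) \<le> e" if "e > 0" for e :: real
  proof -
    obtain M where M: "\<And>m k. m \<ge> M \<Longrightarrow> k \<ge> M \<Longrightarrow> norm (X m - X k) < e"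
      using CauchyD[OF X \<open>e > 0\<close>] by blast
    have "(\<Sum>n<N. \<bar>coord (X m) n - L n\<bar>) \<le> e" if "m \<ge> M" for m N
    proof (rule LIMSEQ_le_const2)
      show "(\<lambda>k. \<Sum>n<N. \<bar>coord (X m) n - coord (X k) n\<bar>) \<longlonglongrightarrow> (\<Sum>n<N. \<bar>coord (X m) n - L n\<bar>)"
        by (intro tendsto_intros L)
      have "(\<Sum>n<N. \<bar>coord (X m) n - coord (X k) n\<bar>) \<le> e" if "k \<ge> M" for k
        using sum_abs_coord_le[of "{..<N}" "X m - X k"] M[OF \<open>m \<ge> M\<close> that] by simp
      then show "\<exists>M. \<forall>k\<ge>M. (\<Sum>n<N. \<bar>coord (X m) n - coord (X k) n\<bar>) \<le> e"
        by blast
    qed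
    then show ?thesis by blast
  qed
  obtain M where M: "\<And>N. (\<Sum>n<N. \<bar>coord (X M) n - L n\<bar>) \<le> 1"
    using close[of 1] by auto
  have "summable (\<lambda>n. \<bar>coord (X M) n - L n\<bar>)"
    by (rule summable_absI[OF M])
  then have "summable (\<lambda>n. \<bar>- (coord (X M) n - L n) + coord (X M) n\<bar>)"
    by (intro summable_abs_add) (simp_all only: abs_minus_cancel summable_coord)
  then have sL: "summable (\<lambda>n. \<bar>L n\<bar>)"
    by simp
  have "X \<longlonglongrightarrow> Abs_ell1 L"
  proof (rule LIMSEQ_I)
    fix r :: real assume "r > 0"
    then obtain M where M: "\<And>m N. m \<ge> M \<Longrightarrow> (\<Sum>n<N. \<bar>coord (X m) n - L n\<bar>) \<le> r / 2"
      using close[of "r / 2"] by auto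
    have "norm (X m - Abs_ell1 L) \<le> r / 2" if "m \<ge> M" for m
      using M[OF that] by (intro norm_ell1_le) (simp add: coord_Abs sL)
    then show "\<exists>no. \<forall>n\<ge>no. norm (X n - Abs_ell1 L) < r"
      using \<open>r > 0\<close> by (intro exI[of _ M]) (smt (verit) field_sum_of_halves)
  qed
  then show "convergent X"
    by (auto simp: convergent_def)
qed

section \<open>Unit vectors, matrices given by their columns, truncations\<close>

definition unit :: "nat \<Rightarrow> ell1" where
  "unit m = Abs_ell1 (\<lambda>n. if n = m then 1 else 0)"

lemma coord_unit: "coord (unit m) n = (if n = m then 1 else 0)"
proof -
  have "summable (\<lambda>n. \<bar>if n = m then 1 else 0 :: real\<bar>)"
    by (rule summable_finite[of "{m}"]) auto
  then show ?thesis
    by (simp add: unit_def coord_Abs)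
qed

lemma norm_unit [simp]: "norm (unit m) = 1"
proof (rule antisym)
  show "norm (unit m) \<le> 1"
    by (rule norm_ell1_le) (simp add: coord_unit sum.If_cases flip: if_distrib[of abs] cong: if_cong)
  show "1 \<le> norm (unit m)"
    using abs_coord_le[of "unit m" m] by (simp add: coord_unit)
qed

text \<open>Excludes the zero space, so that the operator algebra below has
  \<open>norm 1 = 1\<close>.\<close>

instance ell1 :: perfect_space
proof
  fix x :: ell1
  show "\<not> open {x}"
  proof
    assume "open {x}"
    then obtain e where e: "e > 0" "ball x e \<subseteq> {x}"
      by (meson openE singletonI)
    have "x + (e/2) *\<^sub>R unit 0 \<in> ball x e"
      using e(1) by (simp add: dist_norm)
    then have "(e/2) *\<^sub>R unit 0 = 0"
      using e(2) by auto
    then show False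
      using e(1) norm_unit[of 0] by (metis less_irrefl half_gt_zero_iff norm_zero scaleR_eq_0_iff zero_neq_one)
  qed
qed

text \<open>The matrix with columns \<open>v m\<close> applied to x. On l^1 its operator norm is the
  supremum of the column norms. Unbounded columns are allowed as well; the value is then meaningful
  for those x that make the weighted series converge.\<close>

definition colsum :: "(nat \<Rightarrow> ell1) \<Rightarrow> ell1 \<Rightarrow> ell1" where
  "colsum v x = (\<Sum>m. coord x m *\<^sub>R v m)"

lemma
  assumes "summable (\<lambda>m. \<bar>coord x m\<bar> * norm (v m))"
  shows summable_colsum: "summable (\<lambda>m. coord x m *\<^sub>R v m)"
    and norm_colsum_le: "norm (colsum v x) \<le> (\<Sum>m. \<bar>coord x m\<bar> * norm (v m))"
    and summable_coord_colsum: "summable (\<lambda>m. coord x m * coord (v m) n)"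
    and coord_colsum: "coord (colsum v x) n = (\<Sum>m. coord x m * coord (v m) n)"
proof -
  have s: "summable (\<lambda>m. norm (coord x m *\<^sub>R v m))"
    using assms by simp
  show *: "summable (\<lambda>m. coord x m *\<^sub>R v m)"
    by (rule summable_norm_cancel[OF s])
  show "norm (colsum v x) \<le> (\<Sum>m. \<bar>coord x m\<bar> * norm (v m))"
    using summable_norm[OF s] by (simp add: colsum_def)
  show "summable (\<lambda>m. coord x m * coord (v m) n)"
    using bounded_linear.summable[OF bounded_linear_coord *, of n] by simp
  show "coord (colsum v x) n = (\<Sum>m. coord x m * coord (v m) n)"
    using bounded_linear.suminf[OF bounded_linear_coord *, of n] by (simp add: colsum_def)
qed

lemma summable_coord_bounded:
  assumes "\<And>m. norm (v m) \<le> C"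
  shows "summable (\<lambda>m. \<bar>coord x m\<bar> * norm (v m))"
  by (rule summable_comparison_test'[OF summable_mult2[OF summable_coord[of x], of C], of 0])
    (auto intro!: mult_left_mono assms simp: abs_mult)

lemma norm_colsum_bounded:
  assumes "\<And>m. norm (v m) \<le> C"
  shows "norm (colsum v x) \<le> C * norm x"
proof -
  have "norm (colsum v x) \<le> (\<Sum>m. \<bar>coord x m\<bar> * norm (v m))"
    by (rule norm_colsum_le[OF summable_coord_bounded[OF assms]])
  also have "\<dots> \<le> (\<Sum>m. \<bar>coord x m\<bar> * C)"
    by (rule suminf_le) (auto intro!: mult_left_mono assms summable_coord_bounded summable_mult2 summable_coord)
  also have "\<dots> = C * norm x"
    by (subst suminf_mult2[symmetric]) (simp_all add: summable_coord norm_ell1_def mult.commute)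
  finally show ?thesis .
qed

lemma bounded_linear_colsum:
  assumes "\<And>m. norm (v m) \<le> C"
  shows "bounded_linear (colsum v)"
proof (rule bounded_linear_intro[of _ C])
  note s = summable_colsum[OF summable_coord_bounded[OF assms]]
  show "colsum v (x + y) = colsum v x + colsum v y" for x y
    unfolding colsum_def by (subst suminf_add[OF s s]) (simp add: scaleR_add_left)
  show "colsum v (r *\<^sub>R x) = r *\<^sub>R colsum v x" for r x
    unfolding colsum_def by (subst suminf_scaleR_right[OF s]) simp
  show "norm (colsum v x) \<le> norm x * C" for x
    using norm_colsum_bounded[OF assms] by (simp add: mult.commute)
qed

lemma colsum_unit [simp]: "colsum unit x = x"
proof (rule ell1_eqI)
  fix n
  have "coord (colsum unit x) n = (\<Sum>m. coord x m * coord (unit m) n)"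
    by (rule coord_colsum[OF summable_coord_bounded[of _ 1]]) simp
  also have "\<dots> = (\<Sum>m. if m = n then coord x n else 0)"
    by (rule suminf_cong) (simp add: coord_unit)
  finally show "coord (colsum unit x) n = coord x n"
    using sums_unique[OF sums_single[of n "\<lambda>_. coord x n"]] by simp
qed

definition trunc :: "nat \<Rightarrow> ell1 \<Rightarrow> ell1" where
  "trunc N x = (\<Sum>m<N. coord x m *\<^sub>R unit m)"

lemma coord_trunc: "coord (trunc N x) n = (if n < N then coord x n else 0)"
proof -
  have "coord (trunc N x) n = (\<Sum>m<N. if m = n then coord x n else 0)"
    unfolding trunc_def coord_sum by (rule sum.cong) (simp_all add: coord_unit)
  then show ?thesis by simp
qed

lemma trunc_tendsto: "(\<lambda>N. trunc N x) \<longlonglongrightarrow> x"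
  using summable_LIMSEQ[OF summable_colsum[OF summable_coord_bounded[of unit 1]], of x]
  by (simp add: trunc_def colsum_unit[unfolded colsum_def])

section \<open>The positive cone, total mass and positive parts\<close>

definition nonneg :: "ell1 \<Rightarrow> bool" where
  "nonneg x \<longleftrightarrow> (\<forall>n. 0 \<le> coord x n)"

text \<open>Agrees with the norm on the cone but is linear, so it can be moved through the generator
  and through integrals.\<close>

definition total :: "ell1 \<Rightarrow> real" where
  "total x = (\<Sum>n. coord x n)"

lemma summable_coord': "summable (coord x)"
  using summable_rabs_cancel[OF summable_coord] .

lemma bounded_linear_total: "bounded_linear total"
proof (rule bounded_linear_intro[of _ 1])
  show "norm (total x) \<le> norm x * 1" for x
    using summable_rabs[OF summable_coord[of x]] by (simp add: total_def norm_ell1_def)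
qed (simp_all add: total_def suminf_add suminf_mult summable_coord')

lemma norm_nonneg: "nonneg x \<Longrightarrow> norm x = total x"
  by (simp add: norm_ell1_def total_def nonneg_def)

lemma nonneg_add: "nonneg x \<Longrightarrow> nonneg y \<Longrightarrow> nonneg (x + y)"
  by (simp add: nonneg_def)

lemma nonneg_scaleR: "nonneg x \<Longrightarrow> 0 \<le> r \<Longrightarrow> nonneg (r *\<^sub>R x)"
  by (simp add: nonneg_def)

lemma nonneg_zero [simp]: "nonneg 0"
  by (simp add: nonneg_def)

lemma nonneg_unit [simp]: "nonneg (unit m)"
  by (simp add: nonneg_def coord_unit)

lemma closed_nonneg: "closed {x. nonneg x}"
  unfolding nonneg_def Collect_all_eq
  by (intro closed_INT ballI closed_Collect_le linear_continuous_on bounded_linear_coord continuous_on_const)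

lemma nonneg_colsum:
  assumes "summable (\<lambda>m. \<bar>coord x m\<bar> * norm (v m))" "nonneg x" "\<And>m. nonneg (v m)"
  shows "nonneg (colsum v x)"
  using assms summable_coord_colsum[OF assms(1)] unfolding nonneg_def
  by (auto simp: coord_colsum[OF assms(1)] intro!: suminf_nonneg)

definition pos_part :: "ell1 \<Rightarrow> ell1" where
  "pos_part x = Abs_ell1 (\<lambda>n. max 0 (coord x n))"

lemma coord_pos_part: "coord (pos_part x) n = max 0 (coord x n)"
proof -
  have "summable (\<lambda>n. \<bar>max 0 (coord x n)\<bar>)"
    by (rule summable_comparison_test'[OF summable_coord[of x], of 0]) auto
  then show ?thesis by (simp add: pos_part_def coord_Abs)
qed

lemma nonneg_pos_part [simp]: "nonneg (pos_part x)"
  by (simp add: nonneg_def coord_pos_part)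

lemma pos_part_diff: "x = pos_part x - pos_part (- x)"
  by (rule ell1_eqI) (auto simp: coord_pos_part)

text \<open>Because of this equality, estimates proved on the cone extend to all vectors with the
  same constant.\<close>

lemma norm_pos_part: "norm (pos_part x) + norm (pos_part (- x)) = norm x"
  unfolding norm_ell1_def
  by (subst suminf_add[OF summable_coord summable_coord]) (auto simp: coord_pos_part intro!: suminf_cong)

section \<open>The Banach algebra of bounded operators\<close>

text \<open>A copy of the bounded operators on a single space, because \<^typ>\<open>'a \<Rightarrow>\<^sub>L 'b\<close> with two
  type parameters cannot be made an algebra, and the exponential series needs one.\<close>

typedef (overloaded) 'a endo = "UNIV :: ('a::real_normed_vector \<Rightarrow>\<^sub>L 'a) set"
  morphisms blin Endo ..

setup_lifting type_definition_endo

instantiation endo :: ("{real_normed_vector, perfect_space}") real_algebra_1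
begin

lift_definition zero_endo :: "'a endo" is 0 .
lift_definition one_endo :: "'a endo" is id_blinfun .
lift_definition plus_endo :: "'a endo \<Rightarrow> 'a endo \<Rightarrow> 'a endo" is "(+)" .
lift_definition minus_endo :: "'a endo \<Rightarrow> 'a endo \<Rightarrow> 'a endo" is "(-)" .
lift_definition uminus_endo :: "'a endo \<Rightarrow> 'a endo" is uminus .
lift_definition times_endo :: "'a endo \<Rightarrow> 'a endo \<Rightarrow> 'a endo" is "(o\<^sub>L)" .
lift_definition scaleR_endo :: "real \<Rightarrow> 'a endo \<Rightarrow> 'a endo" is "(*\<^sub>R)" .

instance
proof
  show "(0 :: 'a endo) \<noteq> 1"
  proof
    assume "(0 :: 'a endo) = 1"
    then have "(0 :: 'a \<Rightarrow>\<^sub>L 'a) = id_blinfun"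
      by transfer
    then show False
      using norm_blinfun_id[where 'a = 'a] by (metis norm_zero zero_neq_one)
  qed
qed (transfer; auto intro!: blinfun_eqI simp: blinfun.bilinear_simps algebra_simps)+

end

instantiation endo :: ("{real_normed_vector, perfect_space}") real_normed_algebra_1
begin

lift_definition norm_endo :: "'a endo \<Rightarrow> real" is norm .
definition "sgn A = A /\<^sub>R norm A" for A :: "'a endo"
definition "dist A B = norm (A - B)" for A :: "'a endo"
definition "(uniformity :: ('a endo \<times> 'a endo) filter) = (INF e\<in>{0 <..}. principal {(x, y). dist x y < e})"
definition "open U = (\<forall>x\<in>U. eventually (\<lambda>(x', y). x' = x \<longrightarrow> y \<in> U) uniformity)" for U :: "'a endo set"

instance
proof
  fix A B :: "'a endo" and r :: real
  show "norm (A + B) \<le> norm A + norm B"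
    by transfer (rule norm_triangle_ineq)
  show "norm (A * B) \<le> norm A * norm B"
    by transfer (rule norm_blinfun_compose)
  show "norm (r *\<^sub>R A) = \<bar>r\<bar> * norm A"
    by transfer simp
  show "norm A = 0 \<longleftrightarrow> A = 0"
    by transfer simp
  show "norm (1 :: 'a endo) = 1"
    by transfer simp
qed (auto simp: sgn_endo_def dist_endo_def uniformity_endo_def open_endo_def)

end

instance endo :: ("{banach, perfect_space}") banach
proof
  fix X :: "nat \<Rightarrow> 'a endo"
  assume X: "Cauchy X"
  have d: "dist (blin A) (blin B) = dist A B" for A B :: "'a endo"
    unfolding dist_endo_def dist_norm by transfer simp
  have "Cauchy (\<lambda>n. blin (X n))"
    using X by (simp add: Cauchy_def d)
  then obtain L where L: "(\<lambda>n. blin (X n)) \<longlonglongrightarrow> L"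
    by (auto simp: Cauchy_convergent_iff convergent_def)
  have "dist (X n) (Endo L) = dist (blin (X n)) L" for n
    by (simp add: d[symmetric] Endo_inverse)
  then have "X \<longlonglongrightarrow> Endo L"
    using L by (simp add: tendsto_iff)
  then show "convergent X"
    by (auto simp: convergent_def)
qed

lift_definition app :: "'a::{real_normed_vector, perfect_space} endo \<Rightarrow> 'a \<Rightarrow> 'a" is blinfun_apply .

lift_definition endo_of :: "('a::{real_normed_vector, perfect_space} \<Rightarrow> 'a) \<Rightarrow> 'a endo" is Blinfun .

lemma app_endo_of: "bounded_linear f \<Longrightarrow> app (endo_of f) x = f x"
  by transfer (simp add: bounded_linear_Blinfun_apply)

lemma endo_eqI: "(\<And>x. app A x = app B x) \<Longrightarrow> A = B"
  by transfer (rule blinfun_eqI)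

lemma bounded_bilinear_app: "bounded_bilinear app"
  by (rule bounded_bilinear.intro; (intro exI[of _ 1])?; transfer)
    (auto simp: blinfun.bilinear_simps norm_blinfun)

interpretation app: bounded_bilinear app
  by (rule bounded_bilinear_app)

declare app.zero_right [simp]

lemma norm_app: "norm (app A x) \<le> norm A * norm x"
  by transfer (rule norm_blinfun)

lemma norm_app_le: "norm A \<le> C \<Longrightarrow> norm (app A x) \<le> C * norm x"
  using norm_app[of A x] by (meson mult_right_mono norm_ge_zero order_trans)

lemma norm_app_contr: "norm A \<le> 1 \<Longrightarrow> norm (app A x) \<le> norm x"
  using norm_app_le[of A 1 x] by simp

lemma app_mult [simp]: "app (A * B) x = app A (app B x)"
  by transfer simp

lemma app_one [simp]: "app 1 x = x"
  by transfer simp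

lemma norm_endo_le: "0 \<le> C \<Longrightarrow> (\<And>x. norm (app A x) \<le> C * norm x) \<Longrightarrow> norm A \<le> C"
  by transfer (rule norm_blinfun_bound)

lemma app_commute: "A * B = B * A \<Longrightarrow> app A (app B x) = app B (app A x)"
  by (metis app_mult)

section \<open>Contraction semigroups from resolvents\<close>

lemma commuting_exp:
  fixes X :: "'a::{real_normed_algebra_1, banach}"
  assumes "X * B = B * X"
  shows "exp X * B = B * exp X"
proof -
  have "exp X * B = (\<Sum>n. X ^ n /\<^sub>R fact n * B)"
    unfolding exp_def by (rule suminf_mult2[OF summable_exp_generic])
  also have "\<dots> = (\<Sum>n. B * (X ^ n /\<^sub>R fact n))"
    by (rule suminf_cong) (simp add: power_commuting_commutes[OF assms])
  also have "\<dots> = B * exp X"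
    unfolding exp_def by (rule suminf_mult[OF summable_exp_generic])
  finally show ?thesis .
qed

text \<open>Along \<open>H\<close> the derivative is, by commutation, a contraction applied to
  \<open>app A x - app B x\<close>. Only the action on x enters, not the operator norms, so the
  bound survives for approximations of an unbounded operator.\<close>

lemma norm_exp_diff_app_le:
  fixes A B :: "'a::{banach, perfect_space} endo"
  assumes AB: "A * B = B * A" and t: "0 \<le> t"
    and A: "\<And>s. 0 \<le> s \<Longrightarrow> norm (exp (s *\<^sub>R A)) \<le> 1"
    and B: "\<And>s. 0 \<le> s \<Longrightarrow> norm (exp (s *\<^sub>R B)) \<le> 1"
  shows "norm (app (exp (t *\<^sub>R A)) x - app (exp (t *\<^sub>R B)) x) \<le> t * norm (app A x - app B x)"
proof -
  define H where "H s = exp (s *\<^sub>R A) * exp ((t - s) *\<^sub>R B)" for s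
  have BA: "exp (r *\<^sub>R B) * A = A * exp (r *\<^sub>R B)" for r
    by (rule commuting_exp) (simp add: AB)
  have d: "((\<lambda>s. app (H s) x) has_vector_derivative app (H s) (app A x - app B x)) (at s within {0..t})" for s
  proof -
    have "((\<lambda>s. exp ((t - s) *\<^sub>R B)) has_vector_derivative (- 1) *\<^sub>R (exp ((t - s) *\<^sub>R B) * B)) (at s within {0..t})"
      by (rule vector_diff_chain_within[of "\<lambda>s. t - s" _ _ _ "\<lambda>s. exp (s *\<^sub>R B)", unfolded o_def])
        (auto intro!: derivative_eq_intros exp_scaleR_has_vector_derivative_right)
    then have "(H has_vector_derivative exp (s *\<^sub>R A) * ((- 1) *\<^sub>R (exp ((t - s) *\<^sub>R B) * B))
        + (exp (s *\<^sub>R A) * A) * exp ((t - s) *\<^sub>R B)) (at s within {0..t})"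
      unfolding H_def
      by (intro has_vector_derivative_mult exp_scaleR_has_vector_derivative_right)
    moreover have "exp (s *\<^sub>R A) * ((- 1) *\<^sub>R (exp ((t - s) *\<^sub>R B) * B))
        + (exp (s *\<^sub>R A) * A) * exp ((t - s) *\<^sub>R B) = H s * (A - B)"
      using BA[of "t - s"] by (simp add: H_def algebra_simps)
    ultimately have "(H has_vector_derivative H s * (A - B)) (at s within {0..t})"
      by simp
    from bounded_linear.has_vector_derivative[OF app.bounded_linear_left this]
    show ?thesis
      by (simp add: app.diff_left)
  qed
  have "((\<lambda>s. app (H s) (app A x - app B x)) has_integral (app (H t) x - app (H 0) x)) {0..t}"
    by (rule fundamental_theorem_of_calculus[OF t d])
  then have "norm (app (H t) x - app (H 0) x) \<le> norm (app A x - app B x) * measure lborel {0..t}"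
  proof (rule has_integral_bound_real[where S = "{}", rotated 2])
    fix s assume "s \<in> {0..t} - {}"
    then have s: "0 \<le> s" "s \<le> t" by auto
    have "norm (H s) \<le> norm (exp (s *\<^sub>R A)) * norm (exp ((t - s) *\<^sub>R B))"
      unfolding H_def by (rule norm_mult_ineq)
    also have "\<dots> \<le> 1"
      using A[of s] B[of "t - s"] s by (simp add: mult_le_one)
    finally show "norm (app (H s) (app A x - app B x)) \<le> norm (app A x - app B x)"
      by (rule norm_app_contr)
  qed auto
  then show ?thesis
    using t by (simp add: H_def mult.commute)
qed

text \<open>The Hille-Yosida hypotheses with contractive resolvents. \<open>Y\<close> is a bare
  function; its linearity on D and the commutation of the resolvents are derived from
  \<open>Y_R\<close> and \<open>R_Y\<close>, D being the range of \<open>R 1\<close>.\<close>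

locale resolvent_family =
  fixes D :: "'a::{banach, perfect_space} set" and Y :: "'a \<Rightarrow> 'a" and R :: "real \<Rightarrow> 'a endo"
  assumes R_dom: "0 < l \<Longrightarrow> app (R l) x \<in> D"
    and Y_R: "0 < l \<Longrightarrow> Y (app (R l) x) = l *\<^sub>R app (R l) x - x"
    and R_Y: "0 < l \<Longrightarrow> x \<in> D \<Longrightarrow> app (R l) (l *\<^sub>R x - Y x) = x"
    and norm_R: "0 < l \<Longrightarrow> norm (R l) \<le> 1 / l"
    and dense: "closure D = UNIV"
begin

lemma D_obtain:
  assumes "x \<in> D"
  obtains z where "x = app (R 1) z" "Y x = x - z"
  using R_Y[OF _ assms, of 1] by (metis add_diff_cancel_left' diff_add_cancel scaleR_one zero_less_one)

lemma D_Y_add: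
  assumes "x \<in> D" "y \<in> D"
  shows "x + y \<in> D \<and> Y (x + y) = Y x + Y y"
proof -
  obtain z w where z: "x = app (R 1) z" "Y x = x - z" and w: "y = app (R 1) w" "Y y = y - w"
    using D_obtain assms by metis
  have "x + y = app (R 1) (z + w)"
    by (simp add: z w app.add_right)
  then show ?thesis
    using R_dom[of 1 "z + w"] Y_R[of 1 "z + w"] z w by simp
qed

lemma D_Y_scaleR:
  assumes "x \<in> D"
  shows "r *\<^sub>R x \<in> D \<and> Y (r *\<^sub>R x) = r *\<^sub>R Y x"
proof -
  obtain z where z: "x = app (R 1) z" "Y x = x - z"
    using D_obtain assms by metis
  have "r *\<^sub>R x = app (R 1) (r *\<^sub>R z)"
    by (simp add: z app.scaleR_right)
  then show ?thesis
    using R_dom[of 1 "r *\<^sub>R z"] Y_R[of 1 "r *\<^sub>R z"] z by (simp add: scaleR_diff_right)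
qed

lemma D_Y_diff: "x \<in> D \<Longrightarrow> y \<in> D \<Longrightarrow> x - y \<in> D \<and> Y (x - y) = Y x - Y y"
  using D_Y_add[of x "(- 1) *\<^sub>R y"] D_Y_scaleR[of y "- 1"] by simp

lemma R_commute:
  assumes "0 < l" "0 < m"
  shows "R l * R m = R m * R l"
proof (cases "l = m")
  case False
  \<comment> \<open>The resolvent identity. Exchanging l and m changes the sign of the left side,
    which forces commutation when l differs from m.\<close>
  have id: "app (R l) x - app (R m) x = (m - l) *\<^sub>R app (R l) (app (R m) x)" if "0 < l" "0 < m" for l m x
    using R_Y[OF that(1) R_dom[OF that(2), of x]]
    by (simp add: Y_R[OF that(2)] app.diff_right app.add_right app.scaleR_right algebra_simps)
  show ?thesis
  proof (rule endo_eqI)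
    fix x
    have "(m - l) *\<^sub>R app (R l) (app (R m) x) = (m - l) *\<^sub>R app (R m) (app (R l) x)"
      using id[OF assms, of x] id[OF assms(2,1), of x]
      by (metis minus_diff_eq scaleR_minus_left)
    then show "app (R l * R m) x = app (R m * R l) x"
      using False by simp
  qed
qed simp

text \<open>This is l Y R(l) for l = n + 1, expanded by \<open>Y_R\<close> so that it is visibly a
  bounded operator.\<close>

definition yosida :: "nat \<Rightarrow> 'a endo" where
  "yosida n = (real (Suc n))\<^sup>2 *\<^sub>R R (real (Suc n)) - real (Suc n) *\<^sub>R 1"

definition E :: "nat \<Rightarrow> real \<Rightarrow> 'a endo" where
  "E n t = exp (t *\<^sub>R yosida n)"

lemma yosida_commute: "yosida n * yosida m = yosida m * yosida n"
  using R_commute[of "real (Suc n)" "real (Suc m)"] by (simp add: yosida_def algebra_simps)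

lemma yosida_R_commute: "0 < l \<Longrightarrow> yosida n * R l = R l * yosida n"
  using R_commute[of "real (Suc n)" l] by (simp add: yosida_def algebra_simps)

lemma yosida_D:
  assumes "x \<in> D"
  shows "app (yosida n) x = real (Suc n) *\<^sub>R app (R (real (Suc n))) (Y x)"
proof -
  define l where "l = real (Suc n)"
  have "l *\<^sub>R app (R l) x - app (R l) (Y x) = x"
    using R_Y[of l x] assms by (simp add: l_def app.diff_right app.scaleR_right)
  then have "app (R l) (Y x) = l *\<^sub>R app (R l) x - x"
    by (metis diff_diff_eq2 add_diff_cancel_left')
  then show ?thesis
    unfolding yosida_def l_def[symmetric]
    by (simp add: app.diff_left app.scaleR_left power2_eq_square scaleR_diff_right)
qed

text \<open>Splitting off the scalar part gives contractivity, since exp (- t l) cancels exp (t l^2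
  / l). It also shows that \<open>E n t\<close> is a power series in the resolvent with nonnegative
  coefficients, the source of positivity.\<close>

lemma E_eq: "E n t = exp (- (t * real (Suc n))) *\<^sub>R exp ((t * (real (Suc n))\<^sup>2) *\<^sub>R R (real (Suc n)))"
proof -
  let ?l = "real (Suc n)"
  have "t *\<^sub>R yosida n = (t * ?l\<^sup>2) *\<^sub>R R ?l + of_real (- (t * ?l))"
    by (simp add: yosida_def scaleR_diff_right of_real_def)
  then have "E n t = exp ((t * ?l\<^sup>2) *\<^sub>R R ?l) * of_real (exp (- (t * ?l)))"
    unfolding E_def exp_of_real[symmetric]
    by (simp only:) (rule exp_add_commuting, simp add: of_real_def)
  then show ?thesis
    by (simp add: of_real_def)
qed

lemma norm_E: "0 \<le> t \<Longrightarrow> norm (E n t) \<le> 1"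
proof -
  assume t: "0 \<le> t"
  let ?l = "real (Suc n)"
  have "norm ((t * ?l\<^sup>2) *\<^sub>R R ?l) \<le> (t * ?l\<^sup>2) * (1 / ?l)"
    using t norm_R[of ?l] by (simp only: norm_scaleR) (intro mult_mono, auto)
  also have "\<dots> = t * ?l"
    by (simp add: power2_eq_square)
  finally have "norm (exp ((t * ?l\<^sup>2) *\<^sub>R R ?l)) \<le> exp (t * ?l)"
    using norm_exp order_trans exp_le_cancel_iff by meson
  then have "exp (- (t * ?l)) * norm (exp ((t * ?l\<^sup>2) *\<^sub>R R ?l)) \<le> exp (- (t * ?l)) * exp (t * ?l)"
    by (rule mult_left_mono) simp
  also have "\<dots> = 1"
    by (simp only: exp_add[symmetric]) simp
  finally show ?thesis
    unfolding E_eq by simp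
qed

lemma norm_E_diff_le:
  assumes "0 \<le> t"
  shows "norm (app (E n t) x - app (E m t) x) \<le> t * norm (app (yosida n) x - app (yosida m) x)"
  unfolding E_def
  by (rule norm_exp_diff_app_le[OF yosida_commute assms]) (use norm_E in \<open>auto simp: E_def\<close>)

lemma dense_approx: "0 < e \<Longrightarrow> \<exists>y\<in>D. norm (x - y) < e"
  using dense closure_approachable[of x D] by (auto simp: dist_norm norm_minus_commute)

text \<open>On D the error is R(l) Y y, of size 1/l; the scaled resolvents are contractions and D is
  dense.\<close>

lemma R_scaled_tendsto: "(\<lambda>n. real (Suc n) *\<^sub>R app (R (real (Suc n))) z) \<longlonglongrightarrow> z"
proof (rule LIMSEQ_I)
  fix e :: real assume "e > 0"
  define T where "T n x = real (Suc n) *\<^sub>R app (R (real (Suc n))) x" for n x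
  have T: "norm (T n x) \<le> norm x" for n x
  proof -
    define l where "l = real (Suc n)"
    have "l > 0" by (simp add: l_def)
    then show ?thesis
      using norm_app_le[OF norm_R[of l], of x] unfolding T_def l_def[symmetric] by (simp add: field_simps)
  qed
  have Td: "T n x - T n y = T n (x - y)" for n x y
    by (simp add: T_def app.diff_right scaleR_diff_right)
  obtain y where y: "y \<in> D" "norm (z - y) < e / 3"
    using dense_approx[of "e / 3"] \<open>e > 0\<close> by auto
  have Ty: "norm (T n y - y) \<le> norm (Y y) / real (Suc n)" for n
  proof -
    have "T n y - y = app (R (real (Suc n))) (Y y)"
      using R_Y[OF _ y(1), of "real (Suc n)"]
      by (simp only: T_def app.diff_right app.scaleR_right of_nat_0_less_iff zero_less_Suc)
        (metis diff_diff_eq2 add_diff_cancel_left')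
    then show ?thesis
      using norm_app_le[OF norm_R[of "real (Suc n)"], of "Y y"] by simp
  qed
  have "(\<lambda>n. norm (Y y) / real (Suc n)) \<longlonglongrightarrow> 0"
    using tendsto_mult[OF tendsto_const LIMSEQ_inverse_real_of_nat, of "norm (Y y)"]
    by (simp add: divide_inverse)
  then obtain N where N: "\<And>n. n \<ge> N \<Longrightarrow> norm (Y y) / real (Suc n) < e / 3"
    using \<open>e > 0\<close> LIMSEQ_D[of _ 0 "e / 3"] by fastforce
  have "norm (T n z - z) < e" if "n \<ge> N" for n
  proof -
    have "T n z - z = T n (z - y) + (T n y - y) + (y - z)"
      by (simp flip: Td)
    also have "norm \<dots> \<le> norm (T n (z - y)) + norm (T n y - y) + norm (y - z)"
      by (intro norm_triangle_le add_right_mono norm_triangle_ineq)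
    also have "\<dots> < e"
      using T[of n "z - y"] Ty[of n] N[OF that] y(2) norm_minus_commute[of y z] by linarith
    finally show ?thesis .
  qed
  then show "\<exists>no. \<forall>n\<ge>no. norm (real (Suc n) *\<^sub>R app (R (real (Suc n))) z - z) < e"
    unfolding T_def by blast
qed

lemma yosida_tendsto: "x \<in> D \<Longrightarrow> (\<lambda>n. app (yosida n) x) \<longlonglongrightarrow> Y x"
  by (simp only: yosida_D R_scaled_tendsto)

lemma E_uniform_Cauchy:
  assumes "0 < e" "0 \<le> T"
  shows "\<exists>N. \<forall>n\<ge>N. \<forall>m\<ge>N. \<forall>t\<in>{0..T}. norm (app (E n t) x - app (E m t) x) \<le> e"
proof -
  obtain y where y: "y \<in> D" "norm (x - y) < e / 3"
    using dense_approx[of "e / 3"] assms by auto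
  have "Cauchy (\<lambda>n. app (yosida n) y)"
    using yosida_tendsto[OF y(1)] by (rule LIMSEQ_imp_Cauchy)
  then obtain N where N: "\<And>n m. n \<ge> N \<Longrightarrow> m \<ge> N \<Longrightarrow> norm (app (yosida n) y - app (yosida m) y) < e / (3 * (T + 1))"
    using CauchyD[of _ "e / (3 * (T + 1))"] assms by force
  have "norm (app (E n t) x - app (E m t) x) \<le> e" if "n \<ge> N" "m \<ge> N" "t \<in> {0..T}" for n m t
  proof -
    have t: "0 \<le> t" "t \<le> T" using that by auto
    have "t * norm (app (yosida n) y - app (yosida m) y) \<le> (T + 1) * (e / (3 * (T + 1)))"
      using t N[OF that(1,2)] by (intro mult_mono) auto
    also have "\<dots> = e / 3"
    proof -
      have "c * (e / (3 * c)) = e / 3" if "c > 0" for c using that by simp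
      from this[of "T + 1"] show ?thesis using assms(2) by linarith
    qed
    finally have 1: "norm (app (E n t) y - app (E m t) y) \<le> e / 3"
      using norm_E_diff_le[OF t(1), of n y m] by linarith
    have "app (E n t) x - app (E m t) x =
        app (E n t) (x - y) + (app (E n t) y - app (E m t) y) + app (E m t) (y - x)"
      by (simp add: app.diff_right)
    also have "norm \<dots> \<le> norm (app (E n t) (x - y)) + norm (app (E n t) y - app (E m t) y) + norm (app (E m t) (y - x))"
      by (intro norm_triangle_le add_right_mono norm_triangle_ineq)
    also have "\<dots> \<le> e / 3 + e / 3 + e / 3"
      using 1 y(2) norm_app_contr[OF norm_E[OF t(1)], of n "x - y"] norm_app_contr[OF norm_E[OF t(1)], of m "y - x"]
      by (simp add: norm_minus_commute)
    finally show ?thesis by simp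
  qed
  then show ?thesis by blast
qed

section \<open>The semigroup as strong limit of the exponentials of the Yosida
  approximations\<close>

definition S :: "real \<Rightarrow> 'a endo" where
  "S t = endo_of (\<lambda>x. lim (\<lambda>n. app (E n t) x))"

lemma E_tendsto_lim:
  assumes "0 \<le> t"
  shows "(\<lambda>n. app (E n t) x) \<longlonglongrightarrow> lim (\<lambda>n. app (E n t) x)"
proof -
  have "Cauchy (\<lambda>n. app (E n t) x)"
  proof (rule CauchyI)
    fix e :: real assume "e > 0"
    then obtain N where "\<And>n m. n \<ge> N \<Longrightarrow> m \<ge> N \<Longrightarrow> norm (app (E n t) x - app (E m t) x) \<le> e / 2"
      using E_uniform_Cauchy[of "e / 2" t x] assms by force
    then show "\<exists>M. \<forall>m\<ge>M. \<forall>n\<ge>M. norm (app (E m t) x - app (E n t) x) < e"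
      using \<open>e > 0\<close> by (intro exI[of _ N]) (smt (verit) field_sum_of_halves)
  qed
  then show ?thesis
    by (simp add: Cauchy_convergent_iff convergent_LIMSEQ_iff)
qed

lemma norm_lim_E_le:
  assumes "0 \<le> t"
  shows "norm (lim (\<lambda>n. app (E n t) x)) \<le> norm x"
  by (rule LIMSEQ_le_const2[OF tendsto_norm[OF E_tendsto_lim[OF assms]]])
    (use norm_app_contr[OF norm_E[OF assms]] in blast)

lemma bounded_linear_lim_E:
  assumes "0 \<le> t"
  shows "bounded_linear (\<lambda>x. lim (\<lambda>n. app (E n t) x))"
proof (rule bounded_linear_intro[of _ 1])
  note L = E_tendsto_lim[OF assms]
  show "lim (\<lambda>n. app (E n t) (x + y)) = lim (\<lambda>n. app (E n t) x) + lim (\<lambda>n. app (E n t) y)" for x y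
    by (rule limI) (simp add: app.add_right tendsto_add L)
  show "lim (\<lambda>n. app (E n t) (r *\<^sub>R x)) = r *\<^sub>R lim (\<lambda>n. app (E n t) x)" for r x
    by (rule limI) (simp add: app.scaleR_right tendsto_scaleR L)
qed (use norm_lim_E_le[OF assms] in simp)

lemma E_tendsto: "0 \<le> t \<Longrightarrow> (\<lambda>n. app (E n t) x) \<longlonglongrightarrow> app (S t) x"
  using E_tendsto_lim by (simp add: S_def app_endo_of bounded_linear_lim_E)

lemma norm_S: "0 \<le> t \<Longrightarrow> norm (S t) \<le> 1"
  by (rule norm_endo_le) (auto simp: S_def app_endo_of bounded_linear_lim_E norm_lim_E_le)

lemmas norm_app_S = norm_app_contr[OF norm_S]

lemma E_uniform_limit:
  assumes "0 \<le> T"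
  shows "uniform_limit {0..T} (\<lambda>n t. app (E n t) x) (\<lambda>t. app (S t) x) sequentially"
proof (rule uniform_limitI)
  fix e :: real assume e: "e > 0"
  obtain N where N: "\<And>n m t. n \<ge> N \<Longrightarrow> m \<ge> N \<Longrightarrow> t \<in> {0..T} \<Longrightarrow> norm (app (E n t) x - app (E m t) x) \<le> e / 2"
    using E_uniform_Cauchy[of "e / 2" T x] e assms half_gt_zero by blast
  have "norm (app (E n t) x - app (S t) x) \<le> e / 2" if "n \<ge> N" "t \<in> {0..T}" for n t
  proof (rule LIMSEQ_le_const2)
    show "(\<lambda>m. norm (app (E n t) x - app (E m t) x)) \<longlonglongrightarrow> norm (app (E n t) x - app (S t) x)"
      using that by (intro tendsto_intros E_tendsto) auto
    show "\<exists>N. \<forall>m\<ge>N. norm (app (E n t) x - app (E m t) x) \<le> e / 2"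
      using N[OF that(1) _ that(2)] by blast
  qed
  then show "\<forall>\<^sub>F n in sequentially. \<forall>t\<in>{0..T}. dist (app (E n t) x) (app (S t) x) < e"
    unfolding eventually_sequentially dist_norm
    using e by (intro exI[of _ N]) (smt (verit) field_sum_of_halves)
qed

lemma S_zero [simp]: "S 0 = 1"
proof (rule endo_eqI)
  show "app (S 0) x = app 1 x" for x
    using LIMSEQ_unique[OF E_tendsto[of 0 x]] by (simp add: E_def)
qed

lemma S_add:
  assumes "0 \<le> t" "0 \<le> s"
  shows "app (S (t + s)) x = app (S t) (app (S s) x)"
proof (rule LIMSEQ_unique[OF E_tendsto])
  have E: "app (E n (t + s)) x = app (E n t) (app (E n s) x)" for n
    by (simp add: E_def scaleR_add_left exp_add_commuting flip: app_mult)
  have "(\<lambda>n. app (E n t) (app (E n s) x - app (S s) x)) \<longlonglongrightarrow> 0"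
  proof (rule tendsto_norm_zero_cancel, rule tendsto_sandwich[of "\<lambda>_. 0"])
    show "(\<lambda>n. norm (app (E n s) x - app (S s) x)) \<longlonglongrightarrow> 0"
      using E_tendsto[OF assms(2)] LIM_zero tendsto_norm_zero by blast
  qed (use norm_app_contr[OF norm_E[OF assms(1)]] in \<open>auto intro!: always_eventually\<close>)
  from tendsto_add[OF this E_tendsto[OF assms(1), of "app (S s) x"]]
  show "(\<lambda>n. app (E n (t + s)) x) \<longlonglongrightarrow> app (S t) (app (S s) x)"
    by (simp add: E app.diff_right)
qed (use assms in simp)

lemma S_R_commute:
  assumes "0 \<le> t" "0 < l"
  shows "app (S t) (app (R l) x) = app (R l) (app (S t) x)"
proof (rule LIMSEQ_unique[OF E_tendsto[OF assms(1)]])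
  have "E n t * R l = R l * E n t" for n
    unfolding E_def by (rule commuting_exp) (simp add: yosida_R_commute assms)
  then have "app (E n t) (app (R l) x) = app (R l) (app (E n t) x)" for n
    by (rule app_commute)
  then show "(\<lambda>n. app (E n t) (app (R l) x)) \<longlonglongrightarrow> app (R l) (app (S t) x)"
    by (simp add: app.tendsto[OF tendsto_const E_tendsto[OF assms(1)]])
qed

text \<open>D is the range of \<open>R 1\<close>, with which \<open>S t\<close> commutes, so no
  differentiation is involved.\<close>

lemma
  assumes "0 \<le> t" "x \<in> D"
  shows S_dom: "app (S t) x \<in> D" and Y_S: "Y (app (S t) x) = app (S t) (Y x)"
proof -
  obtain z where z: "x = app (R 1) z" "Y x = x - z"
    using D_obtain assms(2) by metis
  have *: "app (S t) x = app (R 1) (app (S t) z)"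
    using assms(1) by (simp add: z S_R_commute)
  then show "app (S t) x \<in> D"
    using R_dom[of 1] by simp
  have "Y (app (S t) x) = app (S t) x - app (S t) z"
    using Y_R[of 1 "app (S t) z"] * by simp
  then show "Y (app (S t) x) = app (S t) (Y x)"
    by (simp add: z(2) app.diff_right)
qed

lemma continuous_E: "continuous_on A (\<lambda>t. app (E n t) x)"
  unfolding E_def
  by (intro continuous_on_vector_derivative[where f' = "\<lambda>s. app (exp (s *\<^sub>R yosida n) * yosida n) x"]
      bounded_linear.has_vector_derivative[OF app.bounded_linear_left exp_scaleR_has_vector_derivative_right])

lemma at_within_cut: "0 \<le> t \<Longrightarrow> t < T \<Longrightarrow> at t within {0..} = at t within {0..T :: real}"
  by (rule at_within_nhd[of _ "{..<T}"]) auto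

lemma continuous_S0: "continuous_on {0..} (\<lambda>t. app (S t) x)"
  unfolding continuous_on_eq_continuous_within
proof
  fix t :: real assume t: "t \<in> {0..}"
  have "continuous_on {0..t + 1} (\<lambda>t. app (S t) x)"
    using t by (intro uniform_limit_theorem[OF _ E_uniform_limit] always_eventually allI continuous_E) auto
  then show "continuous (at t within {0..}) (\<lambda>t. app (S t) x)"
    using t by (simp add: continuous_on_eq_continuous_within at_within_cut[of t "t + 1"])
qed

text \<open>Strong continuity and contractivity together give joint continuity, which makes all
  Duhamel integrands below continuous.\<close>

lemma continuous_on_S:
  assumes a: "continuous_on A a" "\<And>r. r \<in> A \<Longrightarrow> 0 \<le> a r" and g: "continuous_on A g"
  shows "continuous_on A (\<lambda>r. app (S (a r)) (g r))"
  unfolding continuous_on_def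
proof
  fix r assume r: "r \<in> A"
  have "((\<lambda>r'. app (S (a r')) (g r' - g r)) \<longlongrightarrow> 0) (at r within A)"
  proof (rule tendsto_norm_zero_cancel, rule tendsto_sandwich[of "\<lambda>_. 0"])
    show "((\<lambda>r'. norm (g r' - g r)) \<longlongrightarrow> 0) (at r within A)"
      using g r unfolding continuous_on_def by (intro tendsto_norm_zero LIM_zero) blast
    show "\<forall>\<^sub>F r' in at r within A. norm (app (S (a r')) (g r' - g r)) \<le> norm (g r' - g r)"
      using a(2) norm_app_S by (auto simp: eventually_at_filter intro!: always_eventually)
  qed auto
  moreover have "continuous_on A (\<lambda>r'. app (S (a r')) (g r))"
    using a(2) by (intro continuous_on_compose2[OF continuous_S0 a(1)]) auto
  then have "((\<lambda>r'. app (S (a r')) (g r)) \<longlongrightarrow> app (S (a r)) (g r)) (at r within A)"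
    using r by (auto simp: continuous_on_def)
  ultimately have "((\<lambda>r'. app (S (a r')) (g r' - g r) + app (S (a r')) (g r)) \<longlongrightarrow> 0 + app (S (a r)) (g r)) (at r within A)"
    by (rule tendsto_add)
  then show "((\<lambda>r'. app (S (a r')) (g r')) \<longlongrightarrow> app (S (a r)) (g r)) (at r within A)"
    by (simp add: app.diff_right)
qed

lemma S_has_integral:
  assumes "0 \<le> t" "x \<in> D"
  shows "((\<lambda>s. app (S s) (Y x)) has_integral (app (S t) x - x)) {0..t}"
proof -
  have 1: "((\<lambda>s. app (E n s) (app (yosida n) x)) has_integral (app (E n t) x - x)) {0..t}" for n
  proof -
    have "((\<lambda>t. app (E n t) x) has_vector_derivative app (E n s) (app (yosida n) x)) (at s within {0..t})" for s
      using bounded_linear.has_vector_derivative[OF app.bounded_linear_left exp_scaleR_has_vector_derivative_right]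
      by (simp add: E_def)
    from fundamental_theorem_of_calculus[OF assms(1) this] show ?thesis
      by (simp add: E_def)
  qed
  have "uniform_limit {0..t} (\<lambda>n s. app (E n s) (app (yosida n) x - Y x)) (\<lambda>s. 0) sequentially"
  proof (rule uniform_limitI)
    fix e :: real assume "e > 0"
    have "\<forall>\<^sub>F n in sequentially. norm (app (yosida n) x - Y x) < e"
      using tendstoD[OF yosida_tendsto[OF assms(2)] \<open>e > 0\<close>] by (simp add: dist_norm)
    then show "\<forall>\<^sub>F n in sequentially. \<forall>s\<in>{0..t}. dist (app (E n s) (app (yosida n) x - Y x)) 0 < e"
      by eventually_elim (auto intro: order_le_less_trans[OF norm_app_contr[OF norm_E]])
  qed
  from uniform_limit_add[OF this E_uniform_limit[OF assms(1), of "Y x"]]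
  have "uniform_limit {0..t} (\<lambda>n s. app (E n s) (app (yosida n) x)) (\<lambda>s. app (S s) (Y x)) sequentially"
    by (simp add: app.diff_right)
  then obtain I J where IJ: "\<And>n. ((\<lambda>s. app (E n s) (app (yosida n) x)) has_integral I n) {0..t}"
    "((\<lambda>s. app (S s) (Y x)) has_integral J) {0..t}" "I \<longlonglongrightarrow> J"
    by (rule uniform_limit_integral[OF _ continuous_E]) auto
  have "I = (\<lambda>n. app (E n t) x - x)"
    using has_integral_unique[OF IJ(1) 1] by auto
  then have "I \<longlonglongrightarrow> app (S t) x - x"
    by (auto intro!: tendsto_intros E_tendsto assms)
  with IJ(2,3) show ?thesis
    using LIMSEQ_unique by blast
qed

lemma norm_S_diff_le:
  assumes "0 \<le> t" "x \<in> D"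
  shows "norm (app (S t) x - x) \<le> t * norm (Y x)"
proof -
  have "norm (app (S t) x - x) \<le> norm (Y x) * measure lborel {0..t}"
    by (rule has_integral_bound_real[OF _ _ S_has_integral[OF assms], of _ "{}"])
      (auto intro: norm_app_S)
  then show ?thesis
    using assms by (simp add: mult.commute)
qed

lemma S_has_vector_derivative:
  assumes "0 < t" "x \<in> D"
  shows "((\<lambda>t. app (S t) x) has_vector_derivative app (S t) (Y x)) (at t)"
proof -
  have "continuous_on {0..t + 1} (\<lambda>s. app (S s) (Y x))"
    by (rule continuous_on_subset[OF continuous_S0]) auto
  then have "((\<lambda>u. integral {0..u} (\<lambda>s. app (S s) (Y x))) has_vector_derivative app (S t) (Y x)) (at t within {0..t + 1})"
    using assms by (intro integral_has_vector_derivative) auto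
  then have "((\<lambda>u. integral {0..u} (\<lambda>s. app (S s) (Y x)) + x) has_vector_derivative app (S t) (Y x)) (at t within {0..t + 1})"
    by (auto intro!: derivative_eq_intros)
  then have "((\<lambda>t. app (S t) x) has_vector_derivative app (S t) (Y x)) (at t within {0..t + 1})"
    using assms by (elim has_vector_derivative_transform[rotated 2])
      (auto simp: integral_unique[OF S_has_integral])
  then have "((\<lambda>t. app (S t) x) has_vector_derivative app (S t) (Y x)) (at t within {0<..<t + 1})"
    by (rule has_vector_derivative_within_subset) auto
  then show ?thesis
    using assms by (simp add: has_vector_derivative_def at_within_open[of t "{0<..<t+1}"])
qed

text \<open>By \<open>E_eq\<close>, each approximation is a nonnegative scalar times a power series
  in a resolvent with nonnegative coefficients; closedness of P handles the series and the limit in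
  n.\<close>

lemma S_cone_invariant:
  assumes P: "closed P" "0 \<in> P" "\<And>x y. x \<in> P \<Longrightarrow> y \<in> P \<Longrightarrow> x + y \<in> P"
    "\<And>r x. 0 \<le> r \<Longrightarrow> x \<in> P \<Longrightarrow> r *\<^sub>R x \<in> P" "\<And>l x. 0 < l \<Longrightarrow> x \<in> P \<Longrightarrow> app (R l) x \<in> P"
    and "0 \<le> t" "x \<in> P"
  shows "app (S t) x \<in> P"
proof (rule Lim_in_closed_set[OF P(1) _ _ E_tendsto[OF \<open>0 \<le> t\<close>]])
  have "app (E n t) x \<in> P" for n
  proof -
    define B where "B = (t * (real (Suc n))\<^sup>2) *\<^sub>R R (real (Suc n))"
    have B: "app B y \<in> P" if "y \<in> P" for y
      unfolding B_def app.scaleR_left using P(5)[of "real (Suc n)" y] that \<open>0 \<le> t\<close> by (intro P(4)) auto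
    have Bk: "app (B ^ k) x \<in> P" for k
      by (induction k) (auto simp: \<open>x \<in> P\<close> B)
    have sums: "(\<lambda>k. app (B ^ k /\<^sub>R fact k) x) sums app (exp B) x"
      unfolding exp_def by (rule bounded_linear.sums[OF app.bounded_linear_left summable_sums[OF summable_exp_generic]])
    have "(\<Sum>k<N. app (B ^ k /\<^sub>R fact k) x) \<in> P" for N
      by (induction N) (auto simp: P(2) app.scaleR_left intro!: P(3,4) Bk)
    then have "app (exp B) x \<in> P"
      using sums unfolding sums_def by (intro Lim_in_closed_set[OF P(1)]) auto
    then show ?thesis
      by (simp only: E_eq app.scaleR_left B_def[symmetric]) (rule P(4), auto)
  qed
  then show "\<forall>\<^sub>F n in sequentially. app (E n t) x \<in> P"
    by simp
qed simp

end

section \<open>Column dominated matrices generate analytic semigroups\<close>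

lemma colsum_diag:
  assumes "summable (\<lambda>m. \<bar>a m\<bar> * \<bar>coord x m\<bar>)"
  shows "coord (colsum (\<lambda>m. a m *\<^sub>R unit m) x) n = a n * coord x n"
proof -
  have "summable (\<lambda>m. \<bar>coord x m\<bar> * norm (a m *\<^sub>R unit m))"
    using assms by (simp add: mult.commute)
  from coord_colsum[OF this] have "coord (colsum (\<lambda>m. a m *\<^sub>R unit m) x) n = (\<Sum>m. if m = n then a n * coord x n else 0)"
    by (auto simp: coord_unit intro!: suminf_cong)
  also have "\<dots> = a n * coord x n"
    using sums_unique[OF sums_single[of n "\<lambda>_. a n * coord x n"]] by simp
  finally show ?thesis .
qed

lemma bounded_linear_apply_colsum: "bounded_linear f \<Longrightarrow> summable (\<lambda>m. \<bar>coord x m\<bar> * norm (v m)) \<Longrightarrow>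
    f (colsum v x) = (\<Sum>m. coord x m *\<^sub>R f (v m))"
  using bounded_linear.suminf[of f, OF _ summable_colsum]
  by (metis (no_types, lifting) colsum_def linear_scale suminf_cong bounded_linear.linear)

text \<open>Column \<open>m\<close> of the generator is \<open>v m - eta m *\<^sub>R unit m\<close>.  The weight \<open>tau\<close> describes its domain, \<open>c\<close> is
  the margin by which the diagonal dominates, and \<open>\<alpha>\<close> is the order of the intermediate space.\<close>

locale matrix_generator =
  fixes v :: "nat \<Rightarrow> ell1" and eta tau :: "nat \<Rightarrow> real" and c C \<alpha> :: real
  assumes nonneg_v: "nonneg (v m)" and tau_ge: "1 \<le> tau m" and c_pos: "0 < c"
    and norm_v: "norm (v m) \<le> eta m - c * tau m" and eta_le: "eta m \<le> C * tau m"
    and al: "0 < \<alpha>" "\<alpha> < 1"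
begin

definition D :: "ell1 set" where
  "D = {x. summable (\<lambda>m. tau m * \<bar>coord x m\<bar>)}"

definition gen :: "nat \<Rightarrow> ell1" where
  "gen m = v m - eta m *\<^sub>R unit m"

definition Y :: "ell1 \<Rightarrow> ell1" where
  "Y x = colsum gen x"

definition tnorm :: "ell1 \<Rightarrow> real" where
  "tnorm x = (\<Sum>m. tau m * \<bar>coord x m\<bar>)"

lemma tau_pos [simp]: "0 < tau m"
  using tau_ge[of m] by simp

lemma eta_ge: "c * tau m \<le> eta m"
  using norm_v[of m] norm_ge_zero[of "v m"] by linarith

lemma eta_pos [simp]: "0 < eta m"
  using eta_ge[of m] c_pos mult_pos_pos[OF c_pos tau_pos[of m]] by linarith

lemma c_le_C: "c \<le> C"
  using eta_ge[of 0] eta_le[of 0] tau_pos[of 0] by (meson mult_le_cancel_right_pos order_trans)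

lemma C_pos: "0 < C"
  using c_le_C c_pos by linarith

lemma norm_v_le: "norm (v m) \<le> C * tau m"
  using norm_v[of m] eta_le[of m] mult_pos_pos[OF c_pos tau_pos[of m]] by linarith

lemma norm_gen_le: "norm (gen m) \<le> 2 * C * tau m"
proof -
  have "norm (gen m) \<le> norm (v m) + eta m"
    using norm_triangle_ineq4[of "v m" "eta m *\<^sub>R unit m"] eta_pos[of m] by (simp add: gen_def)
  then show ?thesis
    using norm_v_le[of m] eta_le[of m] by linarith
qed

lemma summable_D:
  assumes "x \<in> D" "\<And>m. norm (u m) \<le> K * tau m"
  shows "summable (\<lambda>m. \<bar>coord x m\<bar> * norm (u m))"
proof (rule summable_comparison_test'[of "\<lambda>m. K * (tau m * \<bar>coord x m\<bar>)" 0])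
  show "summable (\<lambda>m. K * (tau m * \<bar>coord x m\<bar>))"
    using assms(1) by (intro summable_mult) (simp add: D_def)
  show "norm (\<bar>coord x m\<bar> * norm (u m)) \<le> K * (tau m * \<bar>coord x m\<bar>)" for m
    using mult_left_mono[OF assms(2)[of m], of "\<bar>coord x m\<bar>"] by (simp add: abs_mult algebra_simps)
qed

lemma summable_eta:
  assumes "x \<in> D"
  shows "summable (\<lambda>m. \<bar>coord x m\<bar> * norm (eta m *\<^sub>R unit m))"
  by (rule summable_D[OF assms, of _ C]) (use eta_le less_imp_le[OF eta_pos] in simp)

text \<open>Factor l - Y = (1 - \<open>K l\<close>) (l + diag \<open>eta\<close>);
  \<open>Dinv l\<close> inverts the second factor. Column dominance bounds \<open>K l\<close> by
  \<open>q\<close> < 1 uniformly in l, so the Neumann series for the first factor converges also at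
  l = 0.\<close>

definition K :: "real \<Rightarrow> ell1 endo" where
  "K l = endo_of (colsum (\<lambda>m. v m /\<^sub>R (l + eta m)))"

definition Dinv :: "real \<Rightarrow> ell1 endo" where
  "Dinv l = endo_of (colsum (\<lambda>m. inverse (l + eta m) *\<^sub>R unit m))"

text \<open>From \<open>eta_le\<close>, \<open>tau m\<close> is at least \<open>eta m / C\<close>,
  so \<open>norm_v\<close> gives \<open>norm (v m) \<le> eta m * (1 - c / C)\<close>.\<close>

definition q where "q = 1 - c / C"

lemma q: "0 \<le> q" "q < 1"
  using c_le_C C_pos c_pos by (auto simp: q_def)

context
  fixes l :: real assumes l: "0 \<le> l"
begin

lemma l_eta: "0 < l + eta m"
  using l eta_pos[of m] by linarith

lemma norm_K_col: "norm (v m /\<^sub>R (l + eta m)) \<le> q"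
proof -
  have "norm (v m) \<le> (l + eta m) * q"
  proof -
    have "eta m * (c / C) \<le> C * tau m * (c / C)"
      using eta_le c_pos C_pos by (intro mult_right_mono) auto
    then have "norm (v m) \<le> eta m * q"
      using norm_v[of m] C_pos by (simp add: q_def algebra_simps)
    also have "\<dots> \<le> (l + eta m) * q"
      using l q by (intro mult_right_mono) auto
    finally show ?thesis .
  qed
  then show ?thesis
    using l_eta[of m] by (simp add: field_simps)
qed

lemma inv_eta_le: "inverse (l + eta m) * tau m \<le> 1 / c"
  using l eta_ge[of m] l_eta[of m] c_pos by (simp add: field_simps)

lemma norm_Dinv_col: "norm (inverse (l + eta m) *\<^sub>R unit m) \<le> 1 / c"
proof -
  have "inverse (l + eta m) * 1 \<le> inverse (l + eta m) * tau m"
    using l_eta[of m] tau_ge by (intro mult_left_mono) auto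
  also note inv_eta_le
  finally show ?thesis
    using l_eta[of m] by simp
qed

lemma app_K: "app (K l) x = colsum (\<lambda>m. v m /\<^sub>R (l + eta m)) x"
  unfolding K_def by (rule app_endo_of[OF bounded_linear_colsum[OF norm_K_col]])

lemma norm_K: "norm (K l) \<le> q"
  by (rule norm_endo_le[OF q(1)]) (simp only: app_K norm_colsum_bounded[OF norm_K_col])

lemma app_Dinv: "app (Dinv l) x = colsum (\<lambda>m. inverse (l + eta m) *\<^sub>R unit m) x"
  unfolding Dinv_def by (rule app_endo_of[OF bounded_linear_colsum[OF norm_Dinv_col]])

lemma coord_Dinv: "coord (app (Dinv l) x) m = inverse (l + eta m) * coord x m"
  unfolding app_Dinv
  by (rule colsum_diag) (use summable_coord_bounded[OF norm_Dinv_col, of x] in \<open>simp add: mult.commute\<close>)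

lemma Dinv_dom: "app (Dinv l) x \<in> D"
proof -
  have "summable (\<lambda>m. tau m * \<bar>coord (app (Dinv l) x) m\<bar>)"
  proof (rule summable_comparison_test'[OF summable_mult[OF summable_coord[of x], of "1 / c"], of 0])
    fix m
    show "norm (tau m * \<bar>coord (app (Dinv l) x) m\<bar>) \<le> 1 / c * \<bar>coord x m\<bar>"
      using mult_right_mono[OF inv_eta_le[of m], of "\<bar>coord x m\<bar>"] l_eta[of m]
      by (simp add: coord_Dinv abs_mult mult_ac abs_of_pos)
  qed
  then show ?thesis by (simp add: D_def)
qed

lemma Y_Dinv: "Y (app (Dinv l) y) = app (K l) y - y + l *\<^sub>R app (Dinv l) y"
proof (rule ell1_eqI)
  fix n
  have s1: "summable (\<lambda>m. coord y m * coord (v m /\<^sub>R (l + eta m)) n)"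
    by (rule summable_coord_colsum[OF summable_coord_bounded[OF norm_K_col]])
  have s2: "summable (\<lambda>m. coord y m * coord (unit m) n)"
    by (rule summable_coord_colsum[OF summable_coord_bounded[of unit 1]]) simp
  have s3: "summable (\<lambda>m. coord y m * coord (inverse (l + eta m) *\<^sub>R unit m) n)"
    by (rule summable_coord_colsum[OF summable_coord_bounded[OF norm_Dinv_col]])
  have "coord (Y (app (Dinv l) y)) n = (\<Sum>m. coord (app (Dinv l) y) m * coord (gen m) n)"
    unfolding Y_def by (rule coord_colsum[OF summable_D[OF Dinv_dom norm_gen_le]])
  also have "\<dots> = (\<Sum>m. coord y m * coord (v m /\<^sub>R (l + eta m)) n - coord y m * coord (unit m) n
      + l * (coord y m * coord (inverse (l + eta m) *\<^sub>R unit m) n))"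
  proof (rule suminf_cong)
    fix m
    show "coord (app (Dinv l) y) m * coord (gen m) n =
        coord y m * coord (v m /\<^sub>R (l + eta m)) n - coord y m * coord (unit m) n
      + l * (coord y m * coord (inverse (l + eta m) *\<^sub>R unit m) n)"
    proof -
      have "i * a * (b - e * d) = a * (i * b) - a * d + l * (a * (i * d))"
        if "i * (l + e) = 1" for i a b d e :: real
        using that by algebra
      from this[of "inverse (l + eta m)" "eta m"] show ?thesis
        using l_eta[of m] by (simp add: coord_Dinv gen_def less_imp_neq[symmetric])
    qed
  qed
  also have "\<dots> = coord (app (K l) y) n - coord (colsum unit y) n + l * coord (app (Dinv l) y) n"
    unfolding app_K app_Dinv
    by (simp only: coord_colsum[OF summable_coord_bounded[OF norm_K_col]]
        coord_colsum[OF summable_coord_bounded[of unit 1], simplified norm_unit order_refl]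
        coord_colsum[OF summable_coord_bounded[OF norm_Dinv_col]]
        suminf_mult[OF s3, symmetric] suminf_diff[OF s1 s2] suminf_add[OF summable_diff[OF s1 s2] summable_mult[OF s3]])
  finally show "coord (Y (app (Dinv l) y)) n = coord (app (K l) y - y + l *\<^sub>R app (Dinv l) y) n"
    by simp
qed

lemma summable_K: "summable (\<lambda>n. K l ^ n)"
  by (rule complete_algebra_summable_geometric) (use norm_K q in linarith)

definition neumann where "neumann = (\<Sum>n. K l ^ n)"

lemma neumann_left: "neumann = 1 + K l * neumann" and neumann_right: "neumann = 1 + neumann * K l"
proof -
  have "neumann = K l ^ 0 + (\<Sum>n. K l ^ Suc n)"
    unfolding neumann_def using suminf_split_head[OF summable_K] by simp
  then show "neumann = 1 + K l * neumann" "neumann = 1 + neumann * K l"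
    by (simp_all add: neumann_def suminf_mult[OF summable_K] suminf_mult2[OF summable_K] power_commutes)
qed

lemma nonneg_K: "nonneg x \<Longrightarrow> nonneg (app (K l) x)"
  unfolding app_K
  by (rule nonneg_colsum[OF summable_coord_bounded[OF norm_K_col]])
    (use l_eta nonneg_v in \<open>auto intro!: nonneg_scaleR simp: less_imp_le\<close>)

lemma nonneg_Dinv: "nonneg x \<Longrightarrow> nonneg (app (Dinv l) x)"
  using l_eta by (simp add: nonneg_def coord_Dinv less_imp_le)

lemma nonneg_neumann:
  assumes "nonneg x"
  shows "nonneg (app neumann x)"
proof -
  have "(\<lambda>n. app (K l ^ n) x) sums app neumann x"
    unfolding neumann_def by (rule bounded_linear.sums[OF app.bounded_linear_left summable_sums[OF summable_K]])
  moreover have "nonneg (app (K l ^ n) x)" for n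
    by (induction n) (auto simp: assms nonneg_K)
  then have "nonneg (\<Sum>n<N. app (K l ^ n) x)" for N
    by (induction N) (auto intro: nonneg_add)
  ultimately have "app neumann x \<in> {x. nonneg x}"
    unfolding sums_def by (intro Lim_in_closed_set[OF closed_nonneg]) auto
  then show ?thesis by simp
qed

end

definition R :: "real \<Rightarrow> ell1 endo" where
  "R l = Dinv l * neumann l"

lemma R_dom0: "0 \<le> l \<Longrightarrow> app (R l) x \<in> D"
  by (simp add: R_def Dinv_dom)

lemma Y_R0:
  assumes "0 \<le> l"
  shows "Y (app (R l) x) = l *\<^sub>R app (R l) x - x"
proof -
  have "app (neumann l) x = x + app (K l) (app (neumann l) x)"
    using arg_cong[OF neumann_left[OF assms], of "\<lambda>A. app A x"] by (simp add: app.add_left)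
  then show ?thesis
    using Y_Dinv[OF assms, of "app (neumann l) x"]
    by (simp only: R_def app_mult) (metis add_diff_cancel_right' diff_add_eq diff_diff_eq2 diff_minus_eq_add minus_diff_eq)
qed

lemma R_Y0:
  assumes l: "0 \<le> l" and x: "x \<in> D"
  shows "app (R l) (l *\<^sub>R x - Y x) = x"
proof -
  \<comment> \<open>z = (l + diag \<open>eta\<close>) x, so that x = \<open>Dinv l\<close> z and l x
    - Y x = (1 - \<open>K l\<close>) z.\<close>
  define z where "z = colsum (\<lambda>m. (l + eta m) *\<^sub>R unit m) x"
  have "summable (\<lambda>m. \<bar>coord x m\<bar> * norm ((l + eta m) *\<^sub>R unit m))"
  proof (rule summable_D[OF x])
    show "norm ((l + eta m) *\<^sub>R unit m) \<le> (l + C) * tau m" for m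
      using l_eta[OF l, of m] mult_left_mono[OF tau_ge[of m] l] eta_le[of m] by (simp add: distrib_right)
  qed
  then have "coord z m = (l + eta m) * coord x m" for m
    unfolding z_def by (intro colsum_diag) (simp add: mult.commute)
  then have z: "app (Dinv l) z = x"
    using l_eta[OF l] by (intro ell1_eqI) (simp add: coord_Dinv[OF l] less_imp_neq[symmetric])
  have "l *\<^sub>R x - Y x = z - app (K l) z"
    using Y_Dinv[OF l, of z] by (simp add: z)
  moreover have "app (neumann l) z = z + app (neumann l) (app (K l) z)"
    using arg_cong[OF neumann_right[OF l], of "\<lambda>A. app A z"] by (simp add: app.add_left)
  ultimately show ?thesis
    by (simp add: R_def app.diff_right[symmetric] z) (simp add: app.diff_right algebra_simps z)
qed

lemma nonneg_R: "0 \<le> l \<Longrightarrow> nonneg x \<Longrightarrow> nonneg (app (R l) x)"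
  by (simp add: R_def nonneg_Dinv nonneg_neumann)

text \<open>Column m of the generator has total \<open>norm (v m) - eta m\<close>, hence at most
  \<open>- c * tau m\<close>. This dissipation gives contractive resolvents and, integrated in time,
  analyticity.\<close>

lemma total_Y_le:
  assumes "x \<in> D" "nonneg x"
  shows "total (Y x) \<le> - c * tnorm x"
proof -
  note s = summable_D[OF assms(1) norm_gen_le]
  have s': "summable (\<lambda>m. coord x m *\<^sub>R total (gen m))"
    using bounded_linear.summable[OF bounded_linear_total summable_colsum[OF s]]
    by (simp add: linear_scale[OF bounded_linear.linear[OF bounded_linear_total]])
  have "total (Y x) = (\<Sum>m. coord x m *\<^sub>R total (gen m))"
    unfolding Y_def by (rule bounded_linear_apply_colsum[OF bounded_linear_total s])
  also have "\<dots> \<le> (\<Sum>m. - c * (tau m * \<bar>coord x m\<bar>))"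
  proof (rule suminf_le[OF _ s'])
    fix m
    have "total (unit m) = 1"
      using norm_nonneg[of "unit m"] by simp
    then have "total (gen m) = norm (v m) - eta m"
      using linear_diff[OF bounded_linear.linear[OF bounded_linear_total]]
        linear_scale[OF bounded_linear.linear[OF bounded_linear_total]]
      by (simp add: gen_def norm_nonneg[OF nonneg_v])
    then have "total (gen m) \<le> - c * tau m"
      using norm_v[of m] by simp
    then show "coord x m *\<^sub>R total (gen m) \<le> - c * (tau m * \<bar>coord x m\<bar>)"
      using assms(2) mult_left_mono[of "total (gen m)" "- c * tau m" "coord x m"]
      by (simp add: nonneg_def mult_ac)
  next
    show "summable (\<lambda>m. - c * (tau m * \<bar>coord x m\<bar>))"
      using assms(1) by (intro summable_mult) (simp add: D_def)
  qed
  also have "\<dots> = - c * tnorm x"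
    unfolding tnorm_def using assms(1) by (intro suminf_mult) (simp add: D_def)
  finally show ?thesis .
qed

lemma tnorm_nonneg: "x \<in> D \<Longrightarrow> 0 \<le> tnorm x"
  unfolding tnorm_def by (rule suminf_nonneg) (auto simp: D_def less_imp_le)

text \<open>For nonnegative x take \<open>total\<close> in Y (R l x) = l R l x - x: the left side is
  nonpositive by dissipation. The general case splits x into positive and negative parts.\<close>

lemma norm_R0:
  assumes "0 < l"
  shows "norm (R l) \<le> 1 / l"
proof (rule norm_endo_le)
  have pos: "l * norm (app (R l) x) \<le> norm x" if x: "nonneg x" for x
  proof -
    have l: "0 \<le> l" using assms by simp
    have "total (Y (app (R l) x)) \<le> 0"
      using total_Y_le[OF R_dom0[OF l] nonneg_R[OF l x]] tnorm_nonneg[OF R_dom0[OF l, of x]] c_pos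
      by (smt (verit) mult_nonneg_nonneg mult_minus_left)
    moreover have "total (Y (app (R l) x)) = l * total (app (R l) x) - total x"
      using linear_diff[OF bounded_linear.linear[OF bounded_linear_total]]
        linear_scale[OF bounded_linear.linear[OF bounded_linear_total]] by (simp add: Y_R0[OF l])
    ultimately show ?thesis
      by (simp add: norm_nonneg[OF nonneg_R[OF l x]] norm_nonneg[OF x])
  qed
  fix x
  have "app (R l) x = app (R l) (pos_part x) - app (R l) (pos_part (- x))"
    using pos_part_diff[of x] by (metis app.diff_right)
  then have "l * norm (app (R l) x) \<le> l * (norm (app (R l) (pos_part x)) + norm (app (R l) (pos_part (- x))))"
    using assms by (simp add: norm_triangle_ineq4)
  also have "\<dots> \<le> norm (pos_part x) + norm (pos_part (- x))"
    using pos[of "pos_part x"] pos[of "pos_part (- x)"] by (simp add: distrib_left)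
  also have "\<dots> = norm x"
    by (rule norm_pos_part)
  finally show "norm (app (R l) x) \<le> 1 / l * norm x"
    using assms by (simp add: field_simps)
qed (use assms in simp)

lemma finite_support_D: "finite {n. coord x n \<noteq> 0} \<Longrightarrow> x \<in> D"
  unfolding D_def by (auto intro!: summable_finite)

lemma trunc_D: "trunc N x \<in> D"
  by (rule finite_support_D) (auto simp: coord_trunc intro: finite_subset[of _ "{..<N}"])

lemma unit_D: "unit j \<in> D"
  by (rule finite_support_D) (auto simp: coord_unit)

sublocale resolvent_family D Y R
proof
  have "x \<in> closure D" for x
    unfolding closure_sequential using trunc_D trunc_tendsto[of x] by (intro exI[of _ "\<lambda>N. trunc N x"]) simp
  then show "closure D = UNIV" by blast
qed (auto simp: R_dom0 Y_R0 R_Y0 norm_R0)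

lemma nonneg_S: "0 \<le> t \<Longrightarrow> nonneg x \<Longrightarrow> nonneg (app (S t) x)"
  using S_cone_invariant[OF closed_nonneg, of t x] by (auto simp: nonneg_add nonneg_scaleR nonneg_R)

lemma norm_Y_le:
  assumes "x \<in> D"
  shows "norm (Y x) \<le> 2 * C * tnorm x"
proof -
  note s = summable_D[OF assms norm_gen_le]
  have "norm (Y x) \<le> (\<Sum>m. \<bar>coord x m\<bar> * norm (gen m))"
    unfolding Y_def by (rule norm_colsum_le[OF s])
  also have "\<dots> \<le> (\<Sum>m. 2 * C * (tau m * \<bar>coord x m\<bar>))"
  proof (rule suminf_le[OF _ s])
    show "\<bar>coord x m\<bar> * norm (gen m) \<le> 2 * C * (tau m * \<bar>coord x m\<bar>)" for m
      using mult_left_mono[OF norm_gen_le[of m], of "\<bar>coord x m\<bar>"] by (simp add: mult_ac)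
  qed (use assms in \<open>auto simp: D_def intro!: summable_mult\<close>)
  also have "\<dots> = 2 * C * tnorm x"
    unfolding tnorm_def using assms by (intro suminf_mult) (simp add: D_def)
  finally show ?thesis .
qed

text \<open>The diagonal part exceeds the off-diagonal part in norm by at least
  \<open>c * tnorm x\<close>. With \<open>norm_Y_le\<close> this makes \<open>norm (Y x)\<close> and
  \<open>tnorm x\<close> equivalent on D, so statements about Y become statements about
  X_{p,1}.\<close>

lemma norm_Y_ge:
  assumes "x \<in> D"
  shows "c * tnorm x \<le> norm (Y x)"
proof -
  define z where "z = colsum (\<lambda>m. eta m *\<^sub>R unit m) x"
  note sv = summable_D[OF assms norm_v_le]
  note se = summable_eta[OF assms]
  have se': "summable (\<lambda>m. eta m * \<bar>coord x m\<bar>)"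
    using se by (simp add: mult.commute less_imp_le abs_of_pos)
  have st: "summable (\<lambda>m. tau m * \<bar>coord x m\<bar>)"
    using assms by (simp add: D_def)
  have "Y x = colsum v x - z"
    unfolding Y_def z_def colsum_def gen_def
    by (subst suminf_diff[OF summable_colsum[OF sv] summable_colsum[OF se]]) (simp add: scaleR_diff_right)
  then have "norm z - norm (colsum v x) \<le> norm (Y x)"
    by (metis norm_minus_commute norm_triangle_ineq2)
  moreover have "norm z = (\<Sum>m. eta m * \<bar>coord x m\<bar>)"
    unfolding norm_ell1_def z_def using colsum_diag[of eta x] se'
    by (simp add: abs_mult abs_of_pos)
  moreover have "norm (colsum v x) \<le> (\<Sum>m. eta m * \<bar>coord x m\<bar> - c * (tau m * \<bar>coord x m\<bar>))"
  proof (rule order_trans[OF norm_colsum_le[OF sv]], rule suminf_le[OF _ sv])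
    show "\<bar>coord x m\<bar> * norm (v m) \<le> eta m * \<bar>coord x m\<bar> - c * (tau m * \<bar>coord x m\<bar>)" for m
      using mult_left_mono[OF norm_v[of m], of "\<bar>coord x m\<bar>"] by (simp add: algebra_simps)
  qed (intro summable_diff se' summable_mult st)
  moreover have "(\<Sum>m. eta m * \<bar>coord x m\<bar> - c * (tau m * \<bar>coord x m\<bar>)) = (\<Sum>m. eta m * \<bar>coord x m\<bar>) - c * tnorm x"
    unfolding tnorm_def by (subst suminf_diff[symmetric, OF se' summable_mult[OF st]]) (simp add: suminf_mult[OF st])
  ultimately show ?thesis by linarith
qed

text \<open>On nonnegative x in D, \<open>norm (Y x) \<le> K1 * - total (Y x)\<close>: the quotient
  of the constants in \<open>norm_Y_le\<close> and \<open>total_Y_le\<close>.\<close>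

definition K1 where "K1 = 2 * C / c"

lemma K1_pos: "0 < K1"
  using c_pos C_pos by (simp add: K1_def)

text \<open>The total mass dissipated up to time \<open>t\<close> controls the time integral of \<open>norm (Y (S s x))\<close>, and the
  integrand is at least its value at \<open>t\<close>.  This already gives analyticity.\<close>

lemma YS_nonneg_le:
  assumes t: "0 \<le> t" and x: "x \<in> D" "nonneg x"
  shows "t * norm (Y (app (S t) x)) \<le> K1 * norm x"
proof -
  let ?N = "norm (app (S t) (Y x))"
  have int: "((\<lambda>s. - total (app (S s) (Y x))) has_integral - total (app (S t) x - x)) {0..t}"
    using has_integral_neg[OF has_integral_linear[OF S_has_integral[OF t x(1)] bounded_linear_total]]
    by (simp add: o_def)
  have "((\<lambda>s. ?N / K1) has_integral (?N / K1 * t)) {0..t}"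
    using has_integral_const_real[of "?N / K1" 0 t] t by (simp add: mult.commute)
  then have "?N / K1 * t \<le> - total (app (S t) x - x)"
  proof (rule has_integral_le[OF _ int])
    fix s assume s: "s \<in> {0..t}"
    have "?N = norm (app (S (t - s)) (app (S s) (Y x)))"
      using S_add[of "t - s" s "Y x"] s by simp
    also have "\<dots> \<le> norm (Y (app (S s) x))"
      using s x norm_app_S by (simp add: Y_S)
    also have "\<dots> \<le> 2 * C * tnorm (app (S s) x)"
      using s x by (intro norm_Y_le S_dom) auto
    finally have "?N / K1 \<le> c * tnorm (app (S s) x)"
      using C_pos c_pos by (simp add: K1_def field_simps)
    also have "\<dots> \<le> - total (Y (app (S s) x))"
      using total_Y_le[OF S_dom[of s x] nonneg_S[of s x]] s x by simp
    finally show "?N / K1 \<le> - total (app (S s) (Y x))"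
      using s x by (simp add: Y_S)
  qed
  moreover have "total (app (S t) x - x) = norm (app (S t) x) - norm x"
    using linear_diff[OF bounded_linear.linear[OF bounded_linear_total]]
    by (simp add: norm_nonneg[OF nonneg_S[OF t x(2)]] norm_nonneg[OF x(2)])
  ultimately have "?N / K1 * t \<le> norm x"
    using norm_ge_zero[of "app (S t) x"] by linarith
  then show ?thesis
    using K1_pos t x by (simp add: Y_S field_simps)
qed

lemma pos_part_D: "x \<in> D \<Longrightarrow> pos_part x \<in> D"
  unfolding D_def
  by (auto intro!: summable_comparison_test'[of "\<lambda>m. tau m * \<bar>coord x m\<bar>" 0] mult_left_mono
      simp: coord_pos_part abs_mult abs_of_pos less_imp_le)

lemma D_uminus: "x \<in> D \<Longrightarrow> - x \<in> D"
  by (simp add: D_def)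

lemma YS_D_le:
  assumes t: "0 \<le> t" and x: "x \<in> D"
  shows "t * norm (Y (app (S t) x)) \<le> K1 * norm x"
proof -
  let ?p = "pos_part x" and ?m = "pos_part (- x)"
  have d: "?p \<in> D" "?m \<in> D"
    using x by (auto intro: pos_part_D D_uminus)
  have "app (S t) x = app (S t) ?p - app (S t) ?m"
    using pos_part_diff[of x] by (metis app.diff_right)
  then have "Y (app (S t) x) = Y (app (S t) ?p) - Y (app (S t) ?m)"
    using D_Y_diff S_dom[OF t] d by metis
  then have "t * norm (Y (app (S t) x)) \<le> t * (norm (Y (app (S t) ?p)) + norm (Y (app (S t) ?m)))"
    using t by (simp add: mult_left_mono norm_triangle_ineq4)
  also have "\<dots> \<le> K1 * norm ?p + K1 * norm ?m"
    unfolding distrib_left using d by (intro add_mono YS_nonneg_le t) auto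
  finally show ?thesis
    by (simp add: norm_pos_part[symmetric, of x] distrib_left)
qed

text \<open>As 0 is in the resolvent set, \<open>- R 0\<close> is a bounded inverse of Y, and the
  relation \<open>u n = - R 0 (Y (u n))\<close> passes to the limit.\<close>

lemma Y_closed:
  assumes "u \<longlonglongrightarrow> x" "\<And>n. u n \<in> D" "(\<lambda>n. Y (u n)) \<longlonglongrightarrow> y"
  shows "x \<in> D \<and> Y x = y"
proof -
  have u: "u n = - app (R 0) (Y (u n))" for n
    using R_Y0[of 0 "u n"] assms(2) by (simp add: app.minus_right)
  have "(\<lambda>n. - app (R 0) (Y (u n))) \<longlonglongrightarrow> - app (R 0) y"
    by (intro tendsto_intros app.tendsto assms)
  then have "x = app (R 0) (- y)"
    using LIMSEQ_unique[OF assms(1)] u by (simp add: app.minus_right)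
  then show ?thesis
    using R_dom0[of 0] Y_R0[of 0 "- y"] by simp
qed

text \<open>The bound of \<open>YS_D_le\<close> contains only \<open>norm x\<close>, so it extends
  from the dense truncations to every x because Y is closed.\<close>

lemma
  assumes t: "0 < t"
  shows S_smooth: "app (S t) x \<in> D" and norm_YS: "norm (Y (app (S t) x)) \<le> K1 / t * norm x"
proof -
  define u where "u n = app (S t) (trunc n x)" for n
  have uD: "u n \<in> D" for n
    using t by (simp add: u_def S_dom trunc_D)
  have bd: "norm (Y (app (S t) z)) \<le> K1 / t * norm z" if "z \<in> D" for z
    using YS_D_le[of t z] that t by (simp add: field_simps)
  have "u \<longlonglongrightarrow> app (S t) x"
    unfolding u_def by (intro app.tendsto tendsto_const trunc_tendsto)
  moreover have "Cauchy (\<lambda>n. Y (u n))"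
  proof (rule CauchyI)
    fix e :: real assume e: "e > 0"
    obtain M where M: "\<And>m n. m \<ge> M \<Longrightarrow> n \<ge> M \<Longrightarrow> norm (trunc m x - trunc n x) < e * t / K1"
      using CauchyD[OF LIMSEQ_imp_Cauchy[OF trunc_tendsto[of x]], of "e * t / K1"] e t K1_pos by auto
    have "norm (Y (u m) - Y (u n)) < e" if "m \<ge> M" "n \<ge> M" for m n
    proof -
      have "Y (u m) - Y (u n) = Y (app (S t) (trunc m x - trunc n x))"
        using D_Y_diff[OF uD uD, of m n] by (simp add: u_def app.diff_right)
      also have "norm \<dots> \<le> K1 / t * norm (trunc m x - trunc n x)"
        by (rule bd) (use D_Y_diff trunc_D in blast)
      also have "\<dots> < K1 / t * (e * t / K1)"
        using M[OF that] t K1_pos by (intro mult_strict_left_mono) auto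
      also have "\<dots> = e" using t K1_pos by simp
      finally show ?thesis .
    qed
    then show "\<exists>M. \<forall>m\<ge>M. \<forall>n\<ge>M. norm (Y (u m) - Y (u n)) < e" by blast
  qed
  then obtain y where y: "(\<lambda>n. Y (u n)) \<longlonglongrightarrow> y"
    by (auto simp: Cauchy_convergent_iff convergent_def)
  ultimately have *: "app (S t) x \<in> D \<and> Y (app (S t) x) = y"
    using Y_closed uD by blast
  then show "app (S t) x \<in> D" by simp
  have "norm y \<le> K1 / t * norm x"
  proof (rule LIMSEQ_le[OF tendsto_norm[OF y]])
    show "(\<lambda>n. K1 / t * norm (trunc n x)) \<longlonglongrightarrow> K1 / t * norm x"
      by (intro tendsto_intros trunc_tendsto)
  qed (use bd trunc_D in \<open>auto simp: u_def\<close>)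
  then show "norm (Y (app (S t) x)) \<le> K1 / t * norm x"
    using * by simp
qed

lemma bounded_linear_YS:
  assumes "0 < t"
  shows "bounded_linear (\<lambda>x. Y (app (S t) x))"
  by (rule bounded_linear_intro[of _ "K1 / t"])
    (use norm_YS[OF assms] in \<open>auto simp: app.add_right app.scaleR_right D_Y_add D_Y_scaleR S_smooth[OF assms] mult.commute\<close>)

lemma YS_add:
  assumes "0 \<le> t" "0 < s"
  shows "Y (app (S (t + s)) x) = app (S t) (Y (app (S s) x))"
  using assms S_smooth[OF assms(2), of x] by (simp add: S_add Y_S)

text \<open>Analyticity makes the semigroup Lipschitz in operator norm with constant of order 1/s.
  Only the ratio of the times matters, which is why time dilations are the right comparison
  later.\<close>

lemma norm_S_minus_S:
  assumes "0 < s" "s \<le> t"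
  shows "norm (S t - S s) \<le> K1 * (t - s) / s"
proof (rule norm_endo_le)
  fix x
  have "app (S t - S s) x = app (S (t - s)) (app (S s) x) - app (S s) x"
    using S_add[of "t - s" s x] assms by (simp add: app.diff_left)
  also have "norm \<dots> \<le> (t - s) * norm (Y (app (S s) x))"
    using assms by (intro norm_S_diff_le S_smooth) auto
  also have "\<dots> \<le> (t - s) * (K1 / s * norm x)"
    using assms by (intro mult_left_mono norm_YS) auto
  finally show "norm (app (S t - S s) x) \<le> K1 * (t - s) / s * norm x"
    by (simp add: mult_ac)
qed (use assms K1_pos in simp)

subsection \<open>The intermediate norms\<close>

text \<open>\<open>bnd x A\<close> says that \<open>x\<close> has norm at most \<open>A\<close> in the space with weight \<open>tau powr \<alpha>\<close>; in terms of finite sums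
  it is stable under limits and integrals without any summability side conditions.\<close>

definition bnd :: "ell1 \<Rightarrow> real \<Rightarrow> bool" where
  "bnd x A \<longleftrightarrow> (\<forall>N. (\<Sum>n<N. tau n powr \<alpha> * \<bar>coord x n\<bar>) \<le> A)"

lemma bndD: "bnd x A \<Longrightarrow> (\<Sum>n<N. tau n powr \<alpha> * \<bar>coord x n\<bar>) \<le> A"
  by (simp add: bnd_def)

lemma bnd_mono: "bnd x A \<Longrightarrow> A \<le> B \<Longrightarrow> bnd x B"
  unfolding bnd_def by (meson order_trans)

lemma bnd_zero: "bnd 0 0"
  by (simp add: bnd_def)

lemma bnd_add: "bnd x A \<Longrightarrow> bnd y B \<Longrightarrow> bnd (x + y) (A + B)"
  unfolding bnd_def
proof (intro allI)
  fix N assume xy: "\<forall>N. (\<Sum>n<N. tau n powr \<alpha> * \<bar>coord x n\<bar>) \<le> A" "\<forall>N. (\<Sum>n<N. tau n powr \<alpha> * \<bar>coord y n\<bar>) \<le> B"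
  have "(\<Sum>n<N. tau n powr \<alpha> * \<bar>coord (x + y) n\<bar>) \<le> (\<Sum>n<N. tau n powr \<alpha> * \<bar>coord x n\<bar> + tau n powr \<alpha> * \<bar>coord y n\<bar>)"
    by (intro sum_mono) (simp add: abs_triangle_ineq mult_left_mono flip: distrib_left)
  with xy show "(\<Sum>n<N. tau n powr \<alpha> * \<bar>coord (x + y) n\<bar>) \<le> A + B"
    by (simp add: sum.distrib) (meson add_mono order_trans)
qed

lemma bnd_scaleR: "bnd x A \<Longrightarrow> bnd (r *\<^sub>R x) (\<bar>r\<bar> * A)"
  unfolding bnd_def
proof (intro allI)
  fix N assume "\<forall>N. (\<Sum>n<N. tau n powr \<alpha> * \<bar>coord x n\<bar>) \<le> A"
  then have "\<bar>r\<bar> * (\<Sum>n<N. tau n powr \<alpha> * \<bar>coord x n\<bar>) \<le> \<bar>r\<bar> * A"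
    by (intro mult_left_mono) auto
  then show "(\<Sum>n<N. tau n powr \<alpha> * \<bar>coord (r *\<^sub>R x) n\<bar>) \<le> \<bar>r\<bar> * A"
    by (simp add: sum_distrib_left abs_mult mult_ac)
qed

lemma bnd_uminus: "bnd (- x) A \<longleftrightarrow> bnd x A"
  by (simp add: bnd_def)

lemma bnd_sum: "(\<And>j. j \<in> I \<Longrightarrow> bnd (f j) (A j)) \<Longrightarrow> bnd (sum f I) (sum A I)"
  by (induction I rule: infinite_finite_induct) (auto simp: bnd_zero bnd_add)

lemma bnd_lim:
  assumes "u \<longlonglongrightarrow> x" "\<And>n. bnd (u n) A"
  shows "bnd x A"
  unfolding bnd_def
proof
  fix N
  show "(\<Sum>n<N. tau n powr \<alpha> * \<bar>coord x n\<bar>) \<le> A"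
  proof (rule LIMSEQ_le_const2)
    show "(\<lambda>m. \<Sum>n<N. tau n powr \<alpha> * \<bar>coord (u m) n\<bar>) \<longlonglongrightarrow> (\<Sum>n<N. tau n powr \<alpha> * \<bar>coord x n\<bar>)"
      by (intro tendsto_intros bounded_linear.tendsto[OF bounded_linear_coord] assms)
  qed (use bndD[OF assms(2)] in blast)
qed

text \<open>The best choice of \<open>s\<close> is \<open>tnorm x / norm x\<close>, but a free \<open>s\<close> avoids Hoelder's inequality.\<close>

lemma bnd_interpolate:
  assumes "x \<in> D" "0 < s"
  shows "bnd x (s powr \<alpha> * norm x + s powr (\<alpha> - 1) * tnorm x)"
  unfolding bnd_def
proof
  fix N
  have "tau n powr \<alpha> \<le> s powr \<alpha> + s powr (\<alpha> - 1) * tau n" for n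
  proof -
    have "(tau n / s) powr \<alpha> \<le> 1 + tau n / s"
    proof (cases "tau n / s \<le> 1")
      case True
      then have "(tau n / s) powr \<alpha> \<le> 1"
        using assms al by (intro powr_le1) (auto simp: less_imp_le)
      then show ?thesis
        using assms divide_pos_pos[OF tau_pos[of n] assms(2)] by linarith
    next
      case False
      then have "(tau n / s) powr \<alpha> \<le> (tau n / s) powr 1"
        using al by (intro powr_mono) auto
      then show ?thesis using False by simp
    qed
    then have "s powr \<alpha> * (tau n / s) powr \<alpha> \<le> s powr \<alpha> * (1 + tau n / s)"
      by (intro mult_left_mono) auto
    also have "\<dots> = s powr \<alpha> + s powr (\<alpha> - 1) * tau n"
      using assms by (simp add: powr_diff field_simps)
    also have "s powr \<alpha> * (tau n / s) powr \<alpha> = tau n powr \<alpha>"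
      using assms by (simp add: powr_divide less_imp_le)
    finally show ?thesis .
  qed
  then have "(\<Sum>n<N. tau n powr \<alpha> * \<bar>coord x n\<bar>)
      \<le> (\<Sum>n<N. s powr \<alpha> * \<bar>coord x n\<bar> + s powr (\<alpha> - 1) * (tau n * \<bar>coord x n\<bar>))"
    by (intro sum_mono) (metis abs_ge_zero distrib_right mult.assoc mult_right_mono)
  also have "\<dots> = s powr \<alpha> * (\<Sum>n<N. \<bar>coord x n\<bar>) + s powr (\<alpha> - 1) * (\<Sum>n<N. tau n * \<bar>coord x n\<bar>)"
    by (simp add: sum.distrib sum_distrib_left)
  also have "\<dots> \<le> s powr \<alpha> * norm x + s powr (\<alpha> - 1) * tnorm x"
  proof (intro add_mono mult_left_mono sum_abs_coord_le)
    show "(\<Sum>n<N. tau n * \<bar>coord x n\<bar>) \<le> tnorm x"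
      unfolding tnorm_def using assms by (intro sum_le_suminf) (auto simp: D_def less_imp_le)
  qed auto
  finally show "(\<Sum>n<N. tau n powr \<alpha> * \<bar>coord x n\<bar>) \<le> s powr \<alpha> * norm x + s powr (\<alpha> - 1) * tnorm x" .
qed

text \<open>From interpolating \<open>app (S t) x\<close> at s = 1/t: 1 comes from the norm, K1 / c
  from \<open>tnorm\<close>, which is of order 1/t.\<close>

definition Ka where "Ka = 1 + K1 / c"

text \<open>From interpolating the image of \<open>unit j\<close> at s = \<open>tau j\<close>: 1
  comes from the norm, 2 C / c from passing from \<open>tnorm\<close> to \<open>norm (Y _)\<close>
  and back.\<close>

definition Kb where "Kb = 1 + 2 * C / c"

lemma Ka_pos: "0 < Ka" and Kb_pos: "0 < Kb"
  using K1_pos c_pos C_pos by (simp_all add: Ka_def Kb_def add_pos_pos)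

lemma bnd_S:
  assumes "0 < t"
  shows "bnd (app (S t) x) (Ka * t powr - \<alpha> * norm x)"
proof (rule bnd_mono[OF bnd_interpolate[OF S_smooth[OF assms], of "1 / t"]])
  let ?y = "app (S t) x"
  have "c * tnorm ?y \<le> K1 / t * norm x"
    using norm_Y_ge[OF S_smooth[OF assms]] norm_YS[OF assms] order_trans by blast
  then have "tnorm ?y \<le> K1 / c / t * norm x"
    using c_pos assms by (simp add: field_simps)
  then have "(1 / t) powr (\<alpha> - 1) * tnorm ?y \<le> (1 / t) powr (\<alpha> - 1) * (K1 / c / t * norm x)"
    by (rule mult_left_mono) simp
  also have "\<dots> = K1 / c * ((1 / t) powr (\<alpha> - 1) * (1 / t)) * norm x"
    by simp
  also have "(1 / t) powr (\<alpha> - 1) * (1 / t) = (1 / t) powr \<alpha>"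
    using assms powr_add[of "1 / t" "\<alpha> - 1" 1] by simp
  finally have "(1 / t) powr (\<alpha> - 1) * tnorm ?y \<le> K1 / c * (1 / t) powr \<alpha> * norm x" .
  moreover have "(1 / t) powr \<alpha> * norm ?y \<le> (1 / t) powr \<alpha> * norm x"
    using assms by (intro mult_left_mono norm_app_S) auto
  moreover have "(1 / t) powr \<alpha> = t powr - \<alpha>"
    using assms by (simp add: powr_divide powr_minus_divide)
  ultimately show "(1 / t) powr \<alpha> * norm ?y + (1 / t) powr (\<alpha> - 1) * tnorm ?y \<le> Ka * t powr - \<alpha> * norm x"
    by (simp add: Ka_def algebra_simps)
qed (use assms in simp)

text \<open>In a weighted sequence space of type \<open>l\<^sup>1\<close> it suffices to interpolate on the unit vectors.\<close>

lemma bnd_commuting: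
  assumes T: "\<And>x. x \<in> D \<Longrightarrow> app T x \<in> D \<and> Y (app T x) = app T (Y x)"
    and k: "norm T \<le> k" and x: "bnd x A"
  shows "bnd (app T x) (Kb * k * A)"
proof -
  have k0: "0 \<le> k" using k norm_ge_zero order_trans by blast
  have e: "bnd (app T (unit j)) (Kb * k * tau j powr \<alpha>)" for j
  proof (rule bnd_mono[OF bnd_interpolate[of _ "tau j"]])
    show "app T (unit j) \<in> D"
      using T unit_D by blast
    have "tnorm (unit j) = tau j"
    proof -
      have "tnorm (unit j) = (\<Sum>m. if m = j then tau j else 0)"
        unfolding tnorm_def by (rule suminf_cong) (simp add: coord_unit)
      then show ?thesis
        using sums_unique[OF sums_single[of j "\<lambda>_. tau j"]] by simp
    qed
    then have "norm (Y (unit j)) \<le> 2 * C * tau j"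
      using norm_Y_le[OF unit_D[of j]] by simp
    then have "norm (app T (Y (unit j))) \<le> k * (2 * C * tau j)"
      using norm_app_le[OF k] k0 by (meson mult_left_mono order_trans)
    then have "c * tnorm (app T (unit j)) \<le> k * (2 * C * tau j)"
      using norm_Y_ge[of "app T (unit j)"] T[OF unit_D] by (metis order_trans)
    then have "tnorm (app T (unit j)) \<le> 2 * C / c * k * tau j"
      using c_pos by (simp add: field_simps)
    then have "tau j powr (\<alpha> - 1) * tnorm (app T (unit j)) \<le> tau j powr (\<alpha> - 1) * (2 * C / c * k * tau j)"
      by (rule mult_left_mono) simp
    also have "\<dots> = 2 * C / c * k * tau j powr \<alpha>"
      by (simp add: powr_diff abs_of_pos less_imp_neq[OF tau_pos, symmetric])
    finally have "tau j powr (\<alpha> - 1) * tnorm (app T (unit j)) \<le> 2 * C / c * k * tau j powr \<alpha>" .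
    moreover have "tau j powr \<alpha> * norm (app T (unit j)) \<le> tau j powr \<alpha> * k"
      using norm_app_le[OF k, of "unit j"] by (intro mult_left_mono) auto
    ultimately show "tau j powr \<alpha> * norm (app T (unit j)) + tau j powr (\<alpha> - 1) * tnorm (app T (unit j))
        \<le> Kb * k * tau j powr \<alpha>"
      by (simp add: Kb_def algebra_simps)
  qed simp
  show ?thesis
  proof (rule bnd_lim)
    show "(\<lambda>M. app T (trunc M x)) \<longlonglongrightarrow> app T x"
      by (intro app.tendsto tendsto_const trunc_tendsto)
    fix M
    have "bnd (\<Sum>j<M. coord x j *\<^sub>R app T (unit j)) (\<Sum>j<M. \<bar>coord x j\<bar> * (Kb * k * tau j powr \<alpha>))"
      by (intro bnd_sum bnd_scaleR e)
    moreover have "(\<Sum>j<M. \<bar>coord x j\<bar> * (Kb * k * tau j powr \<alpha>)) = Kb * k * (\<Sum>j<M. tau j powr \<alpha> * \<bar>coord x j\<bar>)"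
      by (simp add: sum_distrib_left mult_ac)
    moreover have "\<dots> \<le> Kb * k * A"
      using Kb_pos k0 by (intro mult_left_mono bndD[OF x]) auto
    ultimately show "bnd (app T (trunc M x)) (Kb * k * A)"
      by (auto simp: trunc_def app.sum_right app.scaleR_right intro: bnd_mono)
  qed
qed

lemma S_commuting:
  assumes "0 \<le> t" "0 \<le> s" "x \<in> D"
  shows "app (S t - S s) x \<in> D \<and> Y (app (S t - S s) x) = app (S t - S s) (Y x)"
  using assms by (simp add: app.diff_left D_Y_diff S_dom Y_S)

lemma bnd_integral:
  fixes h :: "real \<Rightarrow> ell1"
  assumes h: "h integrable_on {a..b}" and psi: "\<psi> integrable_on {a..b}"
    and le: "\<And>s. a < s \<Longrightarrow> s < b \<Longrightarrow> bnd (h s) (\<psi> s)"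
  shows "bnd (integral {a..b} h) (integral {a..b} \<psi>)"
  unfolding bnd_def
proof
  fix N
  have h': "h integrable_on {a<..<b}" and p': "\<psi> integrable_on {a<..<b}"
    using h psi by (simp_all add: integrable_on_Icc_iff_Ioo)
  \<comment> \<open>The finite weighted sum in \<open>bnd\<close> is the norm of a bounded operator
    W, so the usual norm bound for integrals applies. The open interval is used because the bound is
    only known inside.\<close>
  define W :: "ell1 \<Rightarrow> ell1" where "W x = (\<Sum>n<N. (tau n powr \<alpha> * coord x n) *\<^sub>R unit n)" for x
  have W: "bounded_linear W"
    unfolding W_def
    by (intro bounded_linear_sum bounded_linear_scaleR_const bounded_linear_const_mult bounded_linear_coord)
  have cW: "coord (W x) n = (if n < N then tau n powr \<alpha> * coord x n else 0)" for x n
  proof -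
    have "coord (W x) n = (\<Sum>m<N. if m = n then tau n powr \<alpha> * coord x n else 0)"
      unfolding W_def coord_sum by (rule sum.cong) (simp_all add: coord_unit)
    then show ?thesis by simp
  qed
  have nW: "norm (W x) = (\<Sum>n<N. tau n powr \<alpha> * \<bar>coord x n\<bar>)" for x
    unfolding norm_ell1_def by (subst suminf_finite[of "{..<N}"]) (auto simp: cW abs_mult)
  have "norm (integral {a<..<b} (W \<circ> h)) \<le> integral {a<..<b} \<psi>"
    by (rule integral_norm_bound_integral[OF integrable_linear[OF h' W] p']) (use le in \<open>simp add: nW bndD\<close>)
  moreover have "integral {a<..<b} (W \<circ> h) = W (integral {a<..<b} h)"
    by (rule integral_linear[OF h' W])
  ultimately show "(\<Sum>n<N. tau n powr \<alpha> * \<bar>coord (integral {a..b} h) n\<bar>) \<le> integral {a..b} \<psi>"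
    by (simp add: nW integral_open_interval_real)
qed

end

section \<open>Mild solutions of semilinear equations\<close>

context matrix_generator
begin

text \<open>\<open>J\<close> identifies \<open>ell1\<close> isometrically with the space with weight \<open>tau powr \<alpha>\<close>, and \<open>lift\<close> is its inverse
  (with an arbitrary value outside that space).\<close>

definition J :: "ell1 endo" where
  "J = endo_of (colsum (\<lambda>m. (tau m powr - \<alpha>) *\<^sub>R unit m))"

definition lift :: "ell1 \<Rightarrow> ell1" where
  "lift x = Abs_ell1 (\<lambda>n. tau n powr \<alpha> * coord x n)"

lemma tau_nonzero [simp]: "tau m \<noteq> 0"
  using less_imp_neq[OF tau_pos, of m] by simp

lemma tau_powr_le: "tau m powr - \<alpha> \<le> 1"
  using powr_mono2'[of "- \<alpha>" 1 "tau m"] tau_ge al by simp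

lemma norm_J_col: "norm ((tau m powr - \<alpha>) *\<^sub>R unit m) \<le> 1"
  using tau_powr_le by simp

lemma coord_J: "coord (app J y) m = tau m powr - \<alpha> * coord y m"
  unfolding J_def app_endo_of[OF bounded_linear_colsum[OF norm_J_col]]
  by (rule colsum_diag) (use summable_coord_bounded[OF norm_J_col, of y] in \<open>simp add: mult.commute\<close>)

lemma bnd_J_iff: "bnd (app J y) A \<longleftrightarrow> norm y \<le> A"
proof -
  have "tau n powr \<alpha> * \<bar>coord (app J y) n\<bar> = \<bar>coord y n\<bar>" for n
    by (simp add: coord_J abs_mult powr_minus field_simps)
  then show ?thesis
    unfolding bnd_def using norm_ell1_le[of y A] sum_abs_coord_le[of _ y] by (auto intro: order_trans)
qed

lemma bnd_J: "bnd (app J y) (norm y)"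
  by (simp add: bnd_J_iff)

lemma coord_lift:
  assumes "bnd x A"
  shows "coord (lift x) n = tau n powr \<alpha> * coord x n"
proof -
  have "summable (\<lambda>n. \<bar>tau n powr \<alpha> * coord x n\<bar>)"
    by (rule summable_absI[of _ A]) (use bndD[OF assms] in \<open>simp add: abs_mult\<close>)
  then show ?thesis by (simp add: lift_def coord_Abs)
qed

lemma J_lift: "bnd x A \<Longrightarrow> app J (lift x) = x"
  by (rule ell1_eqI) (simp add: coord_J coord_lift powr_minus field_simps)

lemma lift_J: "lift (app J y) = y"
  by (rule ell1_eqI) (simp add: coord_J coord_lift[OF bnd_J] powr_minus field_simps)

lemma J_inj: "app J y = app J z \<Longrightarrow> y = z"
  using lift_J by metis

lemma nonneg_J: "nonneg y \<Longrightarrow> nonneg (app J y)"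
  by (simp add: nonneg_def coord_J)

lemma nonneg_lift: "bnd x A \<Longrightarrow> nonneg x \<Longrightarrow> nonneg (lift x)"
  by (simp add: nonneg_def coord_lift)

lemma norm_lift_diff_le:
  assumes "bnd x A" "bnd z B" "bnd (x - z) Q"
  shows "norm (lift x - lift z) \<le> Q"
proof -
  have "app J (lift x - lift z) = x - z"
    using J_lift assms by (simp add: app.diff_right)
  then show ?thesis
    using assms bnd_J_iff by metis
qed

section \<open>Duhamel integrals; \<open>Pw\<close> is the primitive of the singularity
  \<open>r powr - \<alpha>\<close>\<close>

definition Pw :: "real \<Rightarrow> real" where
  "Pw t = t powr (1 - \<alpha>) / (1 - \<alpha>)"

lemma Pw_mono: "0 \<le> s \<Longrightarrow> s \<le> t \<Longrightarrow> Pw s \<le> Pw t"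
  using al by (simp add: Pw_def divide_right_mono powr_mono2)

lemma Pw_zero [simp]: "Pw 0 = 0"
  by (simp add: Pw_def)

lemma Pw_nonneg: "0 \<le> Pw t"
  using al by (simp add: Pw_def)

lemma continuous_Pw: "continuous_on {0..} Pw"
  unfolding Pw_def using al by (intro continuous_intros continuous_on_powr') auto

lemma Pw_small:
  assumes "0 < e"
  shows "\<exists>d>0. \<forall>t. 0 \<le> t \<and> t \<le> d \<longrightarrow> Pw t \<le> e"
proof -
  obtain d where d: "d > 0" "\<forall>t\<in>{0..}. dist t 0 < d \<longrightarrow> dist (Pw t) (Pw 0) < e"
    using continuous_Pw[unfolded continuous_on_iff, rule_format, of 0 e] assms by auto
  then show ?thesis
    by (intro exI[of _ "d / 2"]) (auto simp: dist_real_def Pw_nonneg intro!: less_imp_le)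
qed

lemma powr_has_integral:
  assumes "0 \<le> a" "a \<le> b"
  shows "((\<lambda>r. r powr - \<alpha>) has_integral (Pw b - Pw a)) {a..b}"
proof -
  have h: "((\<lambda>r. r powr - \<alpha>) has_integral Pw t) {0..t}" if "0 \<le> t" for t
    using has_integral_powr_from_0[of "- \<alpha>" t] al that by (simp add: Pw_def add.commute)
  have ib: "(\<lambda>r. r powr - \<alpha>) integrable_on {0..b}"
    using h[of b] assms by (auto simp: integrable_on_def)
  then have "integral {0..a} (\<lambda>r. r powr - \<alpha>) + integral {a..b} (\<lambda>r. r powr - \<alpha>) = integral {0..b} (\<lambda>r. r powr - \<alpha>)"
    using assms by (intro Henstock_Kurzweil_Integration.integral_combine) auto
  moreover have "integral {0..a} (\<lambda>r. r powr - \<alpha>) = Pw a" "integral {0..b} (\<lambda>r. r powr - \<alpha>) = Pw b"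
    using h assms by (auto intro!: integral_unique)
  ultimately have "integral {a..b} (\<lambda>r. r powr - \<alpha>) = Pw b - Pw a"
    by simp
  moreover have "(\<lambda>r. r powr - \<alpha>) integrable_on {a..b}"
    using ib assms by (elim integrable_subinterval_real) auto
  ultimately show ?thesis
    by (simp add: has_integral_iff)
qed

lemma bnd_singular_integral:
  assumes ab: "0 \<le> a" "a \<le> b" and h: "continuous_on {a..b} h"
    and le: "\<And>r. a < r \<Longrightarrow> r < b \<Longrightarrow> bnd (h r) (B * r powr - \<alpha>)"
  shows "bnd (integral {a..b} h) (B * (Pw b - Pw a))"
proof -
  have i: "((\<lambda>r. B * r powr - \<alpha>) has_integral (B * (Pw b - Pw a))) {a..b}"
    by (intro has_integral_mult_right powr_has_integral ab)
  have "bnd (integral {a..b} h) (integral {a..b} (\<lambda>r. B * r powr - \<alpha>))"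
    by (rule bnd_integral[OF integrable_continuous_real[OF h] has_integral_integrable[OF i] le])
  then show ?thesis
    by (simp only: integral_unique[OF i])
qed

lemma bnd_S_integral:
  assumes ab: "0 \<le> a" "a \<le> b" and h: "continuous_on {a..b} h"
    and le: "\<And>r. a < r \<Longrightarrow> r < b \<Longrightarrow> norm (h r) \<le> M"
  shows "bnd (integral {a..b} (\<lambda>r. app (S r) (h r))) (Ka * M * (Pw b - Pw a))"
proof (rule bnd_singular_integral[OF ab])
  show "continuous_on {a..b} (\<lambda>r. app (S r) (h r))"
    using ab by (intro continuous_on_S continuous_on_id h) auto
  fix r assume r: "a < r" "r < b"
  show "bnd (app (S r) (h r)) (Ka * M * r powr - \<alpha>)"
  proof (rule bnd_mono[OF bnd_S])
    show "Ka * r powr - \<alpha> * norm (h r) \<le> Ka * M * r powr - \<alpha>"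
      using le[OF r] Ka_pos by (simp add: mult_ac mult_left_mono mult_right_mono)
  qed (use r ab in simp)
qed

text \<open>The Duhamel integral in terms of the elapsed time r. The singularity of the semigroup
  sits at r = 0 for every t, so two times can be compared under one integral.\<close>

definition conv :: "(real \<Rightarrow> ell1) \<Rightarrow> real \<Rightarrow> ell1" where
  "conv G t = integral {0..t} (\<lambda>r. app (S r) (G (t - r)))"

lemma conv_zero [simp]: "conv G 0 = 0"
  by (simp add: conv_def)

lemma continuous_reverse: "continuous_on {0..T} G \<Longrightarrow> t \<le> T \<Longrightarrow> 0 \<le> a \<Longrightarrow> b \<le> t \<Longrightarrow> continuous_on {a..b} (\<lambda>r. G (t - r))" for t T a b :: real
  by (rule continuous_on_compose2[of "{0..T}" G]) (auto intro!: continuous_intros)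

lemma continuous_conv_integrand:
  "continuous_on {0..T} G \<Longrightarrow> t \<le> T \<Longrightarrow> 0 \<le> a \<Longrightarrow> b \<le> t \<Longrightarrow> continuous_on {a..b} (\<lambda>r. app (S r) (G (t - r)))"
  by (intro continuous_on_S continuous_on_id continuous_reverse) auto

text \<open>By the semigroup law the elapsed times beyond e factor through \<open>S e\<close>: the
  integral restarts from its value at t - e.\<close>

lemma conv_split:
  assumes G: "continuous_on {0..T} G" and e: "0 \<le> e" "e \<le> t" "t \<le> T"
  shows "conv G t = integral {0..e} (\<lambda>r. app (S r) (G (t - r))) + app (S e) (conv G (t - e))"
proof -
  let ?h = "\<lambda>r. app (S r) (G (t - r))"
  have i: "?h integrable_on {0..t}"
    by (rule integrable_continuous_real[OF continuous_conv_integrand[OF G]]) (use e in auto)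
  have "integral {e..t} ?h = integral {0..t - e} (?h \<circ> (+) e)"
    using integral_shift_Icc_real[of 0 "t - e" ?h e] by simp
  also have "\<dots> = integral {0..t - e} (app (S e) \<circ> (\<lambda>r. app (S r) (G (t - e - r))))"
    by (rule integral_cong) (use e in \<open>auto simp: S_add diff_diff_eq\<close>)
  also have "\<dots> = app (S e) (conv G (t - e))"
    unfolding conv_def
    by (rule integral_linear[OF integrable_continuous_real[OF continuous_conv_integrand[OF G]] app.bounded_linear_right])
      (use e in auto)
  finally show ?thesis
    unfolding conv_def[of G t] using Henstock_Kurzweil_Integration.integral_combine[OF e(1,2) i] by simp
qed

lemma bnd_conv:
  assumes G: "continuous_on {0..T} G" and t: "0 \<le> t" "t \<le> T" and M: "\<And>s. 0 \<le> s \<Longrightarrow> s \<le> t \<Longrightarrow> norm (G s) \<le> M"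
  shows "bnd (conv G t) (Ka * M * Pw t)"
  unfolding conv_def using bnd_S_integral[of 0 t "\<lambda>r. G (t - r)" M] continuous_reverse[OF G t(2)] t M by simp

lemma bnd_conv_ex:
  assumes G: "continuous_on {0..T} G" and t: "0 \<le> t" "t \<le> T"
  shows "\<exists>A. bnd (conv G t) A"
proof -
  have "bounded (G ` {0..T})"
    by (rule compact_imp_bounded[OF compact_continuous_image[OF G]]) simp
  then obtain M where "\<And>s. s \<in> {0..T} \<Longrightarrow> norm (G s) \<le> M"
    unfolding bounded_iff by blast
  then show ?thesis
    using bnd_conv[OF G t, of M] t by auto
qed

lemma conv_diff:
  assumes "continuous_on {0..T} G" "continuous_on {0..T} H" "0 \<le> t" "t \<le> T"
  shows "conv G t - conv H t = conv (\<lambda>s. G s - H s) t"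
  unfolding conv_def app.diff_right
  by (rule integral_diff[symmetric]) (use assms in \<open>auto intro!: integrable_continuous_real continuous_conv_integrand\<close>)

lemma continuous_conv:
  assumes G: "continuous_on {0..T} G"
  shows "continuous_on {0..T} (\<lambda>t. lift (conv G t))"
proof (cases "0 \<le> T")
  case T: True
  have "bounded (G ` {0..T})"
    by (rule compact_imp_bounded[OF compact_continuous_image[OF G]]) simp
  then obtain M where M: "0 < M" "\<And>s. s \<in> {0..T} \<Longrightarrow> norm (G s) \<le> M"
    by (auto simp: bounded_pos)
  have uG: "uniformly_continuous_on {0..T} G"
    by (rule compact_uniformly_continuous[OF G]) simp
  have uP: "uniformly_continuous_on {0..T} Pw"
    by (rule compact_uniformly_continuous[OF continuous_on_subset[OF continuous_Pw]]) auto
  show ?thesis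
    unfolding continuous_on_iff
  proof (intro ballI allI impI)
    fix t e :: real assume t: "t \<in> {0..T}" and e: "0 < e"
    \<comment> \<open>\<open>e1\<close> bounds the change of G under a time shift on {0..s},
      \<open>e2\<close> the weight of the new piece {s..t}; each contributes e/4. The 1 keeps the
      denominator positive.\<close>
    define e1 where "e1 = e / (4 * Ka * (Pw T + 1))"
    define e2 where "e2 = e / (4 * Ka * M)"
    have e12: "0 < e1" "0 < e2"
      using e Ka_pos M Pw_nonneg[of T] by (auto simp: e1_def e2_def)
    obtain d1 where d1: "0 < d1" "\<And>s t. s \<in> {0..T} \<Longrightarrow> t \<in> {0..T} \<Longrightarrow> \<bar>s - t\<bar> < d1 \<Longrightarrow> norm (G s - G t) < e1"
      using uG e12(1) unfolding uniformly_continuous_on_def dist_norm real_norm_def by meson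
    obtain d2 where d2: "0 < d2" "\<And>s t. s \<in> {0..T} \<Longrightarrow> t \<in> {0..T} \<Longrightarrow> \<bar>s - t\<bar> < d2 \<Longrightarrow> \<bar>Pw s - Pw t\<bar> < e2"
      using uP e12(2) unfolding uniformly_continuous_on_def dist_norm real_norm_def by meson
    have key: "bnd (conv G t - conv G s) (e / 2)" if st: "0 \<le> s" "s \<le> t" "t \<le> T" "t - s < d1" "t - s < d2" for s t
    proof -
      let ?h = "\<lambda>r. app (S r) (G (t - r))"
      have i1: "conv G t = integral {0..s} ?h + integral {s..t} ?h"
        unfolding conv_def using st
        by (intro Henstock_Kurzweil_Integration.integral_combine[symmetric] integrable_continuous_real continuous_conv_integrand[OF G]) auto
      have i2: "integral {0..s} ?h - conv G s = integral {0..s} (\<lambda>r. app (S r) (G (t - r) - G (s - r)))"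
        unfolding conv_def app.diff_right using st
        by (intro integral_diff[symmetric] integrable_continuous_real continuous_conv_integrand[OF G]) auto
      have eq: "conv G t - conv G s = integral {0..s} (\<lambda>r. app (S r) (G (t - r) - G (s - r))) + integral {s..t} ?h"
        unfolding i1 i2[symmetric] by simp
      have 1: "bnd (integral {0..s} (\<lambda>r. app (S r) (G (t - r) - G (s - r)))) (Ka * e1 * (Pw s - Pw 0))"
      proof (rule bnd_S_integral)
        show "continuous_on {0..s} (\<lambda>r. G (t - r) - G (s - r))"
          using st by (intro continuous_intros continuous_reverse[OF G]) auto
        show "norm (G (t - r) - G (s - r)) \<le> e1" if "0 < r" "r < s" for r
          using d1(2)[of "t - r" "s - r"] st that by auto
      qed (use st in auto)
      have 2: "bnd (integral {s..t} ?h) (Ka * M * (Pw t - Pw s))"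
        using st M(2) by (intro bnd_S_integral continuous_reverse[OF G]) auto
      have "Ka * e1 * (Pw s - Pw 0) \<le> Ka * e1 * (Pw T + 1)"
        using Ka_pos e12 Pw_mono[of s T] st by (intro mult_left_mono) auto
      also have "\<dots> = e / 4"
      proof -
        have "Ka * (e / (4 * Ka * q)) * q = e / 4" if "q > 0" for q
          using that Ka_pos by simp
        from this[of "Pw T + 1"] show ?thesis
          using Pw_nonneg[of T] by (simp only: e1_def)
      qed
      finally have "Ka * e1 * (Pw s - Pw 0) \<le> e / 4" .
      moreover have "Ka * M * (Pw t - Pw s) \<le> Ka * M * e2"
        using Ka_pos M d2(2)[of t s] st by (intro mult_left_mono) auto
      moreover have "Ka * M * e2 = e / 4"
        using Ka_pos M by (simp add: e2_def)
      ultimately show ?thesis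
        unfolding eq by (intro bnd_mono[OF bnd_add[OF 1 2]]) linarith
    qed
    have "dist (lift (conv G s)) (lift (conv G t)) < e" if s: "s \<in> {0..T}" "dist s t < min d1 d2" for s
    proof -
      have "bnd (conv G s - conv G t) (e / 2)"
      proof (cases "s \<le> t")
        case True
        then have "bnd (- (conv G s - conv G t)) (e / 2)"
          using key[of s t] s t by (simp add: dist_real_def)
        then show ?thesis by (simp only: bnd_uminus)
      next
        case False
        then show ?thesis
          using key[of t s] s t by (simp add: dist_real_def)
      qed
      moreover obtain A B where "bnd (conv G s) A" "bnd (conv G t) B"
        using bnd_conv_ex[OF G] s t by fastforce
      ultimately have "norm (lift (conv G s) - lift (conv G t)) \<le> e / 2"
        using norm_lift_diff_le by blast
      then show ?thesis
        using e by (simp add: dist_norm)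
    qed
    then show "\<exists>d>0. \<forall>s\<in>{0..T}. dist s t < d \<longrightarrow> dist (lift (conv G s)) (lift (conv G t)) < e"
      using d1 d2 by (intro exI[of _ "min d1 d2"]) auto
  qed
qed simp

lemma continuous_conv': "continuous_on {0..T} G \<Longrightarrow> continuous_on {0..T} (conv G)"
  using continuous_on_cong[of "{0..T}" "{0..T}" "\<lambda>t. app J (lift (conv G t))" "conv G"] J_lift bnd_conv_ex[of T G]
    app.continuous_on[OF continuous_on_const continuous_conv[of T G]]
  by (metis atLeastAtMost_iff)

text \<open>Operators in the semigroup and their differences commute with Y on D, so
  \<open>bnd_commuting\<close> carries their norm bounds to the intermediate space.\<close>

lemma
  assumes "0 \<le> t"
  shows bnd_SJ: "bnd (app (S t) (app J y)) (Kb * norm y)"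
    and bnd_SJ_diff: "0 \<le> s \<Longrightarrow> norm (S t - S s) \<le> k \<Longrightarrow> bnd (app (S t) (app J y) - app (S s) (app J y)) (Kb * k * norm y)"
proof -
  show "bnd (app (S t) (app J y)) (Kb * norm y)"
    using bnd_commuting[OF _ norm_S[OF assms] bnd_J, of y] S_dom[OF assms] Y_S[OF assms] by simp
  show "bnd (app (S t) (app J y) - app (S s) (app J y)) (Kb * k * norm y)" if "0 \<le> s" "norm (S t - S s) \<le> k"
    using bnd_commuting[OF _ that(2) bnd_J, of y] S_commuting[OF assms that(1)] by (simp add: app.diff_left)
qed

text \<open>For a truncated y the vector J y has finite support, hence lies in D, where continuity
  of the orbit and of its image under Y controls the intermediate norm. The remainder is small
  uniformly in time, as \<open>S s - S t\<close> has norm at most 2.\<close>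

lemma continuous_SJ: "continuous_on {0..} (\<lambda>t. lift (app (S t) (app J y)))"
  unfolding continuous_on_iff
proof (intro ballI allI impI)
  fix t e :: real assume t: "t \<in> {0..}" and e: "0 < e"
  obtain N where N: "norm (y - trunc N y) < e / (4 * Kb)"
    using LIMSEQ_D[OF trunc_tendsto[of y], of "e / (4 * Kb)"] e Kb_pos by (auto simp: norm_minus_commute)
  define z where "z = app J (trunc N y)"
  have zD: "z \<in> D"
    by (rule finite_support_D) (auto simp: z_def coord_J coord_trunc intro: finite_subset[of _ "{..<N}"])
  have c1: "\<exists>d>0. \<forall>s\<ge>0. \<bar>s - t\<bar> < d \<longrightarrow> norm (app (S s) x - app (S t) x) < f" if "f > 0" for x f
    using continuous_S0[of x, unfolded continuous_on_iff, rule_format, OF t that] by (simp add: dist_norm Ball_def)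
  obtain d1 where d1: "d1 > 0" "\<And>s. 0 \<le> s \<Longrightarrow> \<bar>s - t\<bar> < d1 \<Longrightarrow> norm (app (S s) z - app (S t) z) < e / 8"
    using c1[of "e / 8" z] e by auto
  obtain d2 where d2: "d2 > 0" "\<And>s. 0 \<le> s \<Longrightarrow> \<bar>s - t\<bar> < d2 \<Longrightarrow> norm (app (S s) (Y z) - app (S t) (Y z)) < e / 8 * c"
    using c1[of "e / 8 * c" "Y z"] e c_pos by auto
  have "dist (lift (app (S s) (app J y))) (lift (app (S t) (app J y))) < e" if s: "s \<in> {0..}" "dist s t < min d1 d2" for s
  proof -
    let ?w = "y - trunc N y"
    have "norm (S s - S t) \<le> 2"
      using norm_triangle_ineq4[of "S s" "S t"] norm_S[of s] norm_S[of t] s t by simp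
    then have 1: "bnd (app (S s) (app J ?w) - app (S t) (app J ?w)) (Kb * 2 * norm ?w)"
      using s t by (intro bnd_SJ_diff) auto
    let ?u = "app (S s) z - app (S t) z"
    have u: "?u \<in> D" "Y ?u = app (S s) (Y z) - app (S t) (Y z)"
      using D_Y_diff[of "app (S s) z" "app (S t) z"] S_dom[OF _ zD] Y_S[OF _ zD] s t by auto
    have "c * tnorm ?u \<le> e / 8 * c"
      using norm_Y_ge[OF u(1)] d2(2)[of s] s unfolding u(2) by (simp add: dist_real_def)
    then have "tnorm ?u \<le> e / 8"
      using c_pos by (simp add: mult.commute)
    then have 2: "bnd ?u (e / 4)"
      using d1(2)[of s] s by (intro bnd_mono[OF bnd_interpolate[OF u(1), of 1]]) (simp_all add: dist_real_def)
    have "app (S s) (app J y) - app (S t) (app J y) = (app (S s) (app J ?w) - app (S t) (app J ?w)) + ?u"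
      by (simp add: z_def app.diff_right)
    moreover have "Kb * 2 * norm ?w < e / 2"
      using N Kb_pos by (simp add: field_simps)
    ultimately have "bnd (app (S s) (app J y) - app (S t) (app J y)) (e * 3 / 4)"
      using bnd_add[OF 1 2] by (auto elim: bnd_mono)
    then have "norm (lift (app (S s) (app J y)) - lift (app (S t) (app J y))) \<le> e * 3 / 4"
      using s t by (intro norm_lift_diff_le[OF bnd_SJ bnd_SJ]) auto
    then show ?thesis
      using e by (simp add: dist_norm)
  qed
  then show "\<exists>d>0. \<forall>s\<in>{0..}. dist s t < d \<longrightarrow> dist (lift (app (S s) (app J y))) (lift (app (S t) (app J y))) < e"
    using d1 d2 by (intro exI[of _ "min d1 d2"]) auto
qed

lemma nonneg_integral:
  fixes h :: "real \<Rightarrow> ell1"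
  assumes "h integrable_on A" "\<And>r. r \<in> A \<Longrightarrow> nonneg (h r)"
  shows "nonneg (integral A h)"
  unfolding nonneg_def
proof
  fix n
  have "coord (integral A h) n = integral A ((\<lambda>x. coord x n) \<circ> h)"
    by (rule integral_linear[symmetric, OF assms(1) bounded_linear_coord])
  also have "\<dots> \<ge> 0"
    by (rule Henstock_Kurzweil_Integration.integral_nonneg[OF integrable_linear[OF assms(1) bounded_linear_coord]])
      (use assms(2) in \<open>auto simp: nonneg_def\<close>)
  finally show "0 \<le> coord (integral A h) n" .
qed

text \<open>Here \<open>y0\<close>, \<open>y\<close> and the argument of \<open>F\<close> are given in the coordinates of the intermediate space, the value
  of \<open>F\<close> in those of the basic space.\<close>

definition mild :: "(ell1 \<Rightarrow> ell1) \<Rightarrow> ell1 \<Rightarrow> real \<Rightarrow> (real \<Rightarrow> ell1) \<Rightarrow> bool" where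
  "mild F y0 T y \<longleftrightarrow> continuous_on {0..T} y \<and>
     (\<forall>t\<in>{0..T}. app J (y t) = app (S t) (app J y0) + conv (\<lambda>s. F (y s)) t)"

section \<open>Local existence and uniqueness of mild solutions\<close>

definition lip_on :: "real \<Rightarrow> (ell1 \<Rightarrow> ell1) \<Rightarrow> real \<Rightarrow> bool" where
  "lip_on r F L \<longleftrightarrow> (\<forall>y z. norm y \<le> r \<longrightarrow> norm z \<le> r \<longrightarrow> norm (F y - F z) \<le> L * norm (y - z))"

lemma lip_on_continuous:
  assumes "lip_on r F L" "continuous_on A y" "\<And>s. s \<in> A \<Longrightarrow> norm (y s) \<le> r"
  shows "continuous_on A (\<lambda>s. F (y s))"
  unfolding continuous_on_def
proof
  fix s assume s: "s \<in> A"
  have "((\<lambda>s'. F (y s') - F (y s)) \<longlongrightarrow> 0) (at s within A)"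
  proof (rule tendsto_norm_zero_cancel, rule tendsto_sandwich[of "\<lambda>_. 0"])
    have "((\<lambda>s'. L * norm (y s' - y s)) \<longlongrightarrow> L * norm (y s - y s)) (at s within A)"
      using assms(2) s unfolding continuous_on_def by (intro tendsto_intros) blast
    then show "((\<lambda>s'. L * norm (y s' - y s)) \<longlongrightarrow> 0) (at s within A)" by simp
    show "\<forall>\<^sub>F s' in at s within A. norm (F (y s') - F (y s)) \<le> L * norm (y s' - y s)"
      using assms(1,3) s by (auto simp: lip_on_def eventually_at_filter intro!: always_eventually)
  qed auto
  then show "((\<lambda>s. F (y s)) \<longlongrightarrow> F (y s)) (at s within A)"
    by (rule LIM_zero_cancel)
qed

lemma mild_initial: "mild F y0 T y \<Longrightarrow> 0 \<le> T \<Longrightarrow> y 0 = y0"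
  by (rule J_inj) (simp add: mild_def)

text \<open>The radius leaves room 1 around y0: the free evolution uses 1/2 by continuity, the
  Duhamel term 1/2 by smallness of \<open>Pw T\<close>. The last conjunct is kept because the
  dilation argument absorbs a term with it.\<close>

lemma mild_exists:
  assumes lip: "lip_on r F L" and r: "r = norm y0 + 1"
    and F: "\<And>y. nonneg y \<Longrightarrow> norm y \<le> r \<Longrightarrow> nonneg (F y)" and y0: "nonneg y0"
  shows "\<exists>T>0. \<exists>y. mild F y0 T y \<and> (\<forall>t\<in>{0..T}. nonneg (y t) \<and> norm (y t) \<le> r) \<and> Ka * L * Pw T \<le> 1 / 2"
proof -
  define M where "M = norm (F 0) + \<bar>L\<bar> * r"
  have r0: "0 \<le> r" by (simp add: r)
  have FM: "norm (F y) \<le> M" if "norm y \<le> r" for y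
  proof -
    have "norm (F y - F 0) \<le> L * norm (y - 0)"
      using lip that r0 unfolding lip_on_def by (metis norm_zero)
    also have "\<dots> \<le> \<bar>L\<bar> * r"
      using that by (intro mult_mono) auto
    finally show ?thesis
      using norm_triangle_sub[of "F y" "F 0"] by (simp add: M_def)
  qed
  have M0: "0 \<le> M" using r0 by (simp add: M_def)
  define h where "h t = lift (app (S t) (app J y0))" for t
  have h0: "h 0 = y0" by (simp add: h_def lift_J)
  obtain d1 where d1': "d1 > 0" "\<forall>t\<in>{0..}. dist t 0 < d1 \<longrightarrow> dist (h t) (h 0) < 1 / 2"
    using continuous_SJ[of y0, unfolded continuous_on_iff, rule_format, of 0 "1 / 2"]
    unfolding h_def by auto
  then have d1: "d1 > 0" "\<And>t. 0 \<le> t \<Longrightarrow> t < d1 \<Longrightarrow> norm (h t - y0) < 1 / 2"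
    by (auto simp: h0 dist_norm)
  \<comment> \<open>One smallness condition serves both purposes: M for mapping the ball into
    itself, the Lipschitz constant for contraction; 1 excludes a zero denominator.\<close>
  define k where "k = 1 / (2 * Ka * (M + \<bar>L\<bar> + 1))"
  have k: "0 < k" using M0 Ka_pos by (simp add: k_def)
  obtain d2 where d2: "d2 > 0" "\<And>t. 0 \<le> t \<Longrightarrow> t \<le> d2 \<Longrightarrow> Pw t \<le> k"
    using Pw_small[OF k] by auto
  define T where "T = min (d1 / 2) d2"
  have T: "0 < T" "T < d1" "T \<le> d2"
    using d1 d2 by (auto simp: T_def)
  have KP: "Ka * B * Pw T \<le> 1 / 2" if "B \<le> M + \<bar>L\<bar> + 1" for B
  proof -
    have "Ka * B * Pw T \<le> Ka * (M + \<bar>L\<bar> + 1) * Pw T"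
      using that Ka_pos Pw_nonneg[of T] by (intro mult_right_mono mult_left_mono) auto
    also have "\<dots> \<le> Ka * (M + \<bar>L\<bar> + 1) * k"
      using d2(2)[of T] T M0 Ka_pos by (intro mult_left_mono) auto
    also have "\<dots> = 1 / 2"
      using M0 Ka_pos by (simp add: k_def add_nonneg_eq_0_iff)
    finally show ?thesis .
  qed
  \<comment> \<open>Clamping the time to [0,T] turns curves on the interval into bounded continuous
    functions on the line, whose complete space hosts the fixed point argument.\<close>
  define cl where "cl t = min T (max 0 t)" for t :: real
  have cl: "cl t \<in> {0..T}" for t
    using T by (auto simp: cl_def)
  have cl_id: "cl t = t" if "t \<in> {0..T}" for t
    using that by (auto simp: cl_def)
  define B where "B = {y. nonneg y \<and> norm y \<le> r}"
  have B: "closed B"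
    unfolding B_def Collect_conj_eq by (intro closed_Int closed_nonneg closed_Collect_le continuous_intros)
  define X where "X = PiC (UNIV :: real set) (\<lambda>_. B)"
  have X: "u \<in> X \<longleftrightarrow> (\<forall>t. apply_bcontfun u t \<in> B)" for u
    by (auto simp: X_def mem_PiC_iff)
  define G where "G u s = F (apply_bcontfun u s)" for u and s :: real
  have Gc: "continuous_on {0..T} (G u)" if "u \<in> X" for u
    unfolding G_def using that by (intro lip_on_continuous[OF lip] continuous_on_apply_bcontfun) (auto simp: X B_def)
  have GM: "norm (G u s) \<le> M" if "u \<in> X" for u s
    using that FM by (auto simp: X B_def G_def)
  define f where "f u t = h (cl t) + lift (conv (G u) (cl t))" for u t
  have bc: "bnd (conv (G u) t) (1 / 2)" if "u \<in> X" "t \<in> {0..T}" for u t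
  proof (rule bnd_mono[OF bnd_conv[OF Gc[OF that(1)]]])
    have "Ka * M * Pw t \<le> Ka * M * Pw T"
      using that Ka_pos M0 by (intro mult_left_mono Pw_mono) auto
    also have "\<dots> \<le> 1 / 2"
      by (rule KP) simp
    finally show "Ka * M * Pw t \<le> 1 / 2" .
  qed (use that GM in auto)
  have fB: "f u t \<in> B" if u: "u \<in> X" for u t
  proof -
    have nn: "nonneg (conv (G u) (cl t))"
      unfolding conv_def
    proof (rule nonneg_integral)
      show "(\<lambda>r. app (S r) (G u (cl t - r))) integrable_on {0..cl t}"
        using cl[of t] by (intro integrable_continuous_real continuous_conv_integrand[OF Gc[OF u]]) auto
      show "nonneg (app (S r) (G u (cl t - r)))" if "r \<in> {0..cl t}" for r
        using that u F by (intro nonneg_S) (auto simp: G_def X B_def)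
    qed
    have "nonneg (f u t)"
      unfolding f_def h_def using cl[of t] y0
      by (intro nonneg_add nonneg_lift[OF bnd_SJ] nonneg_lift[OF bc[OF u]] nn nonneg_S nonneg_J) auto
    moreover have "norm (lift (conv (G u) (cl t))) \<le> 1 / 2"
      using bc[OF u cl[of t]] J_lift bnd_J_iff by metis
    then have "norm (f u t - y0) \<le> 1"
      using d1(2)[of "cl t"] cl[of t] T norm_triangle_ineq[of "h (cl t) - y0" "lift (conv (G u) (cl t))"]
      by (simp add: f_def algebra_simps)
    then have "norm (f u t) \<le> r"
      using norm_triangle_sub[of "f u t" y0] by (simp add: r)
    ultimately show ?thesis by (simp add: B_def)
  qed
  have fc: "f u \<in> bcontfun" if u: "u \<in> X" for u
  proof (rule bcontfun_normI)
    have ccl: "continuous_on UNIV cl"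
      unfolding cl_def by (intro continuous_intros)
    show "continuous_on UNIV (f u)"
      unfolding f_def h_def using cl
      by (intro continuous_on_add continuous_on_compose2[OF continuous_SJ ccl]
          continuous_on_compose2[OF continuous_conv[OF Gc[OF u]] ccl]) auto
    show "norm (f u t) \<le> r" for t
      using fB[OF u] by (auto simp: B_def)
  qed
  define \<Phi> where "\<Phi> u = Bcontfun (f u)" for u
  have \<Phi>: "apply_bcontfun (\<Phi> u) = f u" if "u \<in> X" for u
    using fc[OF that] by (simp add: \<Phi>_def Bcontfun_inverse)
  have "\<exists>!u\<in>X. \<Phi> u = u"
  proof (rule Banach_fix[where c = "1 / 2"])
    show "complete X"
      unfolding X_def complete_eq_closed by (intro closed_PiC B)
    have "const_bcontfun y0 \<in> X"
      using y0 by (simp add: X B_def r)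
    then show "X \<noteq> {}" by auto
    show "\<Phi> ` X \<subseteq> X"
      using \<Phi> fB by (auto simp: X)
    fix u w assume uw: "u \<in> X" "w \<in> X"
    show "dist (\<Phi> u) (\<Phi> w) \<le> 1 / 2 * dist u w"
    proof (rule dist_bound)
      fix t
      let ?t = "cl t"
      have t: "?t \<in> {0..T}" using cl .
      have "norm (G u s - G w s) \<le> \<bar>L\<bar> * dist u w" for s
      proof -
        have "norm (G u s - G w s) \<le> L * norm (apply_bcontfun u s - apply_bcontfun w s)"
          using lip uw by (auto simp: lip_on_def G_def X B_def)
        also have "\<dots> \<le> \<bar>L\<bar> * dist u w"
          using dist_bounded[of u s w] by (intro mult_mono) (auto simp: dist_norm)
        finally show ?thesis .
      qed
      then have "bnd (conv (\<lambda>s. G u s - G w s) ?t) (Ka * (\<bar>L\<bar> * dist u w) * Pw ?t)"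
        using t uw by (intro bnd_conv[of T] continuous_on_diff Gc) auto
      then have "bnd (conv (G u) ?t - conv (G w) ?t) (Ka * (\<bar>L\<bar> * dist u w) * Pw ?t)"
        using t uw by (subst conv_diff[of T]) (auto intro: Gc)
      then have "norm (lift (conv (G u) ?t) - lift (conv (G w) ?t)) \<le> Ka * (\<bar>L\<bar> * dist u w) * Pw ?t"
        by (rule norm_lift_diff_le[OF bc[OF uw(1) t] bc[OF uw(2) t]])
      also have "\<dots> \<le> Ka * (\<bar>L\<bar> * dist u w) * Pw T"
        using t Ka_pos by (intro mult_left_mono Pw_mono) auto
      also have "\<dots> = (Ka * \<bar>L\<bar> * Pw T) * dist u w"
        by simp
      also have "\<dots> \<le> 1 / 2 * dist u w"
        using M0 by (intro mult_right_mono KP) auto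
      finally show "dist (apply_bcontfun (\<Phi> u) t) (apply_bcontfun (\<Phi> w) t) \<le> 1 / 2 * dist u w"
        using uw by (simp add: \<Phi> f_def dist_norm)
    qed
  qed auto
  then obtain u where u: "u \<in> X" "\<Phi> u = u" by blast
  have fu: "apply_bcontfun u t = f u t" for t
    using \<Phi>[OF u(1)] u(2) by simp
  have "app J (apply_bcontfun u t) = app (S t) (app J y0) + conv (\<lambda>s. F (apply_bcontfun u s)) t" if "t \<in> {0..T}" for t
    using that J_lift[OF bnd_SJ] J_lift[OF bc[OF u(1) that]]
    unfolding fu[of t] f_def by (simp add: cl_id app.add_right h_def G_def[abs_def])
  then have "mild F y0 T (apply_bcontfun u)"
    by (simp add: mild_def)
  moreover have "\<forall>t\<in>{0..T}. nonneg (apply_bcontfun u t) \<and> norm (apply_bcontfun u t) \<le> r"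
    using u(1) by (auto simp: X B_def)
  moreover have "Ka * L * Pw T \<le> 1 / 2"
    using M0 by (intro KP) auto
  ultimately show ?thesis
    using T(1) by blast
qed

text \<open>Agreement is propagated in steps of length d, comparing the difference with its own
  maximum. As d depends only on a Lipschitz constant for a ball containing both curves, finitely
  many steps reach t.\<close>

lemma mild_unique:
  assumes lip: "\<And>r. \<exists>L. lip_on r F L" and y: "mild F y0 T y" and z: "mild F y0 T z" and t: "t \<in> {0..T}"
  shows "y t = z t"
proof -
  have cyz: "continuous_on {0..T} y" "continuous_on {0..T} z"
    using y z by (auto simp: mild_def)
  have "bounded (y ` {0..T})" "bounded (z ` {0..T})"
    using cyz by (auto intro!: compact_imp_bounded[OF compact_continuous_image])
  then obtain r1 r2 where "\<And>s. s \<in> {0..T} \<Longrightarrow> norm (y s) \<le> r1" "\<And>s. s \<in> {0..T} \<Longrightarrow> norm (z s) \<le> r2"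
    unfolding bounded_iff by blast
  then have r: "norm (y s) \<le> max r1 r2" "norm (z s) \<le> max r1 r2" if "s \<in> {0..T}" for s
    using that by (auto simp: le_max_iff_disj)
  obtain L where L: "lip_on (max r1 r2) F L"
    using lip by blast
  have cF: "continuous_on {0..T} (\<lambda>s. F (y s))" "continuous_on {0..T} (\<lambda>s. F (z s))"
    using r by (auto intro: lip_on_continuous[OF L] cyz)
  define k where "k = 1 / (2 * Ka * (\<bar>L\<bar> + 1))"
  have k: "0 < k" using Ka_pos by (simp add: k_def)
  obtain d where d: "d > 0" "\<And>t. 0 \<le> t \<Longrightarrow> t \<le> d \<Longrightarrow> Pw t \<le> k"
    using Pw_small[OF k] by auto
  have step: "y s = z s" if eq: "\<And>s. s \<in> {0..T} \<Longrightarrow> s \<le> a \<Longrightarrow> y s = z s" and a: "0 \<le> a"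
    and s: "s \<in> {0..T}" "s \<le> a + d" for a s
  proof -
    define b where "b = min (a + d) T"
    have b: "0 \<le> b" "b \<le> T" "b \<le> a + d" "s \<le> b"
      using a d s by (auto simp: b_def)
    have "continuous_on {0..b} (\<lambda>s. norm (y s - z s))"
      using b by (intro continuous_intros continuous_on_subset[OF cyz(1)] continuous_on_subset[OF cyz(2)]) auto
    then obtain m where m: "m \<in> {0..b}" "\<And>s. s \<in> {0..b} \<Longrightarrow> norm (y s - z s) \<le> norm (y m - z m)"
      using continuous_attains_sup[of "{0..b}" "\<lambda>s. norm (y s - z s)"] b by auto
    let ?A = "norm (y m - z m)"
    have "?A \<le> 1 / 2 * ?A"
    proof (cases "m \<le> a")
      case True
      then show ?thesis using eq[of m] m b by simp
    next
      case False
      define H where "H s = F (y s) - F (z s)" for s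
      have Hc: "continuous_on {0..T} H"
        unfolding H_def by (intro continuous_on_diff cF)
      have H: "norm (H s) \<le> \<bar>L\<bar> * ?A" if "s \<in> {0..b}" for s
      proof -
        have "norm (H s) \<le> L * norm (y s - z s)"
          using L r that b by (auto simp: lip_on_def H_def)
        also have "\<dots> \<le> \<bar>L\<bar> * ?A"
          using m(2)[OF that] by (intro mult_mono) auto
        finally show ?thesis .
      qed
      have mT: "m \<in> {0..T}" using m b by auto
      have "app J (y m - z m) = conv H m"
        using y z mT cF conv_diff[OF cF, of m] by (simp add: mild_def app.diff_right H_def[abs_def])
      \<comment> \<open>H vanishes up to time a, so only elapsed times up to m - a, at most d,
        contribute; the weight \<open>Pw (m - a)\<close> is small whatever a is.\<close>
      also have "\<dots> = integral {0..m - a} (\<lambda>r. app (S r) (H (m - r))) + app (S (m - a)) (conv H a)"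
        using conv_split[OF Hc, of "m - a" m] False mT a by simp
      also have "conv H a = integral {0..a} (\<lambda>r. 0)"
        unfolding conv_def by (rule integral_cong) (use eq mT False in \<open>auto simp: H_def\<close>)
      finally have "app J (y m - z m) = integral {0..m - a} (\<lambda>r. app (S r) (H (m - r)))"
        by simp
      moreover have "bnd \<dots> (Ka * (\<bar>L\<bar> * ?A) * (Pw (m - a) - Pw 0))"
        using False m mT a by (intro bnd_S_integral continuous_reverse[OF Hc] H) auto
      ultimately have "bnd (app J (y m - z m)) (Ka * (\<bar>L\<bar> * ?A) * Pw (m - a))"
        by simp
      then have "?A \<le> Ka * (\<bar>L\<bar> * ?A) * Pw (m - a)"
        by (simp only: bnd_J_iff)
      also have "\<dots> = (Ka * \<bar>L\<bar> * Pw (m - a)) * ?A" by simp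
      also have "\<dots> \<le> 1 / 2 * ?A"
      proof (rule mult_right_mono)
        have "Ka * \<bar>L\<bar> * Pw (m - a) \<le> Ka * (\<bar>L\<bar> + 1) * k"
          using d(2)[of "m - a"] False m b Ka_pos Pw_nonneg by (intro mult_mono) auto
        also have "\<dots> = 1 / 2"
          using Ka_pos by (simp add: k_def add_nonneg_eq_0_iff)
        finally show "Ka * \<bar>L\<bar> * Pw (m - a) \<le> 1 / 2" .
      qed simp
      finally show ?thesis .
    qed
    then have "?A \<le> 0" by simp
    then show ?thesis
      using m(2)[of s] s b by simp
  qed
  have "y s = z s" if "s \<in> {0..T}" "s \<le> real n * d" for n s
    using that
  proof (induction n arbitrary: s)
    case 0
    then have "s = 0" by simp
    then show ?case
      using mild_initial[OF y] mild_initial[OF z] t by simp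
  next
    case (Suc n)
    show ?case
      by (rule step[of "real n * d"]) (use Suc d in \<open>auto simp: algebra_simps\<close>)
  qed
  moreover obtain n where "t \<le> real n * d"
    using reals_Archimedean3[OF d(1)] by (metis less_imp_le)
  ultimately show ?thesis
    using t by blast
qed

end

section \<open>Regularity of mild solutions\<close>

context matrix_generator
begin

text \<open>One factor \<open>S h\<close> supplies the smoothing, and the remaining difference is
  small in operator norm and commutes with Y. The constant 16 is 4 from 2 / l <= 4 times 4 from 4
  powr \<alpha> <= 4.\<close>

lemma bnd_S_dilate:
  assumes r: "0 < r" and l: "1 / 2 \<le> l" "l \<le> 1"
  shows "bnd (app (S r) x - app (S (l * r)) x) (16 * Kb * K1 * Ka * (1 - l) * norm x * r powr - \<alpha>)"
proof -
  \<comment> \<open>Since h + h = l r and (r - h) - h = (1 - l) r, the difference of S r and S (l r)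
    is (S (r - h) - S h) S h.\<close>
  define h where "h = l * r / 2"
  have l0: "0 < l" using l by linarith
  have "l * r \<le> 1 * r" using l r by (intro mult_right_mono) auto
  then have h: "0 < h" "h \<le> r - h" "r / 4 \<le> h"
    using r l mult_right_mono[of "1 / 2" l r] l0 by (auto simp: h_def)
  have "norm (S (r - h) - S h) \<le> K1 * ((r - h) - h) / h"
    using h by (intro norm_S_minus_S) auto
  also have "\<dots> = K1 * (1 - l) * (2 / l)"
    using r l0 by (simp add: h_def field_simps)
  also have "\<dots> \<le> K1 * (1 - l) * 4"
    using l l0 K1_pos by (intro mult_left_mono) (auto simp: field_simps)
  finally have n: "norm (S (r - h) - S h) \<le> 4 * K1 * (1 - l)" by simp
  have "h powr - \<alpha> \<le> (r / 4) powr - \<alpha>"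
    using h r al by (intro powr_mono2') auto
  also have "\<dots> = 4 powr \<alpha> * r powr - \<alpha>"
    using r by (simp add: powr_divide powr_minus field_simps)
  also have "\<dots> \<le> 4 powr 1 * r powr - \<alpha>"
    using al by (intro mult_right_mono powr_mono) auto
  finally have "Ka * h powr - \<alpha> * norm x \<le> Ka * (4 * r powr - \<alpha>) * norm x"
    using Ka_pos by (intro mult_right_mono mult_left_mono) auto
  then have "bnd (app (S h) x) (Ka * (4 * r powr - \<alpha>) * norm x)"
    using bnd_S[OF h(1)] bnd_mono by blast
  then have "bnd (app (S (r - h) - S h) (app (S h) x)) (Kb * (4 * K1 * (1 - l)) * (Ka * (4 * r powr - \<alpha>) * norm x))"
    using h by (intro bnd_commuting n S_commuting) auto
  moreover have "app (S (r - h) - S h) (app (S h) x) = app (S r) x - app (S (l * r)) x"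
  proof -
    have "app (S (r - h)) (app (S h) x) = app (S r) x"
      using S_add[of "r - h" h x] h by simp
    moreover have "app (S h) (app (S h) x) = app (S (l * r)) x"
      using S_add[of h h x] h by (simp add: h_def)
    ultimately show ?thesis by (simp add: app.diff_left)
  qed
  ultimately show ?thesis
    by (simp add: mult_ac)
qed

lemma conv_stretch:
  assumes G: "continuous_on {0..T} G" and t: "0 \<le> t" "l * t \<le> T" and l: "0 < l"
  shows "conv G (l * t) = l *\<^sub>R integral {0..t} (\<lambda>r. app (S (l * r)) (G (l * (t - r))))"
proof -
  have "((\<lambda>r. app (S r) (G (l * t - r))) has_integral conv G (l * t)) {0..l * t}"
    unfolding conv_def
    by (intro integrable_integral integrable_continuous_real continuous_conv_integrand[OF G]) (use t l in auto)
  from has_integral_stretch_real[OF this, of l]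
  have "((\<lambda>r. app (S (l * r)) (G (l * t - l * r))) has_integral (1 / l) *\<^sub>R conv G (l * t)) {0..t}"
    using l t by (simp add: image_divide_atLeastAtMost)
  from integral_unique[OF this] show ?thesis
    using l by (simp add: right_diff_distrib)
qed

text \<open>Comparing \<open>y\<close> with its time dilations \<open>t \<mapsto> y (l * t)\<close> yields Lipschitz continuity away from
  \<open>t = 0\<close> without a singular Gronwall inequality: the dilated equation is a perturbation of size \<open>1 - l\<close>.\<close>

lemma mild_dilation:
  assumes y: "mild F y0 T y" and T: "0 < T" and lip: "lip_on r F L" and L: "0 \<le> L"
    and r: "\<And>t. t \<in> {0..T} \<Longrightarrow> norm (y t) \<le> r" and small: "Ka * L * Pw T \<le> 1 / 2"
  shows "\<exists>Q\<ge>0. \<forall>t\<in>{0..T}. \<forall>l\<in>{1/2..1}. norm (y t - y (l * t)) \<le> Q * (1 - l)"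
proof -
  define G where "G s = F (y s)" for s
  have cy: "continuous_on {0..T} y" using y by (simp add: mild_def)
  have G: "continuous_on {0..T} G"
    unfolding G_def by (rule lip_on_continuous[OF lip cy r])
  have "bounded (G ` {0..T})"
    by (rule compact_imp_bounded[OF compact_continuous_image[OF G]]) simp
  then obtain M where M: "0 < M" "\<And>s. s \<in> {0..T} \<Longrightarrow> norm (G s) \<le> M"
    by (auto simp: bounded_pos)
  \<comment> \<open>The three summands come from the initial term, from I2 and from I3 below; the
    factor 2 appears after absorbing the contribution of I1 into the left side.\<close>
  define Q where "Q = 2 * (2 * Kb * K1 * norm y0 + Ka * M * Pw T + 16 * Kb * K1 * Ka * M * Pw T)"
  have Q: "0 \<le> Q"
    using Ka_pos Kb_pos K1_pos M Pw_nonneg by (simp add: Q_def)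
  have "norm (y t - y (l * t)) \<le> Q * (1 - l)" if l: "l \<in> {1/2..1}" and t: "t \<in> {0..T}" for l t
  proof -
    have l': "1 / 2 \<le> l" "l \<le> 1" "0 < l" using l by auto
    have lT: "l * s \<in> {0..T}" if "s \<in> {0..T}" for s
      using mult_right_mono[OF l'(2), of s] that l' by auto
    have cyl: "continuous_on {0..T} (\<lambda>s. y (l * s))"
      using lT by (intro continuous_on_compose2[OF cy] continuous_intros) auto
    then have "continuous_on {0..T} (\<lambda>s. norm (y s - y (l * s)))"
      by (intro continuous_intros cy)
    \<comment> \<open>At a maximum point all differences of the nonlinearity are bounded by
      \<open>L * \<delta>\<close>, so the estimate closes on itself.\<close>
    then obtain m where m: "m \<in> {0..T}" "\<And>s. s \<in> {0..T} \<Longrightarrow> norm (y s - y (l * s)) \<le> norm (y m - y (l * m))"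
      using continuous_attains_sup[of "{0..T}" "\<lambda>s. norm (y s - y (l * s))"] T by auto
    define \<delta> where "\<delta> = norm (y m - y (l * m))"
    have "\<delta> \<le> Q / 2 * (1 - l) + \<delta> / 2"
    proof (cases "m = 0")
      case True
      then show ?thesis using Q l' by (simp add: \<delta>_def)
    next
      case False
      then have m0: "0 < m" "m \<le> T" "0 \<le> m" "l * m \<le> m" using m l' by (auto simp: mult_left_le_one_le)
      have lmr: "l * (m - r) \<in> {0..T}" if "r \<in> {0..m}" for r
        using lT[of "m - r"] that m by auto
      have cGl: "continuous_on {0..m} (\<lambda>r. G (l * (m - r)))"
        using lmr by (intro continuous_on_compose2[OF G] continuous_intros) auto
      have cGm: "continuous_on {0..m} (\<lambda>r. G (m - r))"
        using m0 by (intro continuous_reverse[OF G]) auto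
      have GL: "norm (G s - G (l * s)) \<le> L * \<delta>" if "s \<in> {0..T}" for s
      proof -
        have "norm (G s - G (l * s)) \<le> L * norm (y s - y (l * s))"
          using lip r[OF that] r[OF lT[OF that]] by (simp add: lip_on_def G_def)
        also have "\<dots> \<le> L * \<delta>"
          unfolding \<delta>_def using m(2)[OF that] L by (intro mult_left_mono)
        finally show ?thesis .
      qed
      \<comment> \<open>conv G m - conv G (l m) = I1 + (1 - l) I2 + l I3: I1 carries the dilation of
        G, I2 the factor l from the change of variables, I3 the dilation of the semigroup.\<close>
      define I1 where "I1 = integral {0..m} (\<lambda>r. app (S r) (G (m - r) - G (l * (m - r))))"
      define I2 where "I2 = integral {0..m} (\<lambda>r. app (S r) (G (l * (m - r))))"
      define I3 where "I3 = integral {0..m} (\<lambda>r. app (S r) (G (l * (m - r))) - app (S (l * r)) (G (l * (m - r))))"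
      have c1: "continuous_on {0..m} (\<lambda>r. app (S r) (G (l * (m - r))))"
        by (intro continuous_on_S continuous_on_id cGl) auto
      have c2: "continuous_on {0..m} (\<lambda>r. app (S (l * r)) (G (l * (m - r))))"
        using l' by (intro continuous_on_S cGl continuous_intros) auto
      have c3: "continuous_on {0..m} (\<lambda>r. app (S r) (G (m - r)))"
        using m0 by (intro continuous_conv_integrand[OF G]) auto
      have e1: "I1 = conv G m - I2"
        unfolding I1_def I2_def conv_def app.diff_right
        by (intro integral_diff integrable_continuous_real c1 c3)
      have e3: "l *\<^sub>R I3 = l *\<^sub>R I2 - conv G (l * m)"
        unfolding I3_def I2_def using m0(2,3,4) l'(3)
        by (subst conv_stretch[OF G, OF m0(3) order_trans[OF m0(4,2)]]) (auto simp: integral_diff[OF integrable_continuous_real[OF c1] integrable_continuous_real[OF c2]]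
            scaleR_diff_right)
      have eq: "conv G m - conv G (l * m) = I1 + (1 - l) *\<^sub>R I2 + l *\<^sub>R I3"
        unfolding e1 e3 by (simp add: scaleR_diff_left)
      have "bnd I1 (Ka * (L * \<delta>) * (Pw m - Pw 0))"
        unfolding I1_def using m0 GL by (intro bnd_S_integral continuous_on_diff cGl cGm) auto
      moreover have "bnd I2 (Ka * M * (Pw m - Pw 0))"
        unfolding I2_def using m0 M lmr by (intro bnd_S_integral cGl) auto
      moreover have "bnd I3 (16 * Kb * K1 * Ka * (1 - l) * M * (Pw m - Pw 0))"
        unfolding I3_def
      proof (rule bnd_singular_integral)
        fix r assume r: "0 < r" "r < m"
        have "norm (G (l * (m - r))) \<le> M"
          using r by (intro M lmr) auto
        then have "16 * Kb * K1 * Ka * (1 - l) * norm (G (l * (m - r))) * r powr - \<alpha> \<le> 16 * Kb * K1 * Ka * (1 - l) * M * r powr - \<alpha>"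
          using Ka_pos Kb_pos K1_pos l' by (intro mult_right_mono mult_left_mono) auto
        then show "bnd (app (S r) (G (l * (m - r))) - app (S (l * r)) (G (l * (m - r)))) (16 * Kb * K1 * Ka * (1 - l) * M * r powr - \<alpha>)"
          by (rule bnd_mono[OF bnd_S_dilate[OF r(1) l'(1,2)]])
      qed (use m0 in \<open>auto intro!: continuous_on_diff c1 c2\<close>)
      ultimately have "bnd (conv G m - conv G (l * m))
          (Ka * (L * \<delta>) * Pw m + \<bar>1 - l\<bar> * (Ka * M * Pw m) + \<bar>l\<bar> * (16 * Kb * K1 * Ka * (1 - l) * M * Pw m))"
        unfolding eq by (intro bnd_add bnd_scaleR) simp_all
      moreover have "bnd (app (S m) (app J y0) - app (S (l * m)) (app J y0)) (Kb * (2 * K1 * (1 - l)) * norm y0)"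
      proof (rule bnd_SJ_diff)
        have "norm (S m - S (l * m)) \<le> K1 * (m - l * m) / (l * m)"
          using m0 l' by (intro norm_S_minus_S) auto
        also have "\<dots> = K1 * (1 - l) * (1 / l)"
          using m0 l' by (simp add: field_simps)
        also have "\<dots> \<le> K1 * (1 - l) * 2"
          using l' K1_pos by (intro mult_left_mono) (auto simp: field_simps)
        finally show "norm (S m - S (l * m)) \<le> 2 * K1 * (1 - l)" by simp
      qed (use m0 l' in auto)
      moreover have "app J (y m - y (l * m)) = (app (S m) (app J y0) - app (S (l * m)) (app J y0)) + (conv G m - conv G (l * m))"
        using y m(1) lT[OF m(1)] by (simp add: mild_def app.diff_right G_def[abs_def])
      ultimately have "bnd (app J (y m - y (l * m))) (Kb * (2 * K1 * (1 - l)) * norm y0 +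
          (Ka * (L * \<delta>) * Pw m + \<bar>1 - l\<bar> * (Ka * M * Pw m) + \<bar>l\<bar> * (16 * Kb * K1 * Ka * (1 - l) * M * Pw m)))"
        by (simp only: bnd_add)
      then have "\<delta> \<le> Kb * (2 * K1 * (1 - l)) * norm y0 +
          (Ka * (L * \<delta>) * Pw m + \<bar>1 - l\<bar> * (Ka * M * Pw m) + \<bar>l\<bar> * (16 * Kb * K1 * Ka * (1 - l) * M * Pw m))"
        by (simp only: bnd_J_iff \<delta>_def)
      also have "\<dots> \<le> Kb * (2 * K1 * (1 - l)) * norm y0 +
          (\<delta> / 2 + (1 - l) * (Ka * M * Pw T) + 1 * (16 * Kb * K1 * Ka * (1 - l) * M * Pw T))"
      proof (intro add_left_mono add_mono)
        have "Ka * (L * \<delta>) * Pw m \<le> Ka * (L * \<delta>) * Pw T"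
          using Ka_pos L m0 by (intro mult_left_mono Pw_mono) (auto simp: \<delta>_def)
        also have "\<dots> = Ka * L * Pw T * \<delta>" by simp
        also have "\<dots> \<le> 1 / 2 * \<delta>"
          using small by (intro mult_right_mono) (auto simp: \<delta>_def)
        finally show "Ka * (L * \<delta>) * Pw m \<le> \<delta> / 2" by simp
        show "\<bar>1 - l\<bar> * (Ka * M * Pw m) \<le> (1 - l) * (Ka * M * Pw T)"
          using l' Ka_pos M m0 by (simp, intro mult_left_mono Pw_mono) auto
        show "\<bar>l\<bar> * (16 * Kb * K1 * Ka * (1 - l) * M * Pw m) \<le> 1 * (16 * Kb * K1 * Ka * (1 - l) * M * Pw T)"
          using l' Ka_pos Kb_pos K1_pos M m0 by (intro mult_mono mult_left_mono Pw_mono) (auto simp: Pw_nonneg)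
      qed
      also have "\<dots> = Q / 2 * (1 - l) + \<delta> / 2"
      proof -
        have "Q / 2 = 2 * Kb * K1 * norm y0 + Ka * M * Pw T + 16 * Kb * K1 * Ka * M * Pw T"
          by (simp add: Q_def)
        then show ?thesis by (simp only:) (simp add: algebra_simps)
      qed
      finally show ?thesis .
    qed
    then have "\<delta> \<le> Q * (1 - l)" by simp
    then show ?thesis
      using m(2)[OF t] by (simp add: \<delta>_def)
  qed
  then show ?thesis
    using Q by blast
qed

text \<open>Applying Y under the integral produces a singularity 1/r. Replacing G (t - r) by its
  difference to G t removes it by the Lipschitz bound, and the subtracted constant integrates
  explicitly through the semigroup. The cut-off versions converge uniformly, and Y is
  closed.\<close>

lemma conv_smooth:
  assumes G: "continuous_on {0..T} G" and a: "0 < a"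
    and lip: "\<And>s t. a / 2 \<le> s \<Longrightarrow> s \<le> t \<Longrightarrow> t \<le> T \<Longrightarrow> t / 2 \<le> s \<Longrightarrow> norm (G t - G s) \<le> Q * (t - s)" and Q: "0 \<le> Q"
  shows "(\<forall>t\<in>{a..T}. conv G t \<in> D) \<and> continuous_on {a..T} (\<lambda>t. Y (conv G t))"
proof -
  \<comment> \<open>Y of the part of the Duhamel integral with elapsed time at least e, plus the
    correction \<open>app (S e) (G t)\<close> that makes it converge as e tends to 0; the limit is Y
    (conv G t) + G t.\<close>
  define u where "u e t = Y (app (S e) (conv G (t - e))) + app (S e) (G t)" for e t
  have key: "norm (u f t - u e t) \<le> K1 * Q * (e - f)"
    if ef: "0 < f" "f \<le> e" "e \<le> a / 2" and t: "t \<in> {a..T}" for e f t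
  proof -
    let ?g = "\<lambda>r. G (t - f - r)"
    have bl: "bounded_linear (\<lambda>x. Y (app (S f) x))"
      by (rule bounded_linear_YS[OF ef(1)])
    have gc: "continuous_on {0..e - f} (\<lambda>r. app (S r) (?g r))"
      using ef t by (intro continuous_conv_integrand[OF G]) auto
    have Gc: "continuous_on {0..e - f} (\<lambda>r. app (S r) (G t))"
      by (intro continuous_on_S continuous_on_const continuous_on_id) auto
    have "conv G (t - f) = integral {0..e - f} (\<lambda>r. app (S r) (?g r)) + app (S (e - f)) (conv G (t - e))"
      using conv_split[OF G, of "e - f" "t - f"] ef t by simp
    then have "Y (app (S f) (conv G (t - f))) = Y (app (S f) (integral {0..e - f} (\<lambda>r. app (S r) (?g r))))
        + Y (app (S f) (app (S (e - f)) (conv G (t - e))))"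
      using linear_add[OF bounded_linear.linear[OF bl]] by simp
    also have "app (S f) (app (S (e - f)) (conv G (t - e))) = app (S e) (conv G (t - e))"
      using S_add[of f "e - f" "conv G (t - e)"] ef by simp
    also have "Y (app (S f) (integral {0..e - f} (\<lambda>r. app (S r) (?g r))))
        = integral {0..e - f} (\<lambda>r. Y (app (S f) (app (S r) (?g r))))"
      using integral_linear[OF integrable_continuous_real[OF gc] bl] by (simp add: o_def)
    finally have 1: "Y (app (S f) (conv G (t - f))) = integral {0..e - f} (\<lambda>r. Y (app (S f) (app (S r) (?g r))))
        + Y (app (S e) (conv G (t - e)))" .
    have "app (S e) (G t) - app (S f) (G t) = app (S (e - f)) (app (S f) (G t)) - app (S f) (G t)"
      using S_add[of "e - f" f "G t"] ef by simp
    also have "\<dots> = integral {0..e - f} (\<lambda>r. app (S r) (Y (app (S f) (G t))))"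
      using integral_unique[OF S_has_integral[of "e - f" "app (S f) (G t)"]] ef S_smooth[OF ef(1)] by simp
    also have "\<dots> = integral {0..e - f} (\<lambda>r. Y (app (S f) (app (S r) (G t))))"
    proof (rule integral_cong)
      fix r assume r: "r \<in> {0..e - f}"
      show "app (S r) (Y (app (S f) (G t))) = Y (app (S f) (app (S r) (G t)))"
        using YS_add[of r f "G t"] S_add[of f r "G t"] r ef by (simp add: add.commute)
    qed
    finally have 2: "app (S e) (G t) - app (S f) (G t) = integral {0..e - f} (\<lambda>r. Y (app (S f) (app (S r) (G t))))" .
    have i1: "(\<lambda>r. Y (app (S f) (app (S r) (?g r)))) integrable_on {0..e - f}"
      and i2: "(\<lambda>r. Y (app (S f) (app (S r) (G t)))) integrable_on {0..e - f}"
      using integrable_linear[OF integrable_continuous_real[OF gc] bl] integrable_linear[OF integrable_continuous_real[OF Gc] bl]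
      by (simp_all add: o_def)
    have "u f t - u e t = (Y (app (S f) (conv G (t - f))) - Y (app (S e) (conv G (t - e)))) - (app (S e) (G t) - app (S f) (G t))"
      by (simp add: u_def)
    also have "\<dots> = integral {0..e - f} (\<lambda>r. Y (app (S f) (app (S r) (?g r))) - Y (app (S f) (app (S r) (G t))))"
      unfolding 1 2 integral_diff[OF i1 i2] by simp
    finally have "norm (u f t - u e t) \<le> integral {0..e - f} (\<lambda>r. K1 * Q)"
    proof (rule ssubst[where P = "\<lambda>z. norm z \<le> integral {0..e - f} (\<lambda>r. K1 * Q)"])
      show "norm (integral {0..e - f} (\<lambda>r. Y (app (S f) (app (S r) (?g r))) - Y (app (S f) (app (S r) (G t)))))
        \<le> integral {0..e - f} (\<lambda>r. K1 * Q)"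
    proof (rule integral_norm_bound_integral[OF integrable_diff[OF i1 i2]])
      fix r assume r: "r \<in> {0..e - f}"
      have "Y (app (S f) (app (S r) (?g r))) - Y (app (S f) (app (S r) (G t))) = Y (app (S (f + r)) (?g r - G t))"
        using linear_diff[OF bounded_linear.linear[OF bl], of "app (S r) (?g r)" "app (S r) (G t)"] ef r
        by (simp add: S_add app.diff_right)
      also have "norm \<dots> \<le> K1 / (f + r) * norm (?g r - G t)"
        using ef r by (intro norm_YS) auto
      \<comment> \<open>Here the Lipschitz modulus over the elapsed time f + r cancels the
        singularity of the analytic semigroup.\<close>
      also have "\<dots> \<le> K1 / (f + r) * (Q * (f + r))"
      proof (rule mult_left_mono)
        have "norm (G t - ?g r) \<le> Q * (t - (t - f - r))"
          using ef r t by (intro lip) auto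
        then show "norm (?g r - G t) \<le> Q * (f + r)"
          by (simp add: norm_minus_commute)
      qed (use ef r K1_pos in auto)
      also have "\<dots> = K1 * Q"
        using ef r by simp
      finally show "norm (Y (app (S f) (app (S r) (?g r))) - Y (app (S f) (app (S r) (G t)))) \<le> K1 * Q" .
    qed auto
    qed
    also have "\<dots> = K1 * Q * (e - f)"
      using ef(2) by (subst integral_const_real) (simp add: mult.commute)
    finally show ?thesis .
  qed
  \<comment> \<open>Cut-offs of at most a/2 keep every compared time above t/2, hence above a/2, as
    the Lipschitz hypothesis requires.\<close>
  define e where "e n = a / 2 / real (Suc n)" for n
  have e: "0 < e n" "e n \<le> a / 2" for n
    using a by (auto simp: e_def field_simps)
  have e_mono: "e n \<le> e m" if "m \<le> n" for m n
    unfolding e_def using a that by (intro divide_left_mono) auto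
  have "(\<lambda>n. a / 2 * inverse (real (Suc n))) \<longlonglongrightarrow> a / 2 * 0"
    by (intro tendsto_mult tendsto_const LIMSEQ_inverse_real_of_nat)
  then have "e \<longlonglongrightarrow> 0"
    by (simp only: e_def[abs_def] divide_inverse mult_zero_right)
  have uc: "continuous_on {a..T} (u (e n))" for n
  proof -
    have "continuous_on {a..T} (\<lambda>t. conv G (t - e n))"
      using e[of n] a by (intro continuous_on_compose2[OF continuous_conv'[OF G]] continuous_intros) auto
    from bounded_linear.continuous_on[OF bounded_linear_YS[OF e(1)] this]
    have "continuous_on {a..T} (\<lambda>t. Y (app (S (e n)) (conv G (t - e n))))" .
    moreover have "continuous_on {a..T} (\<lambda>t. app (S (e n)) (G t))"
      using a by (intro app.continuous_on continuous_on_const continuous_on_subset[OF G]) auto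
    ultimately show ?thesis
      unfolding u_def by (rule continuous_on_add)
  qed
  have "uniformly_Cauchy_on {a..T} (\<lambda>n. u (e n))"
  proof (rule uniformly_Cauchy_onI)
    fix f :: real assume f: "f > 0"
    have "(\<lambda>n. K1 * Q * e n) \<longlonglongrightarrow> K1 * Q * 0"
      by (intro tendsto_intros \<open>e \<longlonglongrightarrow> 0\<close>)
    then have "\<forall>\<^sub>F n in sequentially. K1 * Q * e n < f"
      using f by (intro order_tendstoD) auto
    then obtain N where N: "K1 * Q * e N < f"
      by (auto simp: eventually_sequentially)
    have le: "norm (u (e n) t - u (e m) t) < f" if "m \<ge> N" "n \<ge> m" "t \<in> {a..T}" for m n t
    proof -
      have "norm (u (e n) t - u (e m) t) \<le> K1 * Q * (e m - e n)"
        using that e e_mono by (intro key) auto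
      also have "\<dots> \<le> K1 * Q * e N"
        using K1_pos Q e(1)[of n] e_mono[OF that(1)] by (intro mult_left_mono) auto
      finally show ?thesis using N by linarith
    qed
    have "dist (u (e m) t) (u (e n) t) < f" if "m \<ge> N" "n \<ge> N" "t \<in> {a..T}" for m n t
      using le[of m n t] le[of n m t] that by (cases "m \<le> n") (auto simp: dist_norm norm_minus_commute)
    then show "\<exists>M. \<forall>t\<in>{a..T}. \<forall>m\<ge>M. \<forall>n\<ge>M. dist (u (e m) t) (u (e n) t) < f"
      by blast
  qed
  then obtain w where w: "uniform_limit {a..T} (\<lambda>n. u (e n)) w sequentially"
    using Cauchy_uniformly_convergent unfolding uniformly_convergent_on_def by blast
  then have wc: "continuous_on {a..T} w"
    by (intro uniform_limit_theorem[OF _ w]) (auto simp: uc)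
  have *: "conv G t \<in> D \<and> Y (conv G t) = w t - G t" if t: "t \<in> {a..T}" for t
  proof (rule Y_closed)
    have "continuous_on {0..a / 2} (\<lambda>e. app (S e) (conv G (t - e)))"
      using t by (intro continuous_on_S continuous_on_id continuous_on_compose2[OF continuous_conv'[OF G]] continuous_intros) auto
    then have "((\<lambda>e. app (S e) (conv G (t - e))) \<longlongrightarrow> app (S 0) (conv G (t - 0))) (at 0 within {0..a / 2})"
      unfolding continuous_on_def by (rule bspec) (use a in simp)
    moreover have "filterlim e (at 0 within {0..a / 2}) sequentially"
      unfolding filterlim_at using \<open>e \<longlonglongrightarrow> 0\<close> e less_imp_neq[OF e(1), symmetric]
      by (intro conjI always_eventually allI) (simp_all add: less_imp_le)
    ultimately have "(\<lambda>n. app (S (e n)) (conv G (t - e n))) \<longlonglongrightarrow> app (S 0) (conv G (t - 0))"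
      by (rule filterlim_compose)
    then show "(\<lambda>n. app (S (e n)) (conv G (t - e n))) \<longlonglongrightarrow> conv G t"
      by simp
    show "app (S (e n)) (conv G (t - e n)) \<in> D" for n
      using S_smooth e by blast
    have "(\<lambda>n. u (e n) t) \<longlonglongrightarrow> w t"
      using tendsto_uniform_limitI[OF w t] .
    moreover have "(\<lambda>n. app (S (e n)) (G t)) \<longlonglongrightarrow> app (S 0) (G t)"
      using continuous_on_tendsto_compose[OF continuous_S0 \<open>e \<longlonglongrightarrow> 0\<close>] e by (simp add: less_imp_le)
    ultimately have "(\<lambda>n. u (e n) t - app (S (e n)) (G t)) \<longlonglongrightarrow> w t - app (S 0) (G t)"
      by (rule tendsto_diff)
    then show "(\<lambda>n. Y (app (S (e n)) (conv G (t - e n)))) \<longlonglongrightarrow> w t - G t"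
      by (simp add: u_def)
  qed
  have "continuous_on {a..T} (\<lambda>t. w t - G t)"
    using a by (intro continuous_on_diff wc continuous_on_subset[OF G]) auto
  then have "continuous_on {a..T} (\<lambda>t. Y (conv G t))"
    by (rule continuous_on_eq) (simp add: *)
  then show ?thesis
    using * by blast
qed

section \<open>From mild to classical solutions and back\<close>

lemma continuous_on_half_open:
  fixes f :: "real \<Rightarrow> 'b::topological_space"
  assumes "\<And>a. 0 < a \<Longrightarrow> continuous_on {a..T} f"
  shows "continuous_on {0<..T} f"
  unfolding continuous_on_def
proof
  fix t assume t: "t \<in> {0<..T}"
  have "at t within {0<..T} = at t within {t / 2..T}"
    by (rule at_within_nhd[of _ "{t / 2<..}"]) (use t in auto)
  then show "(f \<longlongrightarrow> f t) (at t within {0<..T})"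
    using assms[of "t / 2"] t by (auto simp: continuous_on_def)
qed

text \<open>The formula can be restarted at any p > 0, where x p already lies in D. Near t the
  integrand of the restarted formula is uniformly close to Y (x t) + G t.\<close>

lemma variation_of_constants_smooth:
  assumes G: "continuous_on {0..T} G"
    and smooth: "\<And>a. 0 < a \<Longrightarrow> (\<forall>t\<in>{a..T}. conv G t \<in> D) \<and> continuous_on {a..T} (\<lambda>t. Y (conv G t))"
    and x: "\<And>t. t \<in> {0..T} \<Longrightarrow> x t = app (S t) x0 + conv G t"
  shows "\<And>t. t \<in> {0<..T} \<Longrightarrow> x t \<in> D"
    and "continuous_on {0<..T} (\<lambda>t. Y (x t))"
    and "\<And>t. t \<in> {0<..<T} \<Longrightarrow> (x has_vector_derivative (Y (x t) + G t)) (at t)"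
proof -
  have cD: "conv G t \<in> D" if "t \<in> {0<..T}" for t
    using smooth[of t] that by auto
  show xD: "x t \<in> D" if "t \<in> {0<..T}" for t
    using D_Y_add[OF S_smooth[of t x0] cD[OF that]] that x[of t] by auto
  have Yx: "Y (x t) = Y (app (S t) x0) + Y (conv G t)" if "t \<in> {0<..T}" for t
    using D_Y_add[OF S_smooth[of t x0] cD[OF that]] that x[of t] by auto
  have cY: "continuous_on {0<..T} (\<lambda>t. Y (x t))"
  proof (rule continuous_on_half_open)
    fix a :: real assume a: "0 < a"
    have "continuous_on {a..T} (\<lambda>t. app (S (t - a)) (Y (app (S a) x0)))"
      by (intro continuous_on_S continuous_intros) auto
    then have "continuous_on {a..T} (\<lambda>t. Y (app (S t) x0))"
    proof (rule continuous_on_eq)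
      fix t assume "t \<in> {a..T}"
      then show "app (S (t - a)) (Y (app (S a) x0)) = Y (app (S t) x0)"
        using YS_add[of "t - a" a x0] a by simp
    qed
    from continuous_on_add[OF this conjunct2[OF smooth[OF a]]]
    show "continuous_on {a..T} (\<lambda>t. Y (x t))"
      by (rule continuous_on_eq) (use a Yx in auto)
  qed
  then show "continuous_on {0<..T} (\<lambda>t. Y (x t))" .
  fix t assume t: "t \<in> {0<..<T}"
  define H where "H = Y (x t) + G t"
  have near: "\<exists>d>0. \<forall>s. s \<in> {0<..<T} \<and> \<bar>s - t\<bar> < d \<longrightarrow> norm (f s - f t) < e"
    if "continuous_on {0<..T} f" "e > 0" for f :: "real \<Rightarrow> ell1" and e
    using that t unfolding continuous_on_iff dist_norm real_norm_def by (metis greaterThanAtMost_iff greaterThanLessThan_iff less_imp_le)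
  \<comment> \<open>Increments between arbitrary p <= q near t: p = t gives the right derivative and
    q = t the left one, although the semigroup only runs forward.\<close>
  have key: "\<exists>d>0. \<forall>p q. t - d < p \<and> p \<le> q \<and> q < t + d \<longrightarrow> norm (x q - x p - (q - p) *\<^sub>R H) \<le> e * (q - p)"
    if e: "e > 0" for e
  proof -
    obtain d1 where d1: "d1 > 0" "\<And>s. s \<in> {0<..<T} \<Longrightarrow> \<bar>s - t\<bar> < d1 \<Longrightarrow> norm (Y (x s) - Y (x t)) < e / 3"
      using near[OF cY, of "e / 3"] e by auto
    have "continuous_on {0<..T} G"
      by (rule continuous_on_subset[OF G]) auto
    from near[OF this, of "e / 3"] e
    obtain d2 where d2: "d2 > 0" "\<And>s. s \<in> {0<..<T} \<Longrightarrow> \<bar>s - t\<bar> < d2 \<Longrightarrow> norm (G s - G t) < e / 3"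
      by auto
    obtain d3 where d3: "d3 > 0" "\<forall>r\<in>{0..}. dist r 0 < d3 \<longrightarrow> dist (app (S r) H) (app (S 0) H) < e / 3"
      using continuous_S0[of H, unfolded continuous_on_iff, rule_format, of 0 "e / 3"] e by auto
    define d where "d = min (min d1 d2) (min (d3 / 2) (min t (T - t)))"
    have d: "d > 0" "d \<le> d1" "d \<le> d2" "d \<le> d3 / 2" "d \<le> t" "d \<le> T - t"
      using d1(1) d2(1) d3(1) t unfolding d_def greaterThanLessThan_iff by linarith+
    have "norm (x q - x p - (q - p) *\<^sub>R H) \<le> e * (q - p)" if pq: "t - d < p" "p \<le> q" "q < t + d" for p q
    proof -
      let ?h = "q - p"
      have r: "0 < p" "q < T" "0 \<le> ?h" "?h < d3"
        using pq d by auto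
      have xp: "x p \<in> D" using r pq by (intro xD) auto
      have iG: "(\<lambda>r. app (S r) (G (q - r))) integrable_on {0..?h}"
        using r pq by (intro integrable_continuous_real continuous_conv_integrand[OF G]) auto
      have "x q = app (S ?h) (x p) + integral {0..?h} (\<lambda>r. app (S r) (G (q - r)))"
        using x[of q] x[of p] r pq conv_split[OF G, of ?h q] S_add[of ?h p x0]
        by (simp add: app.add_right)
      also have "app (S ?h) (x p) = x p + integral {0..?h} (\<lambda>r. app (S r) (Y (x p)))"
        using integral_unique[OF S_has_integral[OF r(3) xp]] by simp
      finally have "x q - x p = integral {0..?h} (\<lambda>r. app (S r) (Y (x p))) + integral {0..?h} (\<lambda>r. app (S r) (G (q - r)))"
        by simp
      also have "\<dots> = integral {0..?h} (\<lambda>r. app (S r) (Y (x p) + G (q - r)))"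
        unfolding app.add_right
        by (rule integral_add[symmetric]) (use iG S_has_integral[OF r(3) xp] in \<open>auto simp: integrable_on_def\<close>)
      also have "\<dots> - ?h *\<^sub>R H = integral {0..?h} (\<lambda>r. app (S r) (Y (x p) + G (q - r)) - H)"
        using iG S_has_integral[OF r(3) xp] r unfolding app.add_right
        by (subst integral_diff) (auto intro!: integrable_add)
      finally have eq: "x q - x p - ?h *\<^sub>R H = integral {0..?h} (\<lambda>r. app (S r) (Y (x p) + G (q - r)) - H)" .
      have "norm (integral {0..?h} (\<lambda>r. app (S r) (Y (x p) + G (q - r)) - H)) \<le> integral {0..?h} (\<lambda>r. e)"
      proof (rule integral_norm_bound_integral)
        show "(\<lambda>r. app (S r) (Y (x p) + G (q - r)) - H) integrable_on {0..?h}"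
          using iG S_has_integral[OF r(3) xp] unfolding app.add_right by (auto intro!: integrable_add integrable_diff)
        fix s assume s: "s \<in> {0..?h}"
        have "app (S s) (Y (x p) + G (q - s)) - H = app (S s) ((Y (x p) - Y (x t)) + (G (q - s) - G t)) + (app (S s) H - H)"
          by (simp add: H_def app.add_right app.diff_right)
        also have "norm \<dots> \<le> norm ((Y (x p) - Y (x t)) + (G (q - s) - G t)) + norm (app (S s) H - H)"
          using s by (intro norm_triangle_le add_right_mono norm_app_S) auto
        also have "\<dots> \<le> e / 3 + e / 3 + e / 3"
        proof (intro add_mono norm_triangle_le)
          show "norm (Y (x p) - Y (x t)) \<le> e / 3"
          proof (rule less_imp_le[OF d1(2)])
            show "p \<in> {0<..<T}" using pq r by auto
            show "\<bar>p - t\<bar> < d1" using pq d by linarith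
          qed
          show "norm (G (q - s) - G t) \<le> e / 3"
          proof (rule less_imp_le[OF d2(2)])
            show "q - s \<in> {0<..<T}" using pq r s by auto
            show "\<bar>q - s - t\<bar> < d2" using pq d s unfolding atLeastAtMost_iff by linarith
          qed
          show "norm (app (S s) H - H) \<le> e / 3"
            using bspec[OF d3(2), of s] s r by (auto simp: dist_norm)
        qed
        finally show "norm (app (S s) (Y (x p) + G (q - s)) - H) \<le> e" by simp
      qed auto
      then show ?thesis
        unfolding eq using r by (simp add: mult.commute)
    qed
    then show ?thesis using d(1) by blast
  qed
  have "(x has_vector_derivative H) (at t)"
    unfolding has_vector_derivative_def has_derivative_at_alt
  proof (intro conjI allI impI)
    show "bounded_linear (\<lambda>r. r *\<^sub>R H)"
      by (rule bounded_linear_scaleR_left)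
    fix e :: real assume "0 < e"
    then obtain d where d: "d > 0" "\<And>p q. t - d < p \<Longrightarrow> p \<le> q \<Longrightarrow> q < t + d \<Longrightarrow> norm (x q - x p - (q - p) *\<^sub>R H) \<le> e * (q - p)"
      using key by blast
    have "norm (x s - x t - (s - t) *\<^sub>R H) \<le> e * norm (s - t)" if "norm (s - t) < d" for s
    proof (cases "s \<le> t")
      case True
      have "x s - x t - (s - t) *\<^sub>R H = - (x t - x s - (t - s) *\<^sub>R H)"
        by (simp add: algebra_simps)
      then show ?thesis
        using d(2)[of s t] that True d(1) by (simp only: norm_minus_cancel) (auto simp: abs_if split: if_splits)
    next
      case False
      then show ?thesis
        using d(2)[of t s] that d(1) by auto
    qed
    then show "\<exists>d>0. \<forall>s. norm (s - t) < d \<longrightarrow> norm (x s - x t - (s - t) *\<^sub>R H) \<le> e * norm (s - t)"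
      using d(1) by blast
  qed
  then show "(x has_vector_derivative (Y (x t) + G t)) (at t)"
    by (simp add: H_def)
qed

text \<open>Keeping \<open>app (S q)\<close> in front of the increment of w means that only
  contractivity and strong continuity are used; \<open>w r\<close> in D makes its orbit
  differentiable.\<close>

lemma S_product_rule:
  assumes r: "0 < r" and w: "(w has_vector_derivative w') (at r)" and wD: "w r \<in> D"
  shows "((\<lambda>r. app (S r) (w r)) has_vector_derivative (app (S r) (Y (w r)) + app (S r) w')) (at r)"
  unfolding has_vector_derivative_def has_derivative_at_alt
proof (intro conjI allI impI)
  let ?D = "app (S r) (Y (w r)) + app (S r) w'"
  show "bounded_linear (\<lambda>q. q *\<^sub>R ?D)"
    by (rule bounded_linear_scaleR_left)
  fix e :: real assume e: "0 < e"
  then have e3: "0 < e / 3" by simp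
  have "\<exists>d>0. \<forall>q. norm (q - r) < d \<longrightarrow> norm (w q - w r - (q - r) *\<^sub>R w') \<le> e / 3 * norm (q - r)"
    using w e3 unfolding has_vector_derivative_def has_derivative_at_alt by blast
  then obtain d1 where d1: "d1 > 0" "\<And>q. norm (q - r) < d1 \<Longrightarrow> norm (w q - w r - (q - r) *\<^sub>R w') \<le> e / 3 * norm (q - r)"
    by blast
  have "\<exists>d>0. \<forall>q. norm (q - r) < d \<longrightarrow> norm (app (S q) (w r) - app (S r) (w r) - (q - r) *\<^sub>R app (S r) (Y (w r))) \<le> e / 3 * norm (q - r)"
    using S_has_vector_derivative[OF r wD] e3 unfolding has_vector_derivative_def has_derivative_at_alt by blast
  then obtain d2 where d2: "d2 > 0" "\<And>q. norm (q - r) < d2 \<Longrightarrow>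
      norm (app (S q) (w r) - app (S r) (w r) - (q - r) *\<^sub>R app (S r) (Y (w r))) \<le> e / 3 * norm (q - r)"
    by blast
  obtain d3 where d3: "d3 > 0" "\<forall>q\<in>{0..}. dist q r < d3 \<longrightarrow> dist (app (S q) w') (app (S r) w') < e / 3"
    using continuous_S0[of w', unfolded continuous_on_iff, rule_format, of r "e / 3"] e r by auto
  have "norm (app (S q) (w q) - app (S r) (w r) - (q - r) *\<^sub>R ?D) \<le> e * norm (q - r)"
    if q: "norm (q - r) < min (min d1 d2) (min d3 r)" for q
  proof -
    have q0: "0 \<le> q" using q by auto
    define u1 where "u1 = app (S q) (w q - w r - (q - r) *\<^sub>R w')"
    define u2 where "u2 = (q - r) *\<^sub>R (app (S q) w' - app (S r) w')"
    define u3 where "u3 = app (S q) (w r) - app (S r) (w r) - (q - r) *\<^sub>R app (S r) (Y (w r))"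
    have eq: "app (S q) (w q) - app (S r) (w r) - (q - r) *\<^sub>R ?D = u1 + u2 + u3"
      by (simp add: u1_def u2_def u3_def app.diff_right app.scaleR_right scaleR_diff_right scaleR_add_right)
    have "norm u1 \<le> e / 3 * norm (q - r)"
      unfolding u1_def by (rule order_trans[OF norm_app_S[OF q0] d1(2)]) (use q in simp)
    moreover have "norm (app (S q) w' - app (S r) w') \<le> e / 3"
      using bspec[OF d3(2), of q] q q0 by (simp add: dist_norm)
    then have "norm u2 \<le> e / 3 * norm (q - r)"
      unfolding u2_def norm_scaleR real_norm_def mult.commute[of "\<bar>q - r\<bar>"] by (rule mult_right_mono) simp
    moreover have "norm u3 \<le> e / 3 * norm (q - r)"
      unfolding u3_def by (rule d2(2)) (use q in simp)
    ultimately have "norm (u1 + u2 + u3) \<le> e / 3 * norm (q - r) + e / 3 * norm (q - r) + e / 3 * norm (q - r)"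
      by (intro norm_triangle_le add_mono)
    then show ?thesis
      unfolding eq by simp
  qed
  then show "\<exists>d>0. \<forall>q. norm (q - r) < d \<longrightarrow> norm (app (S q) (w q) - app (S r) (w r) - (q - r) *\<^sub>R ?D) \<le> e * norm (q - r)"
    using d1 d2 d3 r by (intro exI[of _ "min (min d1 d2) (min d3 r)"]) auto
qed

text \<open>In the derivative of r |-> S r (x (t - r)) the terms with Y cancel. The equation holds
  only on the open interval, hence the interior form of the fundamental theorem.\<close>

lemma variation_of_constants:
  assumes x: "continuous_on {0..T} x" and xD: "\<And>t. t \<in> {0<..<T} \<Longrightarrow> x t \<in> D"
    and deriv: "\<And>t. t \<in> {0<..<T} \<Longrightarrow> (x has_vector_derivative (Y (x t) + G t)) (at t)"
    and t: "t \<in> {0..T}"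
  shows "x t = app (S t) (x 0) + conv G t"
proof -
  have "((\<lambda>r. - app (S r) (G (t - r))) has_integral (app (S t) (x (t - t)) - app (S 0) (x (t - 0)))) {0..t}"
  proof (rule fundamental_theorem_of_calculus_interior)
    show "continuous_on {0..t} (\<lambda>r. app (S r) (x (t - r)))"
      using t by (intro continuous_conv_integrand[OF x]) auto
    fix r assume r: "r \<in> {0<..<t}"
    have "((\<lambda>r. x (t - r)) has_vector_derivative (- 1) *\<^sub>R (Y (x (t - r)) + G (t - r))) (at r)"
      by (rule vector_diff_chain_at[of "\<lambda>r. t - r" _ _ x, unfolded o_def])
        (use r t in \<open>auto intro!: derivative_eq_intros deriv\<close>)
    from S_product_rule[OF _ this] r t xD[of "t - r"]
    show "((\<lambda>r. app (S r) (x (t - r))) has_vector_derivative - app (S r) (G (t - r))) (at r)"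
      by (simp add: app.minus_right app.add_right app.diff_right)
  qed (use t in auto)
  from has_integral_neg[OF this] have "conv G t = - (app (S t) (x 0) - x t)"
    unfolding conv_def by (intro integral_unique) simp
  then show ?thesis by simp
qed

end

context matrix_generator
begin

text \<open>Uniqueness is among solutions of the differentiated equation, which
  \<open>variation_of_constants\<close> turns into mild ones. F is Lipschitz on every ball, as a
  competitor may leave the ball of radius r.\<close>

lemma semilinear_wellposed:
  assumes lip: "\<And>r. \<exists>L\<ge>0. lip_on r F L" and r: "r = norm y0 + 1"
    and F: "\<And>y. nonneg y \<Longrightarrow> norm y \<le> r \<Longrightarrow> nonneg (F y)" and y0: "nonneg y0"
  obtains T y where "0 < T" "continuous_on {0..T} y" "y 0 = y0" "\<And>t. t \<in> {0..T} \<Longrightarrow> nonneg (y t)"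
    "\<And>t. t \<in> {0<..T} \<Longrightarrow> app J (y t) \<in> D" "continuous_on {0<..T} (\<lambda>t. Y (app J (y t)))"
    "\<And>t. t \<in> {0<..<T} \<Longrightarrow> ((\<lambda>t. app J (y t)) has_vector_derivative (Y (app J (y t)) + F (y t))) (at t)"
    "\<forall>z. continuous_on {0..T} z \<longrightarrow> z 0 = y0 \<longrightarrow> (\<forall>t\<in>{0<..<T}. app J (z t) \<in> D \<and>
       ((\<lambda>t. app J (z t)) has_vector_derivative (Y (app J (z t)) + F (z t))) (at t)) \<longrightarrow> (\<forall>t\<in>{0..T}. z t = y t)"
    "continuous_on {0..T} (\<lambda>t. F (y t))"
proof -
  obtain L where L: "0 \<le> L" "lip_on r F L" using lip by blast
  obtain T y where T: "0 < T" and y: "mild F y0 T y" and yB: "\<And>t. t \<in> {0..T} \<Longrightarrow> nonneg (y t) \<and> norm (y t) \<le> r"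
    and small: "Ka * L * Pw T \<le> 1 / 2"
    using mild_exists[OF L(2) r F y0] by blast
  define G where "G t = F (y t)" for t
  have cy: "continuous_on {0..T} y" using y by (simp add: mild_def)
  have G: "continuous_on {0..T} G"
    unfolding G_def using yB by (intro lip_on_continuous[OF L(2) cy]) auto
  obtain Q where Q: "0 \<le> Q" "\<And>t l. t \<in> {0..T} \<Longrightarrow> l \<in> {1/2..1} \<Longrightarrow> norm (y t - y (l * t)) \<le> Q * (1 - l)"
    using mild_dilation[OF y T L(2,1) _ small] yB by blast
  have smooth: "(\<forall>t\<in>{a..T}. conv G t \<in> D) \<and> continuous_on {a..T} (\<lambda>t. Y (conv G t))" if a: "0 < a" for a
  proof (rule conv_smooth[OF G a])
    fix s t assume st: "a / 2 \<le> s" "s \<le> t" "t \<le> T" "t / 2 \<le> s"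
    have t0: "0 < t" "0 < s" using st a by auto
    \<comment> \<open>Dilation by l = s / t, which is at least 1/2; then 1 - l = (t - s) / t and t
      is at least a/2.\<close>
    have "norm (y t - y (s / t * t)) \<le> Q * (1 - s / t)"
      using st t0 by (intro Q(2)) (auto simp: field_simps)
    then have "norm (y t - y s) \<le> Q * ((t - s) / t)"
      using t0 by (simp add: diff_divide_distrib)
    also have "\<dots> \<le> Q * ((t - s) / (a / 2))"
      using st a Q(1) t0 by (intro mult_left_mono divide_left_mono) auto
    finally have "L * norm (y t - y s) \<le> L * (Q * ((t - s) / (a / 2)))"
      using L(1) by (rule mult_left_mono)
    moreover have "norm (G t - G s) \<le> L * norm (y t - y s)"
      using L(2) yB st t0 by (simp add: lip_on_def G_def)
    ultimately show "norm (G t - G s) \<le> (L * Q * 2 / a) * (t - s)"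
      by (simp add: mult_ac)
  qed (use L Q a in auto)
  have mild_eq: "app J (y t) = app (S t) (app J y0) + conv G t" if "t \<in> {0..T}" for t
    using y that by (simp add: mild_def G_def[abs_def])
  note V = variation_of_constants_smooth[OF G smooth mild_eq]
  show thesis
  proof (rule that[of T y])
    have "z t = y t" if z: "continuous_on {0..T} z" "z 0 = y0"
      "\<forall>t\<in>{0<..<T}. app J (z t) \<in> D \<and> ((\<lambda>t. app J (z t)) has_vector_derivative (Y (app J (z t)) + F (z t))) (at t)"
      and t: "t \<in> {0..T}" for z t
    proof -
      have zD: "\<And>t. t \<in> {0<..<T} \<Longrightarrow> app J (z t) \<in> D"
        and z': "\<And>t. t \<in> {0<..<T} \<Longrightarrow> ((\<lambda>t. app J (z t)) has_vector_derivative (Y (app J (z t)) + F (z t))) (at t)"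
        using z(3) by auto
      have "app J (z t) = app (S t) (app J (z 0)) + conv (\<lambda>s. F (z s)) t" if "t \<in> {0..T}" for t
        by (rule variation_of_constants[OF _ zD z' that]) (intro app.continuous_on continuous_on_const z(1))
      then have "mild F y0 T z"
        using z(1,2) by (simp add: mild_def)
      then show ?thesis
        using mild_unique[OF _ _ y t] lip by blast
    qed
    then show "\<forall>z. continuous_on {0..T} z \<longrightarrow> z 0 = y0 \<longrightarrow> (\<forall>t\<in>{0<..<T}. app J (z t) \<in> D \<and>
       ((\<lambda>t. app J (z t)) has_vector_derivative (Y (app J (z t)) + F (z t))) (at t)) \<longrightarrow> (\<forall>t\<in>{0..T}. z t = y t)"
      by blast
  qed (use T cy yB V mild_initial[OF y] G in \<open>simp_all add: G_def[abs_def]\<close>)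
qed

end

section \<open>Bounded bilinear maps\<close>

text \<open>A bounded bilinear map on l^1 is determined by its values \<open>e m j\<close> on pairs
  of unit vectors, and a uniform bound on them is a bound for the map.\<close>

definition bil :: "(nat \<Rightarrow> nat \<Rightarrow> ell1) \<Rightarrow> ell1 \<Rightarrow> ell1 \<Rightarrow> ell1" where
  "bil e y z = colsum (\<lambda>m. colsum (e m) z) y"

context
  fixes e :: "nat \<Rightarrow> nat \<Rightarrow> ell1" and B :: real
  assumes e: "\<And>m j. norm (e m j) \<le> B"
begin

lemma norm_inner: "norm (colsum (e m) z) \<le> B * norm z"
  by (rule norm_colsum_bounded[OF e])

lemma norm_bil: "norm (bil e y z) \<le> B * norm y * norm z"
  using norm_colsum_bounded[of "\<lambda>m. colsum (e m) z", OF norm_inner, of y] by (simp add: bil_def mult_ac)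

lemma bil_diff_left: "bil e (y - y') z = bil e y z - bil e y' z"
  unfolding bil_def using linear_diff[OF bounded_linear.linear[OF bounded_linear_colsum[of "\<lambda>m. colsum (e m) z", OF norm_inner]]] .

lemma bil_diff_right: "bil e y (z - z') = bil e y z - bil e y z'"
proof -
  have "colsum (e m) (z - z') = colsum (e m) z - colsum (e m) z'" for m
    using linear_diff[OF bounded_linear.linear[OF bounded_linear_colsum[OF e]]] .
  then show ?thesis
    unfolding bil_def colsum_def[of "\<lambda>m. colsum (e m) _"]
    by (simp add: scaleR_diff_right suminf_diff[OF summable_colsum[OF summable_coord_bounded[OF norm_inner]]
        summable_colsum[OF summable_coord_bounded[OF norm_inner]]])
qed

lemma bil_lipschitz:
  assumes "norm y \<le> r" "norm z \<le> r"
  shows "norm (bil e y y - bil e z z) \<le> 2 * B * r * norm (y - z)"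
proof -
  have B: "0 \<le> B" using e norm_ge_zero order_trans by blast
  have eq: "bil e y y - bil e z z = bil e (y - z) y + bil e z (y - z)"
    by (simp add: bil_diff_left bil_diff_right)
  have "norm (bil e (y - z) y) \<le> B * norm (y - z) * r" "norm (bil e z (y - z)) \<le> B * r * norm (y - z)"
    using B assms by (auto intro!: order_trans[OF norm_bil] mult_left_mono mult_right_mono)
  then show ?thesis
    unfolding eq by (intro norm_triangle_le) (simp add: mult_ac)
qed

lemma coord_bil: "coord (bil e y z) n = (\<Sum>m. coord y m * (\<Sum>j. coord z j * coord (e m j) n))"
  unfolding bil_def
  by (simp add: coord_colsum[OF summable_coord_bounded[OF norm_inner]] coord_colsum[OF summable_coord_bounded[OF e]])

end

section \<open>Weighted sequences as absolutely summable sequences\<close>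

text \<open>For f in \<open>Xsp u\<close> this is an isometry onto \<open>ell1\<close>; index i
  becomes coordinate i - 1.\<close>

definition pack :: "(nat \<Rightarrow> real) \<Rightarrow> (nat \<Rightarrow> real) \<Rightarrow> ell1" where
  "pack u f = Abs_ell1 (\<lambda>n. u (Suc n) * f (Suc n))"

definition unpack :: "(nat \<Rightarrow> real) \<Rightarrow> ell1 \<Rightarrow> nat \<Rightarrow> real" where
  "unpack u x i = (if i = 0 then 0 else coord x (i - 1) / u i)"

locale weight =
  fixes u :: "nat \<Rightarrow> real"
  assumes u_pos: "\<And>i. 1 \<le> i \<Longrightarrow> 0 < u i"
begin

lemma u_Suc: "0 < u (Suc n)" and u_nonzero [simp]: "u (Suc n) \<noteq> 0"
  using u_pos[of "Suc n"] by simp_all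

lemma abs_weighted: "\<bar>u (Suc n) * r\<bar> = u (Suc n) * \<bar>r\<bar>"
  by (simp add: abs_mult abs_of_pos[OF u_Suc])

lemma weighted_nonneg: "0 \<le> u (Suc n) * \<bar>r\<bar>"
  using less_imp_le[OF u_Suc] by simp

lemma summable_Xsp:
  assumes "f \<in> Xsp u"
  shows "summable (\<lambda>n. \<bar>u (Suc n) * f (Suc n)\<bar>)"
  unfolding abs_weighted
  by (rule summable_suminf_not_top[OF weighted_nonneg]) (use assms in \<open>simp add: Xsp_def enorm_def less_top\<close>)

lemma Xsp_iff: "f \<in> Xsp u \<longleftrightarrow> f 0 = 0 \<and> summable (\<lambda>n. \<bar>u (Suc n) * f (Suc n)\<bar>)"
proof safe
  assume f: "f 0 = 0" "summable (\<lambda>n. \<bar>u (Suc n) * f (Suc n)\<bar>)"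
  have "enorm u f = ennreal (\<Sum>n. u (Suc n) * \<bar>f (Suc n)\<bar>)"
    unfolding enorm_def using f(2) by (intro suminf_ennreal2 weighted_nonneg) (simp add: abs_weighted)
  then show "f \<in> Xsp u"
    using f(1) by (simp add: Xsp_def)
qed (auto simp: summable_Xsp, simp add: Xsp_def)

lemma coord_pack: "f \<in> Xsp u \<Longrightarrow> coord (pack u f) n = u (Suc n) * f (Suc n)"
  by (simp add: pack_def coord_Abs summable_Xsp)

lemma enorm_eq: "f \<in> Xsp u \<Longrightarrow> enorm u f = ennreal (norm (pack u f))"
  unfolding enorm_def norm_ell1_def using summable_Xsp[of f]
  by (subst suminf_ennreal2[OF weighted_nonneg]) (simp_all add: coord_pack abs_weighted)

lemma unpack_Xsp: "unpack u x \<in> Xsp u"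
  by (simp add: Xsp_iff unpack_def summable_coord)

lemma pack_unpack: "pack u (unpack u x) = x"
  by (intro ell1_eqI) (simp add: coord_pack[OF unpack_Xsp], simp add: unpack_def)

lemma unpack_pack:
  assumes "f \<in> Xsp u"
  shows "unpack u (pack u f) = f"
proof
  fix i
  show "unpack u (pack u f) i = f i"
    using assms by (cases i) (simp_all add: unpack_def coord_pack, simp add: Xsp_def)
qed

lemma pack_eqI: "f 0 = 0 \<Longrightarrow> (\<And>n. u (Suc n) * f (Suc n) = coord x n) \<Longrightarrow> f \<in> Xsp u \<and> pack u f = x"
  by (auto simp: Xsp_iff summable_coord coord_pack intro!: ell1_eqI)

lemma pack_linear:
  assumes "f \<in> Xsp u" "h \<in> Xsp u"
  shows "(\<lambda>i. r * f i + q * h i) \<in> Xsp u \<and> pack u (\<lambda>i. r * f i + q * h i) = r *\<^sub>R pack u f + q *\<^sub>R pack u h"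
  by (rule pack_eqI) (use assms in \<open>auto simp: coord_pack algebra_simps, simp add: Xsp_def\<close>)

lemma pack_diff:
  assumes "f \<in> Xsp u" "h \<in> Xsp u"
  shows "(\<lambda>i. f i - h i) \<in> Xsp u" "pack u (\<lambda>i. f i - h i) = pack u f - pack u h"
  using pack_linear[OF assms, of 1 "- 1"] by simp_all

lemma ennreal_norm_tendsto: "((\<lambda>t. ennreal (norm (x t))) \<longlongrightarrow> 0) A \<longleftrightarrow> ((\<lambda>t. norm (x t)) \<longlongrightarrow> 0) A"
  using tendsto_ennreal_iff[of "\<lambda>t. norm (x t)" A 0] by simp

lemma cont_in_iff:
  assumes f: "\<And>t. t \<in> A \<Longrightarrow> f t \<in> Xsp u"
  shows "cont_in u A f \<longleftrightarrow> continuous_on A (\<lambda>t. pack u (f t))"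
  unfolding cont_in_def continuous_on_def
proof (rule ball_cong[OF refl])
  fix t assume t: "t \<in> A"
  have "\<forall>\<^sub>F s in at t within A. enorm u (\<lambda>i. f s i - f t i) = ennreal (norm (pack u (f s) - pack u (f t)))"
    unfolding eventually_at_filter using f t
    by (intro always_eventually) (auto simp: enorm_eq pack_diff)
  from tendsto_cong[OF this]
  show "((\<lambda>s. enorm u (\<lambda>i. f s i - f t i)) \<longlongrightarrow> 0) (at t within A) \<longleftrightarrow>
      ((\<lambda>s. pack u (f s)) \<longlongrightarrow> pack u (f t)) (at t within A)"
    by (simp add: ennreal_norm_tendsto tendsto_norm_zero_iff LIM_zero_iff)
qed

text \<open>Openness of A keeps t + h where f takes values in the space, so that
  \<open>enorm\<close> can be expressed by \<open>pack\<close>.\<close>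

lemma has_deriv_in_iff:
  assumes A: "open A" "t \<in> A" and f: "\<And>t. t \<in> A \<Longrightarrow> f t \<in> Xsp u" and f': "f' \<in> Xsp u"
  shows "has_deriv_in u f f' t \<longleftrightarrow> ((\<lambda>t. pack u (f t)) has_vector_derivative pack u f') (at t)"
proof -
  let ?x = "\<lambda>t. pack u (f t)"
  have "\<forall>\<^sub>F h in at 0. t + h \<in> A"
  proof -
    have "((\<lambda>h. t + h) \<longlongrightarrow> t + 0) (at 0)"
      by (intro tendsto_intros)
    then show ?thesis
      using topological_tendstoD[OF _ A(1), of "\<lambda>h. t + h" t "at 0"] A(2) by simp
  qed
  moreover have "\<forall>\<^sub>F h in at (0::real). h \<noteq> 0"
    by (simp add: eventually_at_filter)
  ultimately have "\<forall>\<^sub>F h in at 0. enorm u (\<lambda>i. (f (t + h) i - f t i) / h - f' i)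
      = ennreal (norm (?x (t + h) - ?x t - h *\<^sub>R pack u f') / norm h)"
  proof eventually_elim
    case (elim h)
    note d = pack_linear[OF pack_diff(1)[OF f[OF elim(1)] f[OF A(2)]] f', of "1 / h" "- 1"]
    have "enorm u (\<lambda>i. (f (t + h) i - f t i) / h - f' i) = ennreal (norm ((1 / h) *\<^sub>R (?x (t + h) - ?x t) - pack u f'))"
      using d enorm_eq[OF conjunct1[OF d]] pack_diff(2)[OF f[OF elim(1)] f[OF A(2)]] by simp
    also have "(1 / h) *\<^sub>R (?x (t + h) - ?x t) - pack u f' = (1 / h) *\<^sub>R (?x (t + h) - ?x t - h *\<^sub>R pack u f')"
      using elim(2) by (simp add: scaleR_diff_right)
    also have "norm \<dots> = norm (?x (t + h) - ?x t - h *\<^sub>R pack u f') / norm h"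
      by simp
    finally show ?case .
  qed
  from tendsto_cong[OF this] show ?thesis
    unfolding has_deriv_in_def has_vector_derivative_def has_derivative_at
    using tendsto_ennreal_iff[of "\<lambda>h. norm (?x (t + h) - ?x t - h *\<^sub>R pack u f') / norm h" "at 0" 0]
    by (simp add: bounded_linear_scaleR_left)
qed

end

section \<open>The fragmentation rates\<close>

text \<open>Convexity of exp between 0 and ln x, i.e. the tangent at 1 of a concave power.\<close>

lemma powr_le_linear:
  fixes x l :: real
  assumes "0 < x" "0 \<le> l" "l \<le> 1"
  shows "x powr l \<le> 1 + l * (x - 1)"
proof -
  have "exp ((1 - l) *\<^sub>R 0 + l *\<^sub>R ln x) \<le> (1 - l) * exp 0 + l * exp (ln x)"
    by (rule convex_onD[OF exp_convex]) (use assms in auto)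
  then show ?thesis
    using assms by (simp add: powr_def algebra_simps)
qed

text \<open>By mass conservation the weights \<open>real j * b j i / real i\<close> add up to 1,
  which absorbs the leading term of \<open>Delta\<close> into the sum.\<close>

lemma Delta_ratio:
  assumes i: "2 \<le> i" and mass: "(\<Sum>j = 1..i - 1. real j * b j i) = real i"
  shows "Delta b q i / real i powr q = (\<Sum>j = 1..i - 1. (1 - (real j / real i) powr (q - 1)) * (real j * b j i / real i))"
proof -
  have "(\<Sum>j = 1..i - 1. (1 - (real j / real i) powr (q - 1)) * (real j * b j i / real i))
      = (\<Sum>j = 1..i - 1. real j * b j i) / real i - (\<Sum>j = 1..i - 1. (real j / real i) powr (q - 1) * (real j * b j i / real i))"
    by (simp add: left_diff_distrib sum_subtractf sum_divide_distrib diff_divide_distrib)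
  also have "(\<Sum>j = 1..i - 1. real j * b j i) / real i = 1"
    using i unfolding mass by simp
  also have "(\<Sum>j = 1..i - 1. (real j / real i) powr (q - 1) * (real j * b j i / real i))
      = (\<Sum>j = 1..i - 1. real j powr q * b j i) / real i powr q"
    unfolding sum_divide_distrib
  proof (rule sum.cong[OF refl])
    fix j assume j: "j \<in> {1..i - 1}"
    then show "(real j / real i) powr (q - 1) * (real j * b j i / real i) = real j powr q * b j i / real i powr q"
      using i by (simp add: powr_divide powr_diff field_simps)
  qed
  finally show ?thesis
    using i by (simp add: Delta_def diff_divide_distrib)
qed

text \<open>The weights \<open>j * b j i / i\<close> form a probability distribution on \<open>{1..i-1}\<close>; passing from the exponent
  \<open>q\<close> to a smaller exponent \<open>p\<close> is Jensen's inequality for it, made linear by \<open>powr_le_linear\<close>.\<close>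

lemma Delta_compare:
  assumes i: "2 \<le> i" and b: "\<And>j. 1 \<le> j \<Longrightarrow> 0 \<le> b j i" and mass: "(\<Sum>j = 1..i - 1. real j * b j i) = real i"
    and q: "1 < q" and p: "1 < p"
  shows "min 1 ((p - 1) / (q - 1)) * (Delta b q i / real i powr q) \<le> Delta b p i / real i powr p"
proof -
  define l where "l = min 1 ((p - 1) / (q - 1))"
  have l: "0 < l" "l \<le> 1" using p q by (auto simp: l_def)
  have lq: "(q - 1) * l \<le> p - 1"
    using q by (simp add: l_def min_def field_simps)
  show ?thesis
    unfolding Delta_ratio[of i b, OF i mass] l_def[symmetric] sum_distrib_left
  proof (rule sum_mono)
    fix j assume j: "j \<in> {1..i - 1}"
    define x where "x = real j / real i"
    have x: "0 < x" "x \<le> 1" using j by (auto simp: x_def)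
    have "x powr (p - 1) \<le> x powr ((q - 1) * l)"
      using x lq by (intro powr_mono') auto
    also have "\<dots> = (x powr (q - 1)) powr l"
      by (simp add: powr_powr)
    also have "\<dots> \<le> 1 + l * (x powr (q - 1) - 1)"
      using x l by (intro powr_le_linear) auto
    finally have "l * (1 - x powr (q - 1)) \<le> 1 - x powr (p - 1)"
      by (simp add: algebra_simps)
    then have "l * (1 - x powr (q - 1)) * (real j * b j i / real i) \<le> (1 - x powr (p - 1)) * (real j * b j i / real i)"
      using b[of j] j by (intro mult_right_mono divide_nonneg_nonneg mult_nonneg_nonneg) auto
    then show "l * ((1 - (real j / real i) powr (q - 1)) * (real j * b j i / real i))
        \<le> (1 - (real j / real i) powr (p - 1)) * (real j * b j i / real i)"
      by (simp add: x_def mult.assoc)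
  qed
qed

text \<open>Relative to i^p, growth is weighted by a ratio tending to 1 and fragmentation loses the
  proportion \<open>Delta b p i / real i powr p\<close>. By (A) and \<open>Delta_compare\<close>
  this loss is at least 2 c \<theta> for large i: half pays for the excess of growth, half remains
  as margin. M absorbs the finitely many small i.\<close>

lemma column_bound:
  fixes g d s a :: "nat \<Rightarrow> real"
  assumes nn: "\<And>i. 1 \<le> i \<Longrightarrow> 0 \<le> g i" "\<And>i. 1 \<le> i \<Longrightarrow> 0 \<le> d i" "\<And>i. 1 \<le> i \<Longrightarrow> 0 \<le> s i"
    and a: "\<And>i. 2 \<le> i \<Longrightarrow> 0 < a i"
    and b: "\<And>i j. 1 \<le> i \<Longrightarrow> 1 \<le> j \<Longrightarrow> 0 \<le> b i j"
    and mass: "\<And>j. 2 \<le> j \<Longrightarrow> (\<Sum>i = 1..j - 1. real i * b i j) = real j"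
    and q: "1 < q" and A: "Liminf sequentially (\<lambda>i. ereal (a i / theta a g d s i * (Delta b q i / real i powr q))) > 0"
    and p: "1 < p"
  shows "\<exists>c>0. \<exists>M\<ge>0. \<forall>i\<ge>1. g i * ((real i + 1) powr p / real i powr p) + d i + a i - a i * (Delta b p i / real i powr p)
    \<le> theta a g d s i + M - c * (1 + theta a g d s i)"
proof -
  let ?th = "theta a g d s"
  obtain c0 where c0: "0 < ereal c0" "ereal c0 < Liminf sequentially (\<lambda>i. ereal (a i / ?th i * (Delta b q i / real i powr q)))"
    using ereal_dense2[OF A] by auto
  then have ev: "\<forall>\<^sub>F i in sequentially. c0 < a i / ?th i * (Delta b q i / real i powr q)"
    using less_LiminfD[OF c0(2)] by simp
  define l where "l = min 1 ((p - 1) / (q - 1))"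
  define c where "c = l * c0 / 2"
  have l: "0 < l" using p q by (auto simp: l_def)
  have c: "0 < c" using l c0 by (simp add: c_def)
  have "(\<lambda>n. (1 + inverse (real n)) powr p) \<longlonglongrightarrow> (1 + 0) powr p"
    by (intro tendsto_intros LIMSEQ_inverse_real_of_nat_add lim_inverse_n) auto
  then have ev2: "\<forall>\<^sub>F i in sequentially. (1 + inverse (real i)) powr p < 1 + c"
    using c by (intro order_tendstoD) auto
  define f where "f i = g i * ((real i + 1) powr p / real i powr p) + d i + a i - a i * (Delta b p i / real i powr p)
     - ?th i + c * (1 + ?th i)" for i
  have "\<forall>\<^sub>F i in sequentially. f i \<le> c"
    using ev ev2 eventually_ge_at_top[of 2]
  proof eventually_elim
    case (elim i)
    have th: "0 < ?th i" "g i \<le> ?th i" "g i + d i + a i \<le> ?th i"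
      using nn[of i] a[of i] elim(3) by (auto simp: theta_def)
    have "(real i + 1) powr p / real i powr p = ((real i + 1) / real i) powr p"
      using elim(3) by (simp add: powr_divide)
    also have "(real i + 1) / real i = 1 + inverse (real i)"
      using elim(3) by (simp add: field_simps)
    finally have "g i * ((real i + 1) powr p / real i powr p) \<le> g i * (1 + c)"
      using elim(2,3) nn(1)[of i] by (intro mult_left_mono) auto
    also have "\<dots> \<le> g i + c * ?th i"
      using th c by (simp add: distrib_left mult.commute)
    finally have 1: "g i * ((real i + 1) powr p / real i powr p) \<le> g i + c * ?th i" .
    have "c0 < a i * (Delta b q i / real i powr q) / ?th i"
      using elim(1) by (simp add: mult.commute)
    then have "c0 * ?th i \<le> a i * (Delta b q i / real i powr q)"
      by (simp only: pos_less_divide_eq[OF th(1)] less_imp_le)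
    then have "l * (c0 * ?th i) \<le> l * (a i * (Delta b q i / real i powr q))"
      using l by (intro mult_left_mono) auto
    also have "\<dots> = a i * (l * (Delta b q i / real i powr q))"
      by simp
    also have "\<dots> \<le> a i * (Delta b p i / real i powr p)"
      unfolding l_def using a[of i] elim(3) b mass[of i] q p by (intro mult_left_mono Delta_compare) auto
    finally have "2 * (c * ?th i) \<le> a i * (Delta b p i / real i powr p)"
      by (simp add: c_def mult.assoc)
    then show ?case
      using 1 th unfolding f_def by (simp add: distrib_left)
  qed
  then obtain N where N: "\<And>i. i \<ge> N \<Longrightarrow> f i \<le> c"
    by (auto simp: eventually_sequentially)
  define M where "M = c + (\<Sum>i<N. \<bar>f i\<bar>)"
  have "f i \<le> M" for i
  proof (cases "i < N")
    case True
    then have "\<bar>f i\<bar> \<le> (\<Sum>i<N. \<bar>f i\<bar>)"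
      by (intro member_le_sum) auto
    then show ?thesis using c by (simp add: M_def)
  next
    case False
    then have "f i \<le> c" by (intro N) simp
    moreover have "0 \<le> (\<Sum>i<N. \<bar>f i\<bar>)" by (simp add: sum_nonneg)
    ultimately show ?thesis unfolding M_def by linarith
  qed
  moreover have "0 \<le> M"
    using c by (simp add: M_def sum_nonneg add_nonneg_nonneg)
  ultimately show ?thesis
    using c by (intro exI[of _ c] conjI exI[of _ M] allI impI) (auto simp: f_def algebra_simps)
qed

section \<open>The growth-fragmentation-coagulation equation\<close>

text \<open>c and M are those of \<open>column_bound\<close>; \<gamma> stays a free parameter until
  the initial datum is known.\<close>

locale coagulation_fragmentation =
  fixes g d s a :: "nat \<Rightarrow> real" and b k :: "nat \<Rightarrow> nat \<Rightarrow> real" and \<kappa> \<alpha> p c M \<gamma> :: real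
  assumes g_nn: "\<And>i. 1 \<le> i \<Longrightarrow> 0 \<le> g i" and d_nn: "\<And>i. 1 \<le> i \<Longrightarrow> 0 \<le> d i"
    and s_nn: "\<And>i. 1 \<le> i \<Longrightarrow> 0 \<le> s i" and a_nn: "\<And>i. 1 \<le> i \<Longrightarrow> 0 \<le> a i"
    and b_nn: "\<And>i j. 1 \<le> i \<Longrightarrow> 1 \<le> j \<Longrightarrow> 0 \<le> b i j" and k_nn: "\<And>i j. 1 \<le> i \<Longrightarrow> 1 \<le> j \<Longrightarrow> 0 \<le> k i j"
    and g0: "g 0 = 0" and kappa: "0 < \<kappa>" and alpha: "0 < \<alpha>" "\<alpha> < 1"
    and k_le: "\<And>i j. 1 \<le> i \<Longrightarrow> 1 \<le> j \<Longrightarrow>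
      k i j \<le> \<kappa> * ((1 + theta a g d s i) powr \<alpha> + (1 + theta a g d s j) powr \<alpha>)"
    and p: "1 < p" and c: "0 < c" and M: "0 \<le> M" and gamma: "0 \<le> \<gamma>"
    and column: "\<And>i. 1 \<le> i \<Longrightarrow>
      g i * ((real i + 1) powr p / real i powr p) + d i + a i - a i * (Delta b p i / real i powr p)
      \<le> theta a g d s i + M - c * (1 + theta a g d s i)"
begin

abbreviation \<theta> where "\<theta> \<equiv> theta a g d s"
abbreviation w where "w n \<equiv> wp p (Suc n)"

section \<open>The linear part as a column dominated matrix\<close>

definition \<tau> :: "nat \<Rightarrow> real" where "\<tau> n = 1 + \<theta> (Suc n)"
definition \<eta> :: "nat \<Rightarrow> real" where "\<eta> n = \<theta> (Suc n) + M + \<gamma> * \<tau> n powr \<alpha>"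

text \<open>Coordinate \<open>n\<close> of \<open>ell1\<close> belongs to the cluster size \<open>n + 1\<close>: \<open>\<beta> n m\<close> is the rate of production of size
  \<open>n + 1\<close> from size \<open>m + 1\<close>.  The shift \<open>M\<close> makes the columns dominated, \<open>\<gamma>\<close> makes the nonlinearity positive.\<close>

definition \<beta> :: "nat \<Rightarrow> nat \<Rightarrow> real" where
  "\<beta> n m = (if n = Suc m then g (Suc m) else 0) + (if Suc n = m then d (Suc m) else 0)
     + (if n < m then a (Suc m) * b (Suc n) (Suc m) else 0)"

text \<open>The production rates conjugated by the weight \<open>w\<close>. Growth raises the size
  by one and all other processes lower it, so every column is finite.\<close>

definition v :: "nat \<Rightarrow> ell1" where
  "v m = (\<Sum>n\<le>Suc m. (w n * \<beta> n m / w m) *\<^sub>R unit n)"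

lemma w_pos: "0 < w n" and w_nonzero [simp]: "w n \<noteq> 0" and w_ge_1: "1 \<le> w n"
  using p by (simp_all add: wp_def ge_one_powr_ge_zero)

lemma \<theta>_nn: "1 \<le> i \<Longrightarrow> 0 \<le> \<theta> i"
  using g_nn d_nn s_nn a_nn by (simp add: theta_def)

lemma \<tau>_ge_1: "1 \<le> \<tau> n"
  using \<theta>_nn[of "Suc n"] by (simp add: \<tau>_def)

lemma \<beta>_nn: "0 \<le> \<beta> n m"
  using g_nn d_nn a_nn b_nn by (simp add: \<beta>_def)

lemma coord_v: "coord (v m) n = w n * \<beta> n m / w m"
proof -
  have "coord (v m) n = (\<Sum>n'\<le>Suc m. if n' = n then w n * \<beta> n m / w m else 0)"
    unfolding v_def coord_sum by (rule sum.cong) (simp_all add: coord_unit)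
  also have "\<dots> = (if n \<le> Suc m then w n * \<beta> n m / w m else 0)"
    by simp
  finally show ?thesis
    by (auto simp: \<beta>_def)
qed

lemma norm_v_le: "norm (v m) \<le> \<eta> m - c * \<tau> m"
proof -
  let ?i = "Suc m"
  have "norm (v m) \<le> (\<Sum>n\<le>Suc m. norm ((w n * \<beta> n m / w m) *\<^sub>R unit n))"
    unfolding v_def by (rule norm_sum)
  also have "\<dots> = (\<Sum>n\<le>Suc m. w n * \<beta> n m) / w m"
  proof -
    have "norm ((w n * \<beta> n m / w m) *\<^sub>R unit n) = w n * \<beta> n m / w m" for n
      using w_pos \<beta>_nn by (simp add: less_imp_le)
    then show ?thesis by (simp only: sum_divide_distrib)
  qed
  also have "(\<Sum>n\<le>Suc m. w n * \<beta> n m) \<le> g ?i * w ?i + d ?i * w m + a ?i * (w m - Delta b p ?i)"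
  proof -
    have "(\<Sum>n\<le>Suc m. w n * \<beta> n m) = (\<Sum>n\<le>Suc m. if n = Suc m then w n * g ?i else 0)
        + (\<Sum>n\<le>Suc m. if Suc n = m then w n * d ?i else 0)
        + (\<Sum>n\<le>Suc m. if n < m then w n * (a ?i * b (Suc n) ?i) else 0)"
      unfolding sum.distrib[symmetric] by (rule sum.cong) (auto simp: \<beta>_def distrib_left)
    also have "(\<Sum>n\<le>Suc m. if n = Suc m then w n * g ?i else 0) = g ?i * w ?i"
      by simp
    \<comment> \<open>Size m + 1 decays to size m, which has the smaller weight; for m = 0 nothing
      is produced.\<close>
    also have "(\<Sum>n\<le>Suc m. if Suc n = m then w n * d ?i else 0) \<le> d ?i * w m"
    proof (cases m)
      case (Suc q)
      then have "(\<Sum>n\<le>Suc m. if Suc n = m then w n * d ?i else 0) = (\<Sum>n\<le>Suc m. if n = q then w q * d ?i else 0)"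
        by (intro sum.cong) auto
      also have "\<dots> = w q * d ?i"
        using Suc by simp
      also have "\<dots> \<le> d ?i * w m"
        using d_nn[of ?i] p Suc by (subst mult.commute) (auto intro!: mult_left_mono powr_mono2 simp: wp_def)
      finally show ?thesis .
    qed (use d_nn[of 1] w_pos[of 0] in simp)
    also have "(\<Sum>n\<le>Suc m. if n < m then w n * (a ?i * b (Suc n) ?i) else 0) = (\<Sum>n<m. w n * (a ?i * b (Suc n) ?i))"
      by (rule sum.mono_neutral_cong_right) auto
    also have "\<dots> = a ?i * (\<Sum>n<m. w n * b (Suc n) ?i)"
      by (simp add: sum_distrib_left mult_ac)
    also have "(\<Sum>n<m. w n * b (Suc n) ?i) = (\<Sum>j = 1..?i - 1. real j powr p * b j ?i)"
      by (rule sum.reindex_bij_witness[of _ "\<lambda>j. j - 1" Suc]) (auto simp: wp_def)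
    also have "\<dots> = w m - Delta b p ?i"
      by (simp add: Delta_def wp_def)
    finally show ?thesis by simp
  qed
  then have "(\<Sum>n\<le>Suc m. w n * \<beta> n m) / w m \<le> (g ?i * w ?i + d ?i * w m + a ?i * (w m - Delta b p ?i)) / w m"
    using w_pos[of m] by (intro divide_right_mono) auto
  also have "\<dots> = g ?i * (w ?i / w m) + d ?i + a ?i - a ?i * (Delta b p ?i / w m)"
    using w_nonzero[of m] by (simp add: add_divide_distrib diff_divide_distrib right_diff_distrib)
  also have "\<dots> \<le> \<theta> ?i + M - c * \<tau> m"
    using column[of ?i] by (simp add: wp_def \<tau>_def add.commute)
  also have "\<dots> \<le> \<eta> m - c * \<tau> m"
    using gamma by (simp add: \<eta>_def)
  finally show ?thesis by simp
qed

lemma \<tau>_powr_le: "\<tau> n powr \<alpha> \<le> \<tau> n"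
  using powr_mono[of \<alpha> 1 "\<tau> n"] alpha \<tau>_ge_1[of n] by simp

lemma \<tau>_powr_ge_1: "1 \<le> \<tau> n powr \<alpha>"
  using alpha \<tau>_ge_1[of n] by (simp add: ge_one_powr_ge_zero)

sublocale matrix_generator v \<eta> \<tau> c "1 + M + \<gamma>" \<alpha>
proof
  fix m
  show "nonneg (v m)"
    using w_pos \<beta>_nn by (simp add: nonneg_def coord_v less_imp_le)
  show "\<eta> m \<le> (1 + M + \<gamma>) * \<tau> m"
    using mult_left_mono[OF \<tau>_powr_le[of m] gamma] mult_left_mono[OF \<tau>_ge_1[of m] M]
    by (simp add: \<eta>_def \<tau>_def distrib_right)
qed (use c alpha \<tau>_ge_1 norm_v_le in auto)

section \<open>Translation between the weighted spaces and \<open>ell1\<close>\<close>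

abbreviation wA where "wA \<equiv> wpb p \<alpha> \<theta>"
abbreviation w1 where "w1 \<equiv> wpb p 1 \<theta>"

lemma wA_Suc: "wA (Suc n) = w n * \<tau> n powr \<alpha>"
  by (simp add: wpb_def wp_def \<tau>_def)

lemma w1_Suc: "w1 (Suc n) = w n * \<tau> n"
  using \<tau>_ge_1[of n] by (simp add: wpb_def wp_def \<tau>_def)

sublocale X: weight "wp p"
  by unfold_locales (simp add: wp_def)

sublocale XA: weight wA
proof
  show "0 < wA i" if "1 \<le> i" for i
    using that \<theta>_nn[OF that] by (simp add: wpb_def)
qed

sublocale X1: weight w1
proof
  show "0 < w1 i" if "1 \<le> i" for i
    using that \<theta>_nn[OF that] by (simp add: wpb_def)
qed

lemma XA_X:
  assumes "f \<in> Xsp wA"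
  shows "f \<in> Xsp (wp p)" "pack (wp p) f = app J (pack wA f)"
proof -
  have "f \<in> Xsp (wp p) \<and> pack (wp p) f = app J (pack wA f)"
    by (rule X.pack_eqI)
      (use assms in \<open>auto simp: coord_J XA.coord_pack wA_Suc powr_minus, simp add: Xsp_def\<close>)
  then show "f \<in> Xsp (wp p)" "pack (wp p) f = app J (pack wA f)"
    by auto
qed

lemma X1_iff: "f \<in> Xsp (wp p) \<Longrightarrow> f \<in> Xsp w1 \<longleftrightarrow> pack (wp p) f \<in> D"
  using \<tau>_ge_1 by (simp add: X1.Xsp_iff D_def X.coord_pack w1_Suc abs_mult mult_ac abs_of_pos)
    (simp add: Xsp_def)

lemma X1_XA:
  assumes "f \<in> Xsp w1"
  shows "f \<in> Xsp wA"
proof -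
  have "summable (\<lambda>n. \<bar>wA (Suc n) * f (Suc n)\<bar>)"
  proof (rule summable_comparison_test'[OF X1.summable_Xsp[OF assms], of 0])
    fix n
    have "w n * \<tau> n powr \<alpha> * \<bar>f (Suc n)\<bar> \<le> w n * \<tau> n * \<bar>f (Suc n)\<bar>"
      using w_pos[of n] \<tau>_powr_le by (intro mult_right_mono mult_left_mono) auto
    then show "norm \<bar>wA (Suc n) * f (Suc n)\<bar> \<le> \<bar>w1 (Suc n) * f (Suc n)\<bar>"
      by (simp add: XA.abs_weighted X1.abs_weighted wA_Suc[symmetric] w1_Suc[symmetric])
  qed
  then show ?thesis
    using assms by (simp add: XA.Xsp_iff) (simp add: Xsp_def)
qed

lemma norm_pack_X1:
  assumes "f \<in> Xsp w1"
  shows "norm (pack w1 f) = tnorm (pack (wp p) f)"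
proof -
  have "f \<in> Xsp (wp p)"
    using XA_X X1_XA[OF assms] by blast
  then have "\<bar>coord (pack w1 f) n\<bar> = \<tau> n * \<bar>coord (pack (wp p) f) n\<bar>" for n
    using assms by (simp add: X.coord_pack X1.coord_pack w1_Suc abs_mult abs_of_pos[OF w_pos] abs_of_pos[OF tau_pos])
  then show ?thesis
    by (simp add: norm_ell1_def tnorm_def)
qed

text \<open>The difference to \<open>Yop\<close> is the artificial damping contained in \<eta>.
  Growth and decay contribute one term each to row n; removing them and the diagonal leaves the
  fragmentation series.\<close>

lemma coord_Y:
  assumes "f \<in> Xsp w1"
  shows "w n * Yop a b g d s f (Suc n) = coord (Y (pack (wp p) f)) n + (M + \<gamma> * \<tau> n powr \<alpha>) * coord (pack (wp p) f) n"
proof -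
  let ?x = "pack (wp p) f"
  have f: "f \<in> Xsp (wp p)" "f 0 = 0"
    using XA_X X1_XA[OF assms] assms by (auto simp: Xsp_def)
  have xD: "?x \<in> D"
    using X1_iff[OF f(1)] assms by simp
  have sg: "summable (\<lambda>m. coord ?x m * coord (gen m) n)"
    by (rule summable_coord_colsum[OF summable_D[OF xD norm_gen_le]])
  have su: "(\<lambda>m. coord ?x m * coord (\<eta> m *\<^sub>R unit m) n) sums (\<eta> n * coord ?x n)"
  proof -
    have "(\<lambda>m. coord ?x m * coord (\<eta> m *\<^sub>R unit m) n) = (\<lambda>m. if m = n then \<eta> n * coord ?x n else 0)"
      by (auto simp: coord_unit)
    then show ?thesis
      using sums_single[of n "\<lambda>_. \<eta> n * coord ?x n"] by simp
  qed
  have sv: "(\<lambda>m. coord ?x m * coord (v m) n) sums (coord (Y ?x) n + \<eta> n * coord ?x n)"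
  proof -
    have "(\<lambda>m. coord ?x m * coord (gen m) n) sums coord (Y ?x) n"
      unfolding Y_def coord_colsum[OF summable_D[OF xD norm_gen_le]] by (rule summable_sums[OF sg])
    from sums_add[OF this su] show ?thesis
      by (simp add: gen_def algebra_simps)
  qed
  have e: "coord ?x m * coord (v m) n = w n * (\<beta> n m * f (Suc m))" for m
    using f by (simp add: X.coord_pack coord_v)
  have sb: "(\<lambda>m. \<beta> n m * f (Suc m)) sums ((coord (Y ?x) n + \<eta> n * coord ?x n) / w n)"
    using sums_divide[OF sv, of "w n"] by (simp add: e)
  have s1: "(\<lambda>m. if n = Suc m then g (Suc m) * f (Suc m) else 0) sums (g n * f n)"
  proof (cases n)
    case (Suc q)
    have "(\<lambda>m. if n = Suc m then g (Suc m) * f (Suc m) else 0) = (\<lambda>m. if m = q then g n * f n else 0)"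
      using Suc by auto
    then show ?thesis
      using sums_single[of q "\<lambda>_. g n * f n"] by simp
  qed (simp add: f)
  have s2: "(\<lambda>m. if Suc n = m then d (Suc m) * f (Suc m) else 0) sums (d (n + 2) * f (n + 2))"
  proof -
    have "(\<lambda>m. if Suc n = m then d (Suc m) * f (Suc m) else 0) = (\<lambda>m. if m = Suc n then d (n + 2) * f (n + 2) else 0)"
      by auto
    then show ?thesis
      using sums_single[of "Suc n" "\<lambda>_. d (n + 2) * f (n + 2)"] by simp
  qed
  define h where "h m = (if n < m then a (Suc m) * b (Suc n) (Suc m) * f (Suc m) else 0)" for m
  have s3: "h sums ((coord (Y ?x) n + \<eta> n * coord ?x n) / w n - g n * f n - d (n + 2) * f (n + 2))"
  proof -
    have "(\<lambda>m. \<beta> n m * f (Suc m) - (if n = Suc m then g (Suc m) * f (Suc m) else 0)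
        - (if Suc n = m then d (Suc m) * f (Suc m) else 0)) = h"
      by (auto simp: \<beta>_def h_def distrib_right)
    then show ?thesis
      using sums_diff[OF sums_diff[OF sb s1] s2] by simp
  qed
  \<comment> \<open>h vanishes for m <= n; the shift produces the indexing of the series in
    \<open>Yop\<close>.\<close>
  have "(\<lambda>q. h (q + Suc n)) sums ((coord (Y ?x) n + \<eta> n * coord ?x n) / w n - g n * f n - d (n + 2) * f (n + 2))"
  proof -
    have "(\<Sum>m<Suc n. h m) = 0"
      by (rule sum.neutral) (auto simp: h_def)
    then show ?thesis
      using s3 by (subst sums_iff_shift) simp
  qed
  moreover have "h (q + Suc n) = a (Suc n + 1 + q) * b (Suc n) (Suc n + 1 + q) * f (Suc n + 1 + q)" for q
    by (simp add: h_def add.commute add.left_commute)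
  ultimately have "(\<Sum>q. a (Suc n + 1 + q) * b (Suc n) (Suc n + 1 + q) * f (Suc n + 1 + q))
      = (coord (Y ?x) n + \<eta> n * coord ?x n) / w n - g n * f n - d (n + 2) * f (n + 2)"
    by (simp add: sums_unique[symmetric])
  then have "Yop a b g d s f (Suc n) = (coord (Y ?x) n + \<eta> n * coord ?x n) / w n - \<theta> (Suc n) * f (Suc n)"
    by (simp add: Yop_def)
  then show ?thesis
    using f by (simp add: X.coord_pack \<eta>_def right_diff_distrib distrib_right)
qed

text \<open>The coagulation operator becomes a bounded bilinear map once both arguments are read with the
  weight \<open>wA\<close> and the result with the weight \<open>wp p\<close>.\<close>

definition gain :: "nat \<Rightarrow> nat \<Rightarrow> real" where
  "gain m j = w (Suc (m + j)) * k (Suc m) (Suc j) / (wA (Suc m) * wA (Suc j))"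

definition loss :: "nat \<Rightarrow> nat \<Rightarrow> real" where
  "loss m j = w m * k (Suc m) (Suc j) / (wA (Suc m) * wA (Suc j))"

definition coag :: "nat \<Rightarrow> nat \<Rightarrow> ell1" where
  "coag m j = (gain m j / 2) *\<^sub>R unit (Suc (m + j)) - loss m j *\<^sub>R unit m"

text \<open>Both powers are at least 1, so their sum is at most twice their product. The product
  form is what the weights of the two arguments can absorb.\<close>

lemma k_Suc_le: "k (Suc m) (Suc j) \<le> 2 * \<kappa> * (\<tau> m powr \<alpha> * \<tau> j powr \<alpha>)"
proof -
  let ?A = "\<tau> m powr \<alpha>" and ?B = "\<tau> j powr \<alpha>"
  have "0 \<le> (?A - 1) * ?B + (?B - 1) * ?A"
    using \<tau>_powr_ge_1[of m] \<tau>_powr_ge_1[of j] by (intro add_nonneg_nonneg mult_nonneg_nonneg) auto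
  then have "\<kappa> * (?A + ?B) \<le> \<kappa> * (2 * (?A * ?B))"
    using kappa by (intro mult_left_mono) (auto simp: algebra_simps)
  moreover have "k (Suc m) (Suc j) \<le> \<kappa> * (?A + ?B)"
    using k_le[of "Suc m" "Suc j"] by (simp add: \<tau>_def)
  ultimately show ?thesis by simp
qed

text \<open>Coordinate m + j + 1 is the size m + j + 2, the sum of the merging sizes; both are at
  least 1, so their sum is at most twice their product.\<close>

lemma w_add_le: "w (Suc (m + j)) \<le> 2 powr p * (w m * w j)"
proof -
  have "real (Suc (Suc (m + j))) \<le> 2 * (real (Suc m) * real (Suc j))"
    by (simp add: algebra_simps)
  then have "w (Suc (m + j)) \<le> (2 * (real (Suc m) * real (Suc j))) powr p"
    unfolding wp_def using p by (intro powr_mono2) auto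
  then show ?thesis
    by (simp add: wp_def powr_mult)
qed

lemma gain_loss_bounds:
  shows "0 \<le> gain m j" "gain m j \<le> 2 powr p * (2 * \<kappa>)" "0 \<le> loss m j" "loss m j \<le> 2 * \<kappa>"
proof -
  let ?A = "\<tau> m powr \<alpha>" and ?B = "\<tau> j powr \<alpha>"
  have k0: "0 \<le> k (Suc m) (Suc j)" using k_nn by simp
  have pos: "0 < wA (Suc m) * wA (Suc j)"
    using XA.u_Suc by simp
  show "0 \<le> gain m j" "0 \<le> loss m j"
    using k0 pos w_pos by (simp_all add: gain_def loss_def less_imp_le)
  have "w (Suc (m + j)) * k (Suc m) (Suc j) \<le> (2 powr p * (w m * w j)) * (2 * \<kappa> * (?A * ?B))"
    using w_add_le k_Suc_le k0 w_pos by (intro mult_mono) (auto simp: less_imp_le)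
  also have "\<dots> = 2 powr p * (2 * \<kappa>) * (wA (Suc m) * wA (Suc j))"
    by (simp add: wA_Suc)
  finally show "gain m j \<le> 2 powr p * (2 * \<kappa>)"
    using pos by (simp add: gain_def pos_divide_le_eq)
  have "w m * k (Suc m) (Suc j) \<le> w m * w j * (2 * \<kappa> * (?A * ?B))"
    using w_ge_1[of j] w_pos[of m] k_Suc_le k0 by (intro mult_mono) (auto simp: less_imp_le)
  also have "\<dots> = 2 * \<kappa> * (wA (Suc m) * wA (Suc j))"
    by (simp add: wA_Suc)
  finally show "loss m j \<le> 2 * \<kappa>"
    using pos by (simp add: loss_def pos_divide_le_eq)
qed

lemma norm_coag: "norm (coag m j) \<le> 2 powr p * (2 * \<kappa>) + 2 * \<kappa>"
proof -
  have "norm (coag m j) \<le> gain m j / 2 + loss m j"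
    unfolding coag_def using gain_loss_bounds[of m j]
    by (intro order_trans[OF norm_triangle_ineq4]) simp
  then show ?thesis
    using gain_loss_bounds[of m j] by linarith
qed

lemma coord_coag:
  "coord (bil coag y z) n = (\<Sum>m<n. gain m (n - 1 - m) / 2 * coord y m * coord z (n - 1 - m))
     - (\<Sum>j. loss n j * coord z j) * coord y n"
  and summable_loss: "summable (\<lambda>j. loss n j * coord z j)"
proof -
  show sl: "summable (\<lambda>j. loss n j * coord z j)"
  proof (rule summable_comparison_test'[OF summable_mult[OF summable_coord[of z], of "2 * \<kappa>"], of 0])
    show "norm (loss n j * coord z j) \<le> 2 * \<kappa> * \<bar>coord z j\<bar>" for j
      using gain_loss_bounds[of n j] by (simp add: abs_mult mult_right_mono)
  qed
  \<comment> \<open>Coordinates m and j merge into coordinate m + j + 1, so the partner of m for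
    target n is n - 1 - m, and it exists only for m < n.\<close>
  have inner: "(\<Sum>j. coord z j * coord (coag m j) n) =
      (if m < n then gain m (n - 1 - m) / 2 * coord z (n - 1 - m) else 0) - (if m = n then \<Sum>j. loss n j * coord z j else 0)" for m
  proof -
    have 1: "(\<lambda>j. coord z j * (if n = Suc (m + j) then gain m j / 2 else 0)) sums
        (if m < n then gain m (n - 1 - m) / 2 * coord z (n - 1 - m) else 0)"
    proof (cases "m < n")
      case True
      then have "(\<lambda>j. coord z j * (if n = Suc (m + j) then gain m j / 2 else 0)) =
          (\<lambda>j. if j = n - 1 - m then gain m (n - 1 - m) / 2 * coord z (n - 1 - m) else 0)"
        by auto
      then show ?thesis
        using True sums_single[of "n - 1 - m" "\<lambda>_. gain m (n - 1 - m) / 2 * coord z (n - 1 - m)"] by simp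
    next
      case False
      then have "(\<lambda>j. coord z j * (if n = Suc (m + j) then gain m j / 2 else 0)) = (\<lambda>_. 0)"
        by auto
      then show ?thesis using False by simp
    qed
    have 2: "(\<lambda>j. coord z j * (if n = m then loss m j else 0)) sums (if m = n then \<Sum>j. loss n j * coord z j else 0)"
      using summable_sums[OF sl] by (auto simp: mult.commute)
    have "(\<lambda>j. coord z j * coord (coag m j) n) =
        (\<lambda>j. coord z j * (if n = Suc (m + j) then gain m j / 2 else 0) - coord z j * (if n = m then loss m j else 0))"
      by (auto simp: coag_def coord_unit)
    then show ?thesis
      using sums_unique[OF sums_diff[OF 1 2]] by simp
  qed
  let ?l = "\<Sum>j. loss n j * coord z j"
  have "(\<lambda>m. coord y m * (\<Sum>j. coord z j * coord (coag m j) n)) =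
      (\<lambda>m. (if m < n then gain m (n - 1 - m) / 2 * coord y m * coord z (n - 1 - m) else 0) - (if m = n then ?l * coord y n else 0))"
    unfolding inner by (auto simp: algebra_simps)
  moreover have "(\<lambda>m. if m < n then gain m (n - 1 - m) / 2 * coord y m * coord z (n - 1 - m) else 0)
      sums (\<Sum>m<n. gain m (n - 1 - m) / 2 * coord y m * coord z (n - 1 - m))"
    using sums_If_finite_set[of "{..<n}" "\<lambda>m. gain m (n - 1 - m) / 2 * coord y m * coord z (n - 1 - m)"] by simp
  ultimately have "(\<lambda>m. coord y m * (\<Sum>j. coord z j * coord (coag m j) n)) sums
      ((\<Sum>m<n. gain m (n - 1 - m) / 2 * coord y m * coord z (n - 1 - m)) - ?l * coord y n)"
    using sums_diff[OF _ sums_single[of n "\<lambda>_. ?l * coord y n"]] by simp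
  then show "coord (bil coag y z) n = (\<Sum>m<n. gain m (n - 1 - m) / 2 * coord y m * coord z (n - 1 - m)) - ?l * coord y n"
    by (simp add: coord_bil[OF norm_coag] sums_unique[symmetric])
qed

lemma coord_F:
  assumes "f \<in> Xsp wA"
  shows "w n * Fop k f (Suc n) = coord (bil coag (pack wA f) (pack wA f)) n"
proof -
  let ?y = "pack wA f"
  have y: "coord ?y m = wA (Suc m) * f (Suc m)" for m
    by (rule XA.coord_pack[OF assms])
  have "(\<Sum>j = 1..n. k (Suc n - j) j * f (Suc n - j) * f j) =
      (\<Sum>m<n. k (Suc m) (Suc (n - 1 - m)) * f (Suc m) * f (Suc (n - 1 - m)))"
    by (rule sum.reindex_bij_witness[of _ "\<lambda>m. n - m" "\<lambda>j. n - j"]) (auto simp: Suc_diff_le)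
  then have "w n * ((1 / 2) * (\<Sum>j = 1..n. k (Suc n - j) j * f (Suc n - j) * f j)) =
      (\<Sum>m<n. w n * k (Suc m) (Suc (n - 1 - m)) * f (Suc m) * f (Suc (n - 1 - m)) / 2)"
    by (simp add: sum_distrib_left mult_ac)
  also have "\<dots> = (\<Sum>m<n. gain m (n - 1 - m) / 2 * coord ?y m * coord ?y (n - 1 - m))"
  proof (rule sum.cong[OF refl])
    fix m assume m: "m \<in> {..<n}"
    then have "Suc (m + (n - 1 - m)) = n" by auto
    then show "w n * k (Suc m) (Suc (n - 1 - m)) * f (Suc m) * f (Suc (n - 1 - m)) / 2
        = gain m (n - 1 - m) / 2 * coord ?y m * coord ?y (n - 1 - m)"
      by (simp add: gain_def y)
  qed
  finally have 1: "w n * ((1 / 2) * (\<Sum>j = 1..n. k (Suc n - j) j * f (Suc n - j) * f j))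
      = (\<Sum>m<n. gain m (n - 1 - m) / 2 * coord ?y m * coord ?y (n - 1 - m))" .
  have "k (Suc n) (Suc j) * f (Suc n) * f (Suc j) = (coord ?y n / w n) * (loss n j * coord ?y j)" for j
    by (simp add: loss_def y)
  then have "(\<Sum>j. k (Suc n) (Suc j) * f (Suc n) * f (Suc j)) = (coord ?y n / w n) * (\<Sum>j. loss n j * coord ?y j)"
    by (simp only: suminf_mult[OF summable_loss])
  then have 2: "w n * (\<Sum>j. k (Suc n) (Suc j) * f (Suc n) * f (Suc j)) = (\<Sum>j. loss n j * coord ?y j) * coord ?y n"
    by simp
  show ?thesis
    unfolding coord_coag 1[symmetric] 2[symmetric] by (simp add: Fop_def right_diff_distrib)
qed

text \<open>Coagulation plus the damping removed from the linear part.
  \<open>\<gamma> *\<^sub>R y\<close> needs no weight: coordinates of y already carry the factor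
  \<open>\<tau> n powr \<alpha>\<close> relative to \<open>app J y\<close>.\<close>

definition N :: "ell1 \<Rightarrow> ell1" where
  "N y = bil coag y y + M *\<^sub>R app J y + \<gamma> *\<^sub>R y"

lemma rhs_pack:
  assumes "f \<in> Xsp w1"
  shows "(\<lambda>i. Yop a b g d s f i + Fop k f i) \<in> Xsp (wp p)"
    and "pack (wp p) (\<lambda>i. Yop a b g d s f i + Fop k f i) = Y (pack (wp p) f) + N (pack wA f)"
proof -
  note fA = X1_XA[OF assms]
  have "(\<lambda>i. Yop a b g d s f i + Fop k f i) \<in> Xsp (wp p) \<and>
      pack (wp p) (\<lambda>i. Yop a b g d s f i + Fop k f i) = Y (pack (wp p) f) + N (pack wA f)"
  proof (rule X.pack_eqI)
    fix n
    have "\<tau> n powr \<alpha> * coord (app J (pack wA f)) n = coord (pack wA f) n"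
      by (simp add: coord_J powr_minus)
    then show "w n * (Yop a b g d s f (Suc n) + Fop k f (Suc n)) = coord (Y (pack (wp p) f) + N (pack wA f)) n"
      unfolding distrib_left coord_Y[OF assms] coord_F[OF fA]
      by (simp add: N_def XA_X(2)[OF fA] distrib_right mult.assoc)
  qed (simp add: Yop_def Fop_def)
  then show "(\<lambda>i. Yop a b g d s f i + Fop k f i) \<in> Xsp (wp p)"
    "pack (wp p) (\<lambda>i. Yop a b g d s f i + Fop k f i) = Y (pack (wp p) f) + N (pack wA f)"
    by auto
qed

lemma N_lipschitz: "\<exists>L\<ge>0. lip_on r N L"
proof -
  let ?B = "2 powr p * (2 * \<kappa>) + 2 * \<kappa>"
  define L where "L = 2 * ?B * \<bar>r\<bar> + M * norm J + \<gamma>"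
  have "norm (N y - N z) \<le> L * norm (y - z)" if "norm y \<le> r" "norm z \<le> r" for y z
  proof -
    have r: "0 \<le> r" using that(1) norm_ge_zero order_trans by blast
    have eq: "N y - N z = (bil coag y y - bil coag z z) + M *\<^sub>R app J (y - z) + \<gamma> *\<^sub>R (y - z)"
      by (simp add: N_def app.diff_right scaleR_diff_right)
    have "norm (bil coag y y - bil coag z z) \<le> 2 * ?B * r * norm (y - z)"
      by (rule bil_lipschitz[OF norm_coag that])
    moreover have "norm (M *\<^sub>R app J (y - z)) \<le> M * norm J * norm (y - z)"
      using M norm_app[of J "y - z"] by (simp add: mult_left_mono mult.assoc)
    moreover have "norm (\<gamma> *\<^sub>R (y - z)) \<le> \<gamma> * norm (y - z)"
      using gamma by simp
    ultimately have "norm (N y - N z) \<le> 2 * ?B * r * norm (y - z) + M * norm J * norm (y - z) + \<gamma> * norm (y - z)"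
      unfolding eq by (intro norm_triangle_le add_mono)
    then show ?thesis
      using r by (simp add: L_def distrib_right)
  qed
  moreover have "0 \<le> L"
    using kappa M gamma by (simp add: L_def add_nonneg_nonneg)
  ultimately show ?thesis
    unfolding lip_on_def by blast
qed

text \<open>The loss rate of a state \<open>y\<close> in the \<open>r\<close>-ball is at most \<open>2 * \<kappa> * r\<close>, relative to the weight
  \<open>\<tau> powr \<alpha>\<close>; the extra damping \<open>\<gamma>\<close> in \<open>\<eta>\<close> compensates it.\<close>

lemma nonneg_N:
  assumes "2 * \<kappa> * r \<le> \<gamma>" "nonneg y" "norm y \<le> r"
  shows "nonneg (N y)"
  unfolding nonneg_def
proof
  fix n
  have y: "0 \<le> coord y m" for m using assms(2) by (simp add: nonneg_def)
  have "(\<Sum>j. loss n j * coord y j) \<le> (\<Sum>j. 2 * \<kappa> * \<bar>coord y j\<bar>)"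
    using gain_loss_bounds y
    by (intro suminf_le summable_loss summable_mult summable_coord) (simp add: mult_right_mono)
  also have "\<dots> = 2 * \<kappa> * norm y"
    unfolding norm_ell1_def by (rule suminf_mult[OF summable_coord])
  also have "\<dots> \<le> 2 * \<kappa> * r"
    using kappa assms(3) by (intro mult_left_mono) auto
  finally have "(\<Sum>j. loss n j * coord y j) * coord y n \<le> \<gamma> * coord y n"
    using assms(1) y by (intro mult_right_mono) auto
  moreover have "0 \<le> (\<Sum>m<n. gain m (n - 1 - m) / 2 * coord y m * coord y (n - 1 - m))"
    using gain_loss_bounds y by (intro sum_nonneg mult_nonneg_nonneg) auto
  moreover have "0 \<le> M * coord (app J y) n"
    using M nonneg_J[OF assms(2)] by (simp add: nonneg_def)
  ultimately show "0 \<le> coord (N y) n"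
    unfolding N_def by (simp add: coord_coag)
qed

text \<open>The fixed point lives in the ball of radius \<open>norm (pack wA f0) + 1\<close>, where
  \<open>gamma_ge\<close> makes N positive. By \<open>rhs_pack\<close> both shifts cancel, so the
  conclusion is free of M and \<gamma>.\<close>

lemma wellposed:
  assumes f0: "f0 \<in> Xpos wA" and gamma_ge: "2 * \<kappa> * (norm (pack wA f0) + 1) \<le> \<gamma>"
  shows "\<exists>T>0. \<exists>f. classical_sol a b g d s k p \<alpha> T f0 f
            \<and> (\<forall>t\<in>{0..T}. \<forall>i. 0 \<le> f t i)
            \<and> cont_in w1 {0<..<T} f
            \<and> (\<forall>h. classical_sol a b g d s k p \<alpha> T f0 h \<and> (\<forall>t\<in>{0..T}. \<forall>i. 0 \<le> h t i)
                   \<longrightarrow> (\<forall>t\<in>{0..T}. h t = f t))"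
proof -
  define y0 where "y0 = pack wA f0"
  have f0A: "f0 \<in> Xsp wA" and f0_nn: "\<And>i. 0 \<le> f0 i"
    using f0 by (auto simp: Xpos_def)
  have y0: "nonneg y0"
    using f0_nn XA.u_Suc by (simp add: nonneg_def y0_def XA.coord_pack[OF f0A] less_imp_le)
  have nn: "nonneg (N y)" if "nonneg y" "norm y \<le> norm y0 + 1" for y
    using nonneg_N[OF gamma_ge[folded y0_def] that] .
  obtain T y where T: "0 < T" and cy: "continuous_on {0..T} y" and y_0: "y 0 = y0"
    and y_nn: "\<And>t. t \<in> {0..T} \<Longrightarrow> nonneg (y t)"
    and yD: "\<And>t. t \<in> {0<..T} \<Longrightarrow> app J (y t) \<in> D" and cY: "continuous_on {0<..T} (\<lambda>t. Y (app J (y t)))"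
    and y': "\<And>t. t \<in> {0<..<T} \<Longrightarrow> ((\<lambda>t. app J (y t)) has_vector_derivative (Y (app J (y t)) + N (y t))) (at t)"
    and uniq: "\<forall>z. continuous_on {0..T} z \<longrightarrow> z 0 = y0 \<longrightarrow> (\<forall>t\<in>{0<..<T}. app J (z t) \<in> D \<and>
       ((\<lambda>t. app J (z t)) has_vector_derivative (Y (app J (z t)) + N (z t))) (at t)) \<longrightarrow> (\<forall>t\<in>{0..T}. z t = y t)"
    and cN: "continuous_on {0..T} (\<lambda>t. N (y t))"
  proof (rule semilinear_wellposed[OF N_lipschitz refl _ y0])
    show "nonneg (N y)" if "nonneg y" "norm y \<le> norm y0 + 1" for y
      by (rule nn[OF that])
  qed (rule that)
  define f where "f t = unpack wA (y t)" for t
  define F where "F t = (\<lambda>i. Yop a b g d s (f t) i + Fop k (f t) i)" for t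
  have fA: "f t \<in> Xsp wA" and pA: "pack wA (f t) = y t" for t
    by (simp_all add: f_def XA.unpack_Xsp XA.pack_unpack)
  have fX: "f t \<in> Xsp (wp p)" and pX: "pack (wp p) (f t) = app J (y t)" for t
    using XA_X[OF fA[of t]] by (simp_all add: pA)
  have f1: "f t \<in> Xsp w1" if "t \<in> {0<..<T}" for t
    using X1_iff[OF fX] yD[of t] that by (simp add: pX)
  have FX: "F t \<in> Xsp (wp p)" "pack (wp p) (F t) = Y (app J (y t)) + N (y t)" if "t \<in> {0<..<T}" for t
    using rhs_pack[OF f1[OF that]] by (simp_all add: F_def pA pX)
  have deriv: "has_deriv_in (wp p) f (F t) t" if t: "t \<in> {0<..<T}" for t
    using y'[OF t] by (subst X.has_deriv_in_iff[of "{0<..<T}", OF _ t fX FX(1)[OF t]]) (simp_all add: pX FX(2)[OF t] t)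
  have cJ: "continuous_on {0..T} (\<lambda>t. app J (y t))"
    by (intro app.continuous_on continuous_on_const cy)
  have cF: "continuous_on {0<..<T} (\<lambda>t. Y (app J (y t)))"
    by (rule continuous_on_subset[OF cY]) auto
  have "continuous_on {0<..<T} (\<lambda>t. Y (app J (y t)) + N (y t))"
    by (intro continuous_on_add cF continuous_on_subset[OF cN]) auto
  then have "continuous_on {0<..<T} (\<lambda>t. pack (wp p) (F t))"
    by (rule continuous_on_eq) (simp add: FX)
  then have "cont_in (wp p) {0<..<T} F"
    using X.cont_in_iff[of "{0<..<T}" F] FX(1) by simp
  moreover have "cont_in (wp p) {0<..<T} f"
    using continuous_on_subset[OF cJ, of "{0<..<T}"] by (simp add: X.cont_in_iff fX pX subset_eq)
  ultimately have "C1_in (wp p) {0<..<T} f"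
    unfolding C1_in_def using deriv fX FX(1) by blast
  moreover have "f 0 = f0"
    using XA.unpack_pack[OF f0A] by (simp add: f_def y_0 y0_def)
  moreover have "cont_in wA {0..T} f"
    using cy by (simp add: XA.cont_in_iff fA pA)
  ultimately have sol: "classical_sol a b g d s k p \<alpha> T f0 f"
    using deriv f1 fA by (simp add: classical_sol_def F_def)
  have nn: "\<forall>t\<in>{0..T}. \<forall>i. 0 \<le> f t i"
  proof (intro ballI allI)
    fix t i assume t: "t \<in> {0..T}"
    have "0 \<le> wA i" by (simp add: wpb_def)
    then show "0 \<le> f t i"
      using y_nn[OF t] by (simp add: f_def unpack_def nonneg_def)
  qed
  \<comment> \<open>\<open>norm_Y_ge\<close> bounds distances in X_{p,1} by 1/c times the distance
    of the images under Y, and these images are continuous in time.\<close>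
  have c1: "cont_in w1 {0<..<T} f"
  proof (subst X1.cont_in_iff[OF f1])
    show "continuous_on {0<..<T} (\<lambda>t. pack w1 (f t))"
      unfolding continuous_on_def
    proof
      fix t assume t: "t \<in> {0<..<T}"
      have "((\<lambda>s. pack w1 (f s) - pack w1 (f t)) \<longlongrightarrow> 0) (at t within {0<..<T})"
      proof (rule tendsto_norm_zero_cancel, rule tendsto_sandwich[of "\<lambda>_. 0"])
        have "((\<lambda>s. norm (Y (app J (y s)) - Y (app J (y t))) / c) \<longlongrightarrow> norm (Y (app J (y t)) - Y (app J (y t))) / c) (at t within {0<..<T})"
          using cF t c unfolding continuous_on_def by (intro tendsto_intros) auto
        then show "((\<lambda>s. norm (Y (app J (y s)) - Y (app J (y t))) / c) \<longlongrightarrow> 0) (at t within {0<..<T})"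
          by simp
        have "norm (pack w1 (f s) - pack w1 (f t)) \<le> norm (Y (app J (y s)) - Y (app J (y t))) / c" if s: "s \<in> {0<..<T}" for s
        proof -
          note d = X1.pack_diff[OF f1[OF s] f1[OF t]]
          have "norm (pack w1 (f s) - pack w1 (f t)) = tnorm (app J (y s) - app J (y t))"
            using norm_pack_X1[OF d(1)] d(2) X.pack_diff(2)[OF fX fX, of s t] by (simp add: pX)
          moreover have dY: "app J (y s) - app J (y t) \<in> D \<and> Y (app J (y s) - app J (y t)) = Y (app J (y s)) - Y (app J (y t))"
            using yD s t by (intro D_Y_diff) auto
          ultimately show ?thesis
            using norm_Y_ge[OF conjunct1[OF dY]] c
            unfolding conjunct2[OF dY] by (simp add: pos_le_divide_eq mult.commute)
        qed
        then show "\<forall>\<^sub>F s in at t within {0<..<T}. norm (pack w1 (f s) - pack w1 (f t))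
            \<le> norm (Y (app J (y s)) - Y (app J (y t))) / c"
          by (auto simp: eventually_at_filter intro!: always_eventually)
      qed auto
      then show "((\<lambda>s. pack w1 (f s)) \<longlongrightarrow> pack w1 (f t)) (at t within {0<..<T})"
        by (rule LIM_zero_cancel)
    qed
  qed
  \<comment> \<open>In packed coordinates a classical solution solves the shifted semilinear
    equation, to which \<open>uniq\<close> applies.\<close>
  have "h t = f t" if h: "classical_sol a b g d s k p \<alpha> T f0 h" and t: "t \<in> {0..T}" for h t
  proof -
    have hA: "\<And>t. t \<in> {0..T} \<Longrightarrow> h t \<in> Xsp wA" and hc: "cont_in wA {0..T} h"
      and h1: "\<And>t. t \<in> {0<..<T} \<Longrightarrow> h t \<in> Xsp w1"
      and h': "\<And>t. t \<in> {0<..<T} \<Longrightarrow> has_deriv_in (wp p) h (\<lambda>i. Yop a b g d s (h t) i + Fop k (h t) i) t"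
      and h0: "h 0 = f0"
      using h by (auto simp: classical_sol_def)
    have J: "pack (wp p) (h t) = app J (pack wA (h t))" "h t \<in> Xsp (wp p)" if "t \<in> {0..T}" for t
      using XA_X[OF hA[OF that]] by auto
    have "pack wA (h t) = y t"
    proof (rule uniq[rule_format, OF _ _ _ t])
      show "continuous_on {0..T} (\<lambda>t. pack wA (h t))"
        by (rule iffD1[OF XA.cont_in_iff hc]) (rule hA)
      show "pack wA (h 0) = y0"
        by (simp add: h0 y0_def)
      fix t assume t: "t \<in> {0<..<T}"
      then have tT: "t \<in> {0..T}" by auto
      have "app J (pack wA (h t)) \<in> D"
        using X1_iff[OF J(2)[OF tT]] h1[OF t] J(1)[OF tT] by simp
      moreover have "((\<lambda>t. pack (wp p) (h t)) has_vector_derivative (Y (pack (wp p) (h t)) + N (pack wA (h t)))) (at t)"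
        unfolding rhs_pack(2)[OF h1[OF t], symmetric]
        by (rule iffD1[OF X.has_deriv_in_iff[OF _ t] h'[OF t]]) (use J(2) rhs_pack(1)[OF h1[OF t]] in auto)
      then have "((\<lambda>t. pack (wp p) (h t)) has_vector_derivative (Y (app J (pack wA (h t))) + N (pack wA (h t)))) (at t)"
        using J(1)[OF tT] by simp
      then have "((\<lambda>t. app J (pack wA (h t))) has_vector_derivative (Y (app J (pack wA (h t))) + N (pack wA (h t)))) (at t)"
        by (rule has_vector_derivative_transform_within_open[of _ _ _ "{0<..<T}"]) (use t J(1) in auto)
      ultimately show "app J (pack wA (h t)) \<in> D \<and> ((\<lambda>t. app J (pack wA (h t))) has_vector_derivative
          (Y (app J (pack wA (h t))) + N (pack wA (h t)))) (at t)"
        by blast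
    qed
    then show ?thesis
      using XA.unpack_pack[OF hA[OF t]] by (simp add: f_def)
  qed
  then show ?thesis
    using T sol nn c1 by blast
qed

end

theorem theorem3p4:
  fixes g d s a :: "nat \<Rightarrow> real" and b k :: "nat \<Rightarrow> nat \<Rightarrow> real"
    and \<kappa> \<alpha> p :: real and f0 :: "nat \<Rightarrow> real"
  assumes g_nn: "\<forall>i\<ge>1. 0 \<le> g i" and d_nn: "\<forall>i\<ge>1. 0 \<le> d i"
    and s_nn: "\<forall>i\<ge>1. 0 \<le> s i" and a_nn: "\<forall>i\<ge>1. 0 \<le> a i"
    and b_nn: "\<forall>i\<ge>1. \<forall>j\<ge>1. 0 \<le> b i j" and k_nn: "\<forall>i\<ge>1. \<forall>j\<ge>1. 0 \<le> k i j"
    and a1: "a 1 = 0" and a_pos: "\<forall>i\<ge>2. 0 < a i"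
    and b_zero: "\<forall>i\<ge>1. \<forall>j\<ge>1. j \<le> i \<longrightarrow> b i j = 0"
    and b_mass: "\<forall>j\<ge>2. (\<Sum>i = 1..j - 1. real i * b i j) = real j"
    and g0: "g 0 = 0"
    and A: "\<exists>p0>1. Liminf sequentially
              (\<lambda>i. ereal (a i / theta a g d s i * (Delta b p0 i / real i powr p0))) > 0"
    and K: "\<kappa> > 0" "0 < \<alpha>" "\<alpha> < 1"
       "\<forall>i\<ge>1. \<forall>j\<ge>1. k i j \<le> \<kappa> * ((1 + theta a g d s i) powr \<alpha> + (1 + theta a g d s j) powr \<alpha>)"
    and p: "p > 1"
    and f0: "f0 \<in> Xpos (wpb p \<alpha> (theta a g d s))"
  shows "\<exists>T>0. \<exists>f. classical_sol a b g d s k p \<alpha> T f0 f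
            \<and> (\<forall>t\<in>{0..T}. \<forall>i. 0 \<le> f t i)
            \<and> cont_in (wpb p 1 (theta a g d s)) {0<..<T} f
            \<and> (\<forall>h. classical_sol a b g d s k p \<alpha> T f0 h \<and> (\<forall>t\<in>{0..T}. \<forall>i. 0 \<le> h t i)
                   \<longrightarrow> (\<forall>t\<in>{0..T}. h t = f t))"
proof -
  obtain q where q: "1 < q"
    and Aq: "Liminf sequentially (\<lambda>i. ereal (a i / theta a g d s i * (Delta b q i / real i powr q))) > 0"
    using A by blast
  have "\<exists>c>0. \<exists>M\<ge>0. \<forall>i\<ge>1. g i * ((real i + 1) powr p / real i powr p) + d i + a i
      - a i * (Delta b p i / real i powr p) \<le> theta a g d s i + M - c * (1 + theta a g d s i)"
    by (rule column_bound[OF _ _ _ _ _ _ q Aq p]) (use g_nn d_nn s_nn a_pos b_nn b_mass in simp_all)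
  then obtain c M where cM: "0 < c" "0 \<le> M" and column: "\<And>i. 1 \<le> i \<Longrightarrow>
      g i * ((real i + 1) powr p / real i powr p) + d i + a i
      - a i * (Delta b p i / real i powr p) \<le> theta a g d s i + M - c * (1 + theta a g d s i)"
    by blast
  \<comment> \<open>Chosen after c and M, which do not depend on it: the loss rate 2 \<kappa> r on
    the ball of radius r, the norm of the datum plus 1.\<close>
  define \<gamma> where "\<gamma> = 2 * \<kappa> * (norm (pack (wpb p \<alpha> (theta a g d s)) f0) + 1)"
  interpret coagulation_fragmentation g d s a b k \<kappa> \<alpha> p c M \<gamma>
  proof
    show "0 \<le> \<gamma>" using K(1) by (simp add: \<gamma>_def)
  qed (use g_nn d_nn s_nn a_nn b_nn k_nn g0 K p cM column in blast)+
  show ?thesis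
    by (rule wellposed[OF f0]) (simp add: \<gamma>_def)
qed

end
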